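(* Let $\gamma>0$ and let $p^s(t,x,dy)$ be the transition kernel of the Brownian motion $B^s$ on $\mathbb{R}_+$ with sticky origin and stickiness parameter $\gamma$. Then for $t>0$, $x,y\in\mathbb{R}_+$, $$p^s(t,x,dy)=p^D(t,x,y)\,dy+2g_{0,\gamma}(t,x+y)\,dy+\gamma\,g_{0,\gamma}(t,x)\,\varepsilon_0(dy),$$ where $\varepsilon_0$ is the Dirac measure at $0$, $$p^D(t,x,y)=\frac{1}{\sqrt{2\pi t}}\Bigl(e^{-(x-y)^2/2t}-e^{-(x+y)^2/2t}\Bigr),$$ and $$g_{0,\gamma}(t,x)=\frac1\gamma\exp\Bigl(\frac{2x}{\gamma}+\frac{2t}{\gamma^2}\Bigr)\operatorname{erfc}\Bigl(\frac{x}{\sqrt{2t}}+\frac{\sqrt{2t}}{\gamma}\Bigr),\qquad t>0,\ x\ge0.$$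
   Context: Setting. $(\Omega,\mathcal{A})$ is a measurable space with probability measures $(P_x,\,x\in\mathbb{R})$ and a right continuous filtration $\mathcal{F}=(\mathcal{F}_t,\,t\ge0)$, complete with respect to $(P_x)$; $B=(B_t,\,t\ge0)$ is a standard one-dimensional Brownian motion relative to $\mathcal{F}$ with $P_x(B_0=x)=1$, equipped with shift operators $\theta_t:\Omega\to\Omega$ with $B_s\circ\theta_t=B_{s+t}$. $L=(L_t,\,t\ge0)$ is the local time of $B$ at $0$, normalized so that Tanaka's formula reads $d|B_t|=\operatorname{sign}(B_t)\,dB_t+dL_t$. All paths of $B$ and $L$ are continuous. Sticky Brownian motion. For $\gamma>0$ let $\tau^{-1}(t)=t+\gamma L_t$, $t\ge0$; this is a strictly increasing continuous bijection of $\mathbb{R}_+=[0,+\infty)$ and $\tau$ denotes its inverse. Put $B^s_t=|B_{\tau(t)}|$, $t\ge0$. The transition kernel is $p^s(t,x,dy)=P_x(B^s_t\in dy)$ for $x\in\mathbb{R}_+$, a measure on $\mathbb{R}_+$. $\operatorname{erfc}(z)=\frac{2}{\sqrt\pi}\int_z^\infty e^{-u^2}\,du$. *)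

theory Defs
  imports "HOL-Probability.Probability"
begin

section \<open>Brownian motion with a family of starting points\<close>

text \<open>
  Only times \<open>t \<ge> 0\<close> are meaningful; values of \<open>F\<close>, \<open>B\<close>, \<open>\<theta>\<close>, \<open>L\<close> at negative times are
  unconstrained and never used.  \<open>A\<close> carries the measurable space; its measure part plays no role.
  Completeness with respect to the family \<open>P\<close> means that sets which are negligible for
  every \<open>P x\<close> belong to \<open>F 0\<close>.
\<close>

locale brownian_family =
  fixes A :: "'a measure"
    and P :: "real \<Rightarrow> 'a measure"
    and F :: "real \<Rightarrow> 'a measure"
    and B :: "real \<Rightarrow> 'a \<Rightarrow> real"
    and \<theta> :: "real \<Rightarrow> 'a \<Rightarrow> 'a"
  assumes prob_space_P: "\<And>x. prob_space (P x)"
    and sets_P: "\<And>x. sets (P x) = sets A"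
    and subalgebra_F: "\<And>t. 0 \<le> t \<Longrightarrow> subalgebra A (F t)"
    and F_mono: "\<And>s t. 0 \<le> s \<Longrightarrow> s \<le> t \<Longrightarrow> sets (F s) \<subseteq> sets (F t)"
    and F_right_continuous: "\<And>t. 0 \<le> t \<Longrightarrow> sets (F t) = (\<Inter>s\<in>{t<..}. sets (F s))"
    and F_complete:
      "\<And>N Z. N \<subseteq> Z \<Longrightarrow> Z \<in> sets A \<Longrightarrow> (\<And>x. emeasure (P x) Z = 0) \<Longrightarrow> N \<in> sets (F 0)"
    and B_adapted: "\<And>t. 0 \<le> t \<Longrightarrow> B t \<in> borel_measurable (F t)"
    and B_continuous: "\<And>\<omega>. \<omega> \<in> space A \<Longrightarrow> continuous_on {0..} (\<lambda>t. B t \<omega>)"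
    and B_start: "\<And>x. AE \<omega> in P x. B 0 \<omega> = x"
    and B_increment_normal:
      "\<And>x s t. 0 \<le> s \<Longrightarrow> s < t \<Longrightarrow>
         distributed (P x) lborel (\<lambda>\<omega>. B t \<omega> - B s \<omega>) (normal_density 0 (sqrt (t - s)))"
    and B_increment_indep:
      "\<And>x s t. 0 \<le> s \<Longrightarrow> s < t \<Longrightarrow>
         prob_space.indep_set (P x) (sets (F s))
           (sets (vimage_algebra (space A) (\<lambda>\<omega>. B t \<omega> - B s \<omega>) borel))"
    and shift_space: "\<And>t \<omega>. 0 \<le> t \<Longrightarrow> \<omega> \<in> space A \<Longrightarrow> \<theta> t \<omega> \<in> space A"
    and B_shift: "\<And>s t \<omega>. 0 \<le> s \<Longrightarrow> 0 \<le> t \<Longrightarrow> \<omega> \<in> space A \<Longrightarrow> B s (\<theta> t \<omega>) = B (s + t) \<omega>"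

section \<open>The \<open>L\<^sup>2\<close> It\^o integral with respect to a Brownian motion\<close>

text \<open>
  A simple integrand \<open>\<Sum>i<n. \<xi>\<^sub>i 1\<^bsub>(T\<^sub>i, T\<^sub>i\<^sub>+\<^sub>1]\<^esub>\<close> with bounded \<open>F (T\<^sub>i)\<close>-measurable \<open>\<xi>\<^sub>i\<close> is given
  by the data \<open>n\<close>, \<open>T\<close>, \<open>\<xi>\<close>.
\<close>

definition simple_integrand ::
    "(real \<Rightarrow> 'a measure) \<Rightarrow> nat \<Rightarrow> (nat \<Rightarrow> real) \<Rightarrow> (nat \<Rightarrow> 'a \<Rightarrow> real) \<Rightarrow> bool" where
  "simple_integrand F n T \<xi> \<longleftrightarrow>
     0 \<le> T 0 \<and> (\<forall>i<n. T i \<le> T (Suc i)) \<and>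
     (\<forall>i<n. \<xi> i \<in> borel_measurable (F (T i)) \<and> bounded (\<xi> i ` space (F (T i))))"

definition simple_value ::
    "nat \<Rightarrow> (nat \<Rightarrow> real) \<Rightarrow> (nat \<Rightarrow> 'a \<Rightarrow> real) \<Rightarrow> real \<Rightarrow> 'a \<Rightarrow> real" where
  "simple_value n T \<xi> s \<omega> = (\<Sum>i<n. \<xi> i \<omega> * indicator {T i<..T (Suc i)} s)"

definition simple_integral ::
    "(real \<Rightarrow> 'a \<Rightarrow> real) \<Rightarrow> nat \<Rightarrow> (nat \<Rightarrow> real) \<Rightarrow> (nat \<Rightarrow> 'a \<Rightarrow> real) \<Rightarrow> real \<Rightarrow> 'a \<Rightarrow> real" where
  "simple_integral B n T \<xi> t \<omega> =
     (\<Sum>i<n. \<xi> i \<omega> * (B (min t (T (Suc i))) \<omega> - B (min t (T i)) \<omega>))"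

text \<open>
  \<open>is_ito_integral M F B H I\<close>: for the progressively measurable integrand \<open>H\<close>, the adapted process
  \<open>I\<close> is a version of \<open>t \<mapsto> \<integral>\<^sub>0\<^sup>t H dB\<close> under \<open>M\<close>, i.e. the \<open>L\<^sup>2\<close>-limit of the integrals
  of simple integrands converging to \<open>H\<close> in \<open>L\<^sup>2(ds \<otimes> M)\<close> on every \<open>[0, t]\<close>.
\<close>

definition is_ito_integral ::
    "'a measure \<Rightarrow> (real \<Rightarrow> 'a measure) \<Rightarrow> (real \<Rightarrow> 'a \<Rightarrow> real) \<Rightarrow>
     (real \<Rightarrow> 'a \<Rightarrow> real) \<Rightarrow> (real \<Rightarrow> 'a \<Rightarrow> real) \<Rightarrow> bool" where
  "is_ito_integral M F B H I \<longleftrightarrow>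
     (\<forall>t\<ge>0. (\<lambda>(s, \<omega>). H s \<omega>) \<in>
        borel_measurable (restrict_space borel {0..t} \<Otimes>\<^sub>M F t)) \<and>
     (\<forall>t\<ge>0. I t \<in> borel_measurable (F t)) \<and>
     (\<exists>n T \<xi>.
        (\<forall>k. simple_integrand F (n k) (T k) (\<xi> k)) \<and>
        (\<forall>t\<ge>0. (\<lambda>k. \<integral>\<^sup>+\<omega>. (\<integral>\<^sup>+s\<in>{0..t}.
             ennreal ((simple_value (n k) (T k) (\<xi> k) s \<omega> - H s \<omega>)\<^sup>2) \<partial>lborel) \<partial>M) \<longlonglongrightarrow> 0) \<and>
        (\<forall>t\<ge>0. (\<lambda>k. \<integral>\<^sup>+\<omega>.
             ennreal ((simple_integral B (n k) (T k) (\<xi> k) t \<omega> - I t \<omega>)\<^sup>2) \<partial>M) \<longlonglongrightarrow> 0))"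

section \<open>Local time at the origin\<close>

text \<open>
  Tanaka's formula determines \<open>L\<close> up to indistinguishability and fixes its normalization.
  The value of \<open>sgn\<close> at \<open>0\<close> is immaterial, since \<open>{s. B\<^sub>s = 0}\<close> is almost surely a Lebesgue null set.
\<close>

locale brownian_local_time = brownian_family +
  fixes L :: "real \<Rightarrow> 'a \<Rightarrow> real"
  assumes L_adapted: "\<And>t. 0 \<le> t \<Longrightarrow> L t \<in> borel_measurable (F t)"
    and L_continuous: "\<And>\<omega>. \<omega> \<in> space A \<Longrightarrow> continuous_on {0..} (\<lambda>t. L t \<omega>)"
    and L_zero: "\<And>\<omega>. \<omega> \<in> space A \<Longrightarrow> L 0 \<omega> = 0"
    and L_mono: "\<And>\<omega>. \<omega> \<in> space A \<Longrightarrow> mono_on {0..} (\<lambda>t. L t \<omega>)"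
    and tanaka:
      "\<And>x. \<exists>I. is_ito_integral (P x) F B (\<lambda>s \<omega>. sgn (B s \<omega>)) I \<and>
           (\<forall>t\<ge>0. AE \<omega> in P x. \<bar>B t \<omega>\<bar> = \<bar>B 0 \<omega>\<bar> + I t \<omega> + L t \<omega>)"

section \<open>Sticky Brownian motion\<close>

definition sticky_clock :: "(real \<Rightarrow> 'a \<Rightarrow> real) \<Rightarrow> real \<Rightarrow> real \<Rightarrow> 'a \<Rightarrow> real" where
  "sticky_clock L \<gamma> t \<omega> = the_inv_into {0..} (\<lambda>s. s + \<gamma> * L s \<omega>) t"

definition sticky_bm ::
    "(real \<Rightarrow> 'a \<Rightarrow> real) \<Rightarrow> (real \<Rightarrow> 'a \<Rightarrow> real) \<Rightarrow> real \<Rightarrow> real \<Rightarrow> 'a \<Rightarrow> real" where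
  "sticky_bm B L \<gamma> t \<omega> = \<bar>B (sticky_clock L \<gamma> t \<omega>) \<omega>\<bar>"

definition sticky_kernel ::
    "(real \<Rightarrow> 'a measure) \<Rightarrow> (real \<Rightarrow> 'a \<Rightarrow> real) \<Rightarrow> (real \<Rightarrow> 'a \<Rightarrow> real) \<Rightarrow>
     real \<Rightarrow> real \<Rightarrow> real \<Rightarrow> real measure" where
  "sticky_kernel P B L \<gamma> t x = distr (P x) (restrict_space borel {0..}) (sticky_bm B L \<gamma> t)"

section \<open>The explicit densities\<close>

definition erfc :: "real \<Rightarrow> real" where
  "erfc z = 2 / sqrt pi * (LINT u:{z..}|lborel. exp (- u\<^sup>2))"

definition dirichlet_kernel :: "real \<Rightarrow> real \<Rightarrow> real \<Rightarrow> real" where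
  "dirichlet_kernel t x y =
     1 / sqrt (2 * pi * t) * (exp (- (x - y)\<^sup>2 / (2 * t)) - exp (- (x + y)\<^sup>2 / (2 * t)))"

definition g0 :: "real \<Rightarrow> real \<Rightarrow> real \<Rightarrow> real" where
  "g0 \<gamma> t x =
     1 / \<gamma> * exp (2 * x / \<gamma> + 2 * t / \<gamma>\<^sup>2) * erfc (x / sqrt (2 * t) + sqrt (2 * t) / \<gamma>)"

end

theory Submission
  imports Defs
begin

text \<open>
  For real \<open>k\<close> the function \<open>\<psi> y = cos (k y) - (\<gamma> k / 2) sin (k y)\<close> satisfies \<open>\<psi>'' = - k\<^sup>2 \<psi>\<close> and
  the boundary condition \<open>\<psi>' 0 = - (\<gamma> k\<^sup>2 / 2) \<psi> 0\<close> of the sticky semigroup, so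
  \<open>exp (k\<^sup>2/2 (r + \<gamma> L\<^sub>r)) \<psi> \<bar>B\<^sub>r\<bar>\<close> is a local martingale, bounded up to the time at which the clock
  \<open>r + \<gamma> L\<^sub>r\<close> reaches \<open>t\<close>; hence \<open>E \<psi> (B\<^sup>s\<^sub>t) = exp (- k\<^sup>2 t / 2) \<psi> x\<close>.  This is obtained by
  telescoping along a grid: Tanaka's formula enters only as \<open>E Z dL = E Z d\<bar>B\<bar>\<close> for bounded adapted
  \<open>Z\<close>, which cancels the kink of \<open>\<psi> \<bar>b\<bar>\<close> at \<open>0\<close>, and in the fact that \<open>L\<close> only grows at zeros of
  \<open>B\<close>.  The claimed kernel has the same transform because \<open>g = g0 \<gamma> t\<close> solves \<open>g - (\<gamma>/2) g' = \<phi>\<close>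
  with \<open>\<phi>\<close> the centred Gaussian density of variance \<open>t\<close>.  Finally the integrals of all the \<open>\<psi>\<close>
  determine a law on the half-line: adding an independent exponential variable of mean \<open>\<gamma>/2\<close> and a
  random sign turns them into a characteristic function.
\<close>

section \<open>Pathwise limits along a grid\<close>

text \<open>The sine coefficient is forced: with \<open>c = k^2 / 2\<close> the exponential
  contributes \<open>c * \<gamma> * \<psi> 0\<close> per unit of local time and \<psi> itself
  contributes \<open>\<psi>' 0\<close>, so the two cancel exactly when
  \<open>\<psi>' 0 = - \<gamma> * k^2 / 2\<close>. The exponential grows with the clock, so the
  argument has to stop when the clock reaches \<open>t\<close>. That happens at a random time,
  whereas Tanaka's formula speaks of L2 limits at fixed times. A deterministic grid on
  \<open>[0, t]\<close> resolves this: a step counts when the clock at its left end is below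
  \<open>t\<close>, an event known at that time, and capping the clock at \<open>t\<close> bounds
  every weight by \<open>exp (c * t)\<close> and makes the final one equal to it. Three errors
  remain. The finite variation errors vanish pathwise under an integrable bound. The Taylor
  remainders, of order \<open>n powr (-3/2)\<close> per step, add up to order
  \<open>n powr (-1/2)\<close>. Finally, the clock term carries \<psi> at the current position where
  the cancellation asks for \<open>\<psi> 0\<close>; this is harmless only through a quantitative
  form of the fact that \<open>L\<close> grows at zeros of \<open>B\<close>.\<close>

definition grid :: "real \<Rightarrow> nat \<Rightarrow> nat \<Rightarrow> real" where
  "grid t n i = t * real i / real n"

lemma grid_0 [simp]: "grid t n 0 = 0"
  and grid_self: "0 < n \<Longrightarrow> grid t n n = t"
  and grid_nonneg: "0 \<le> t \<Longrightarrow> 0 \<le> grid t n i"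
  and grid_le_Suc: "0 \<le> t \<Longrightarrow> grid t n i \<le> grid t n (Suc i)"
  and grid_step: "grid t n (Suc i) - grid t n i = t / real n"
  by (auto simp: grid_def algebra_simps add_divide_distrib intro!: divide_right_mono mult_left_mono)

lemma grid_le: "0 \<le> t \<Longrightarrow> i \<le> n \<Longrightarrow> grid t n i \<le> t"
  by (cases "n = 0") (auto simp: grid_def field_simps intro!: mult_left_mono)


text \<open>The kept indices form an initial segment, so the sum telescopes up to \<open>N\<close>,
  the index of the first grid point that is not before \<open>T\<close>. There the capped clock
  equals \<open>t\<close> exactly, so the only discretisation error is that \<open>p\<close> is
  evaluated up to \<open>t / n\<close> too late.\<close>

lemma stopped_telescope:
  fixes a p :: "real \<Rightarrow> real" and c t T :: real
  assumes "0 < t" and T: "0 \<le> T" "T \<le> t" and aT: "a T = t" and a0: "a 0 = 0"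
    and a: "strict_mono_on {0..} a" and n: "0 < n"
  obtains N :: nat where "T \<le> grid t n N" "grid t n N \<le> T + t / n" "N \<le> n"
    "\<And>i. a (grid t n i) < t \<longleftrightarrow> i < N"
    "(\<Sum>i<n. if a (grid t n i) < t
        then exp (c * min (a (grid t n (Suc i))) t) * p (grid t n (Suc i))
           - exp (c * min (a (grid t n i)) t) * p (grid t n i) else 0)
     = exp (c * t) * p (grid t n N) - p 0"
proof -
  define N where "N = nat \<lceil>n * T / t\<rceil>"
  have N: "n * T / t \<le> N" "real N < n * T / t + 1"
    using assms by (auto simp: N_def) (smt (verit) divide_nonneg_nonneg mult_nonneg_nonneg of_int_ceiling_le_add_one of_nat_0_le_iff of_nat_nat ceiling_correct zero_le_ceiling)+
  have N1: "T \<le> grid t n N" "grid t n N \<le> T + t / n"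
    using N n \<open>0 < t\<close> by (auto simp: grid_def field_simps)
  have "n * T / t \<le> n" using T n \<open>0 < t\<close> by (simp add: field_simps)
  then have N2: "N \<le> n" by (simp add: N_def nat_le_iff ceiling_le_iff)
  have lt: "a r < t \<longleftrightarrow> r < T" if "0 \<le> r" for r
    using strict_mono_on_less[OF a, of r T] that T aT by simp
  have ind: "a (grid t n i) < t \<longleftrightarrow> i < N" for i
  proof -
    have "a (grid t n i) < t \<longleftrightarrow> grid t n i < T"
      using lt[of "grid t n i"] grid_nonneg[of t] \<open>0 < t\<close> by simp
    also have "\<dots> \<longleftrightarrow> real i < n * T / t" using n \<open>0 < t\<close> by (simp add: grid_def field_simps)
    also have "\<dots> \<longleftrightarrow> i < N"
      by (simp add: N_def zless_nat_eq_int_zless less_ceiling_iff)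
    finally show ?thesis .
  qed
  let ?M = "\<lambda>i. exp (c * min (a (grid t n i)) t) * p (grid t n i)"
  have "(\<Sum>i<n. if a (grid t n i) < t then ?M (Suc i) - ?M i else 0)
      = (\<Sum>i<N. ?M (Suc i) - ?M i)"
    using N2 by (intro sum.mono_neutral_cong_right) (auto simp: ind)
  also have "\<dots> = ?M N - ?M 0" by (rule sum_lessThan_telescope)
  also have "\<dots> = exp (c * t) * p (grid t n N) - p 0"
  proof -
    have "t \<le> a (grid t n N)" using ind[of N] by simp
    then show ?thesis using a0 \<open>0 < t\<close> by (simp add: min_def)
  qed
  finally show ?thesis using that N1 N2 ind by blast
qed

text \<open>Only continuity of \<open>p\<close> is at stake, because the exponential weights at both
  ends are already exact. The case \<open>c = 0\<close> is also of use: it gives stopped increments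
  of \<open>p\<close> alone.\<close>

lemma stopped_sum_tendsto:
  fixes a p :: "real \<Rightarrow> real" and c t T :: real
  assumes "0 < t" "0 \<le> T" "T \<le> t" "a T = t" "a 0 = 0" "strict_mono_on {0..} a"
    and p: "continuous_on {0..t} p"
  shows "(\<lambda>n. \<Sum>i<n. if a (grid t n i) < t
        then exp (c * min (a (grid t n (Suc i))) t) * p (grid t n (Suc i))
           - exp (c * min (a (grid t n i)) t) * p (grid t n i) else 0)
     \<longlonglongrightarrow> exp (c * t) * p T - p 0"
proof -
  define S where "S = (\<lambda>n. \<Sum>i<n. if a (grid t n i) < t
        then exp (c * min (a (grid t n (Suc i))) t) * p (grid t n (Suc i))
           - exp (c * min (a (grid t n i)) t) * p (grid t n i) else 0)"
  \<comment> \<open>The premise \<open>0 < n\<close> sits under the quantifier so that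
    \<open>N\<close> can be chosen as a total function of \<open>n\<close>.\<close>
  have "\<exists>N. 0 < n \<longrightarrow> T \<le> grid t n N \<and> grid t n N \<le> T + t / n \<and> N \<le> n \<and>
    S n = exp (c * t) * p (grid t n N) - p 0" for n
  proof (cases "0 < n")
    case True
    show ?thesis
      by (rule stopped_telescope[OF assms(1-6) True, of c p]) (auto simp: S_def)
  qed simp
  then obtain N :: "nat \<Rightarrow> nat" where N: "\<And>n. 0 < n \<Longrightarrow> T \<le> grid t n (N n)"
    "\<And>n. 0 < n \<Longrightarrow> grid t n (N n) \<le> T + t / n" "\<And>n. 0 < n \<Longrightarrow> N n \<le> n"
    "\<And>n. 0 < n \<Longrightarrow> S n = exp (c * t) * p (grid t n (N n)) - p 0"
    by metis
  have ev: "\<forall>\<^sub>F n in sequentially. 0 < (n::nat)" by (rule eventually_gt_at_top)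
  have lim: "(\<lambda>n. grid t n (N n)) \<longlonglongrightarrow> T"
  proof (rule tendsto_sandwich)
    show "(\<lambda>n. T) \<longlonglongrightarrow> T" by simp
    show "(\<lambda>n. T + t / real n) \<longlonglongrightarrow> T" by real_asymp
  qed (rule eventually_mono[OF ev], simp add: N)+
  have rng: "grid t n (N n) \<in> {0..t}" if "0 < n" for n
    using N(3)[OF that] grid_nonneg[of t] grid_le[of t] \<open>0 < t\<close> by auto
  have "(\<lambda>n. p (grid t n (N n))) \<longlonglongrightarrow> p T"
    by (rule continuous_on_tendsto_compose[OF p lim]) (use \<open>0 \<le> T\<close> \<open>T \<le> t\<close> in \<open>auto intro!: eventually_mono[OF ev] simp del: atLeastAtMost_iff intro: rng\<close>, simp)
  then have "(\<lambda>n. exp (c * t) * p (grid t n (N n)) - p 0) \<longlonglongrightarrow> exp (c * t) * p T - p 0"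
    by (intro tendsto_intros)
  then have "S \<longlonglongrightarrow> exp (c * t) * p T - p 0"
    by (rule Lim_transform_eventually) (rule eventually_mono[OF ev], simp add: N)
  then show ?thesis unfolding S_def .
qed

text \<open>After telescoping only the two end terms survive. The bound depends neither on
  \<open>n\<close> nor on the clock, so it can dominate the sums over all paths at once.\<close>

lemma stopped_sum_bound:
  fixes a p :: "real \<Rightarrow> real" and c t T K :: real
  assumes "0 < t" "0 \<le> T" "T \<le> t" "a T = t" "a 0 = 0" "strict_mono_on {0..} a"
    and p: "\<And>r. 0 \<le> r \<Longrightarrow> \<bar>p r\<bar> \<le> K"
  shows "\<bar>\<Sum>i<n. if a (grid t n i) < t
        then exp (c * min (a (grid t n (Suc i))) t) * p (grid t n (Suc i))
           - exp (c * min (a (grid t n i)) t) * p (grid t n i) else 0\<bar> \<le> (exp (c * t) + 1) * K"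
proof (cases "0 < n")
  case True
  show ?thesis
  proof (rule stopped_telescope[OF assms(1-6) True, of c p])
    fix N :: nat
    assume eq: "(\<Sum>i<n. if a (grid t n i) < t
        then exp (c * min (a (grid t n (Suc i))) t) * p (grid t n (Suc i))
           - exp (c * min (a (grid t n i)) t) * p (grid t n i) else 0) = exp (c * t) * p (grid t n N) - p 0"
    have "\<bar>exp (c * t) * p (grid t n N)\<bar> \<le> exp (c * t) * K"
      using p[of "grid t n N"] \<open>0 < t\<close> by (simp add: abs_mult grid_nonneg)
    then show ?thesis unfolding eq using p[of 0] by (simp add: algebra_simps)
  qed
next
  case False
  have "0 \<le> K" using p[of 0] by simp
  then show ?thesis using False by simp
qed

text \<open>The increments of the monotone \<open>a\<close> add up to \<open>a t - a 0\<close> on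
  every grid, while the oscillation of \<open>q\<close> over one step tends to 0 uniformly by
  compactness.\<close>

lemma increment_product_sum_tendsto_0:
  fixes a q :: "real \<Rightarrow> real" and t :: real
  assumes "0 < t" and a: "mono_on {0..} a" and q: "continuous_on {0..t} q"
  shows "(\<lambda>n. \<Sum>i<n. (a (grid t n (Suc i)) - a (grid t n i))
           * \<bar>q (grid t n (Suc i)) - q (grid t n i)\<bar>) \<longlonglongrightarrow> 0"
proof (rule LIMSEQ_I)
  fix e :: real assume "0 < e"
  \<comment> \<open>The summand 1 keeps \<open>C\<close> positive when \<open>a\<close> is constant
    on \<open>[0, t]\<close>.\<close>
  define C where "C = a t - a 0 + 1"
  have "a 0 \<le> a t" using mono_onD[OF a, of 0 t] \<open>0 < t\<close> by simp
  then have C: "0 < C" by (simp add: C_def)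
  have "uniformly_continuous_on {0..t} q" by (rule compact_uniformly_continuous[OF q]) simp
  then obtain d where d: "d > 0"
    "\<And>r s. r \<in> {0..t} \<Longrightarrow> s \<in> {0..t} \<Longrightarrow> dist r s < d \<Longrightarrow> dist (q r) (q s) < e / C"
    unfolding uniformly_continuous_on_def using \<open>0 < e\<close> C by (metis divide_pos_pos)
  obtain n0 :: nat where n0: "t / d < n0" using reals_Archimedean2 by blast
  show "\<exists>n0. \<forall>n\<ge>n0. norm ((\<Sum>i<n. (a (grid t n (Suc i)) - a (grid t n i))
           * \<bar>q (grid t n (Suc i)) - q (grid t n i)\<bar>) - 0) < e"
  proof (intro exI[of _ n0] allI impI)
    fix n assume "n0 \<le> n"
    have "0 < t / d" using d \<open>0 < t\<close> by simp
    with n0 \<open>n0 \<le> n\<close> have n: "0 < n" "t / d < n" by linarith+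
    have q1: "\<bar>q (grid t n (Suc i)) - q (grid t n i)\<bar> \<le> e / C" if "i < n" for i
    proof -
      have "dist (grid t n (Suc i)) (grid t n i) = t / n"
        using grid_step[of t n i] \<open>0 < t\<close> n by (simp add: dist_real_def)
      also have "\<dots> < d" using n d by (simp add: field_simps)
      finally have "dist (q (grid t n (Suc i))) (q (grid t n i)) < e / C"
        using that \<open>0 < t\<close> by (intro d) (auto intro: grid_nonneg grid_le)
      then show ?thesis by (simp add: dist_real_def)
    qed
    have a1: "0 \<le> a (grid t n (Suc i)) - a (grid t n i)" for i
      using mono_onD[OF a, of "grid t n i" "grid t n (Suc i)"] \<open>0 < t\<close>
        grid_nonneg[of t] grid_le_Suc[of t] by simp
    let ?S = "\<Sum>i<n. (a (grid t n (Suc i)) - a (grid t n i))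
           * \<bar>q (grid t n (Suc i)) - q (grid t n i)\<bar>"
    have "?S \<le> (\<Sum>i<n. (a (grid t n (Suc i)) - a (grid t n i)) * (e / C))"
      by (intro sum_mono mult_left_mono q1 a1) auto
    also have "\<dots> = (a t - a 0) * (e / C)"
      unfolding sum_distrib_right[symmetric]
      using sum_lessThan_telescope[of "\<lambda>i. a (grid t n i)" n] n by (simp add: grid_self)
    also have "\<dots> < C * (e / C)"
      using \<open>0 < e\<close> C by (intro mult_strict_right_mono) (auto simp: C_def)
    finally have "?S < e" using C by simp
    moreover have "0 \<le> ?S" by (intro sum_nonneg mult_nonneg_nonneg a1) auto
    ultimately show "norm (?S - 0) < e" by simp
  qed
qed

text \<open>Convexity: the graph of the exponential lies above its tangents at \<open>u\<close> and
  at \<open>v\<close>. The last bound replaces \<open>v\<close> by \<open>t\<close> to obtain a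
  constant common to all steps.\<close>

lemma exp_increment_bounds:
  fixes c u v t :: real
  assumes "0 \<le> c" "u \<le> v" "v \<le> t"
  shows "c * exp (c * u) * (v - u) \<le> exp (c * v) - exp (c * u)"
    "exp (c * v) - exp (c * u) \<le> c * exp (c * v) * (v - u)"
    "exp (c * v) - exp (c * u) \<le> c * exp (c * t) * (v - u)"
proof -
  have 1: "exp (c * u) * (1 + c * (v - u)) \<le> exp (c * u) * exp (c * (v - u))"
    by (intro mult_left_mono exp_ge_add_one_self) auto
  then show "c * exp (c * u) * (v - u) \<le> exp (c * v) - exp (c * u)"
    by (simp add: algebra_simps flip: exp_add)
  have "exp (c * v) * (1 + c * (u - v)) \<le> exp (c * v) * exp (c * (u - v))"
    by (intro mult_left_mono exp_ge_add_one_self) auto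
  then show 2: "exp (c * v) - exp (c * u) \<le> c * exp (c * v) * (v - u)"
    by (simp add: algebra_simps flip: exp_add)
  have "c * exp (c * v) * (v - u) \<le> c * exp (c * t) * (v - u)"
    using assms by (intro mult_right_mono mult_left_mono) (auto intro: mult_left_mono)
  with 2 show "exp (c * v) - exp (c * u) \<le> c * exp (c * t) * (v - u)" by simp
qed

text \<open>Pathwise chain rule for the finite variation factor \<open>exp (c * min a t)\<close>, up to the
  time at which \<open>a\<close> reaches \<open>t\<close>.\<close>

lemma stopped_chain_rule:
  fixes a p :: "real \<Rightarrow> real" and c t T K :: real
  assumes "0 < t" "0 \<le> T" "T \<le> t" "a T = t" "a 0 = 0" and a: "strict_mono_on {0..} a"
    and ac: "continuous_on {0..} a"
    and p: "continuous_on {0..} p" and K: "\<And>r. 0 \<le> r \<Longrightarrow> \<bar>p r\<bar> \<le> K" and c: "0 \<le> c"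
  defines "U \<equiv> \<lambda>n. \<Sum>i<n. if a (grid t n i) < t
        then (exp (c * min (a (grid t n (Suc i))) t) - exp (c * min (a (grid t n i)) t))
               * p (grid t n (Suc i))
           - c * exp (c * min (a (grid t n i)) t)
               * (a (grid t n (Suc i)) - a (grid t n i)) * p (grid t n i) else 0"
  shows "U \<longlonglongrightarrow> 0" and "\<And>n. \<bar>U n\<bar> \<le> 2 * c * exp (c * t) * K * a t"
proof -
  have am: "mono_on {0..} a" using a by (rule strict_mono_on_imp_mono_on)
  have K0: "0 \<le> K" using K[of 0] by simp
  have r0: "0 \<le> grid t n i" for n i using \<open>0 < t\<close> by (simp add: grid_nonneg)
  have aS: "a (grid t n i) \<le> a (grid t n (Suc i))" for n i
    using mono_onD[OF am, of "grid t n i" "grid t n (Suc i)"] \<open>0 < t\<close> 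
    by (simp add: grid_nonneg grid_le_Suc)
  \<comment> \<open>\<open>d\<close> is the clock capped at \<open>t\<close>; the weights see its
    increments \<open>dd\<close>, whereas the compensating term contains the uncapped increments
    \<open>da\<close>. The two differ only in the last kept step, where \<open>a\<close> may
    overshoot \<open>t\<close>.\<close>
  define d where "d = (\<lambda>s. min (a s) t)"
  define e where "e = (\<lambda>s. exp (c * d s))"
  define da where "da = (\<lambda>n i. a (grid t n (Suc i)) - a (grid t n i))"
  define dd where "dd = (\<lambda>n i. d (grid t n (Suc i)) - d (grid t n i))"
  have U: "U n = (\<Sum>i<n. if a (grid t n i) < t
        then (e (grid t n (Suc i)) - e (grid t n i)) * p (grid t n (Suc i))
           - c * e (grid t n i) * da n i * p (grid t n i) else 0)" for n
    unfolding U_def e_def d_def da_def by (rule refl)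
  have da0: "0 \<le> da n i" for n i using aS[of n i] by (simp add: da_def)
  have dd_bounds: "0 \<le> dd n i" "dd n i \<le> da n i" for n i
    using aS[of n i] by (auto simp: min_def dd_def da_def d_def)
  have dt: "d s \<le> t" for s by (simp add: d_def)
  have e_bounds: "c * e (grid t n i) * dd n i \<le> e (grid t n (Suc i)) - e (grid t n i)"
    "e (grid t n (Suc i)) - e (grid t n i) \<le> c * e (grid t n (Suc i)) * dd n i"
    "e (grid t n (Suc i)) - e (grid t n i) \<le> c * exp (c * t) * dd n i" for n i
    using exp_increment_bounds[OF c _ dt, of "d (grid t n i)" "grid t n (Suc i)"] dd_bounds(1)[of n i]
    unfolding dd_def e_def by simp_all
  have em: "e (grid t n i) \<le> e (grid t n (Suc i))" for n i
    using dd_bounds(1)[of n i] c unfolding dd_def e_def by (simp add: mult_left_mono)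
  have e0: "0 \<le> e s" for s by (simp add: e_def)
  have et: "e s \<le> exp (c * t)" for s using c dt[of s] by (simp add: e_def mult_left_mono)
  have cet: "c * e s \<le> c * exp (c * t)" for s using et c by (rule mult_left_mono)
  have at: "0 \<le> a t" using mono_onD[OF am, of 0 t] assms by auto
  have da_sum: "(\<Sum>i<n. da n i) \<le> a t" for n
    using sum_lessThan_telescope[of "\<lambda>i. a (grid t n i)" n] at \<open>a 0 = 0\<close>
    by (cases "n = 0") (simp_all add: grid_self da_def)
  show "\<bar>U n\<bar> \<le> 2 * c * exp (c * t) * K * a t" for n
  proof -
    have "\<bar>U n\<bar> \<le> (\<Sum>i<n. 2 * c * exp (c * t) * K * da n i)"
      unfolding U
    proof (rule order_trans[OF sum_abs sum_mono], goal_cases)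
      case (1 i)
      have "\<bar>(e (grid t n (Suc i)) - e (grid t n i)) * p (grid t n (Suc i))\<bar> \<le> (c * exp (c * t) * da n i) * K"
        unfolding abs_mult
      proof (rule mult_mono)
        have "c * exp (c * t) * dd n i \<le> c * exp (c * t) * da n i"
          using dd_bounds c by (intro mult_left_mono) auto
        then show "\<bar>e (grid t n (Suc i)) - e (grid t n i)\<bar> \<le> c * exp (c * t) * da n i"
          using e_bounds(3)[of n i] em[of n i] by linarith
        show "0 \<le> c * exp (c * t) * da n i" using c da0[of n i] by (intro mult_nonneg_nonneg) auto
      qed (use K r0 in auto)
      moreover have "\<bar>c * e (grid t n i) * da n i * p (grid t n i)\<bar> \<le> (c * exp (c * t) * da n i) * K"
        unfolding abs_mult[of _ "p _"]
      proof (rule mult_mono)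
        have "c * e (grid t n i) * da n i \<le> c * exp (c * t) * da n i"
          using da0[of n i] cet by (intro mult_right_mono) auto
        then show "\<bar>c * e (grid t n i) * da n i\<bar> \<le> c * exp (c * t) * da n i"
          using c e0[of "grid t n i"] da0[of n i] by (simp add: abs_mult)
        show "0 \<le> c * exp (c * t) * da n i" using c da0[of n i] by (intro mult_nonneg_nonneg) auto
      qed (use K r0 in auto)
      moreover have "0 \<le> (c * exp (c * t) * da n i) * K" using c da0[of n i] K0 by (intro mult_nonneg_nonneg) auto
      ultimately show ?case by (auto simp: algebra_simps)
    qed
    also have "\<dots> = 2 * c * exp (c * t) * K * (\<Sum>i<n. da n i)" by (simp add: sum_distrib_left)
    also have "\<dots> \<le> 2 * c * exp (c * t) * K * a t"
      using da_sum c K0 by (intro mult_left_mono) auto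
    finally show ?thesis .
  qed
  have tele: "(\<lambda>n. \<Sum>i<n. if a (grid t n i) < t then f (grid t n (Suc i)) - f (grid t n i) else 0) \<longlonglongrightarrow> f T - f 0"
    if "continuous_on {0..t} f" for f :: "real \<Rightarrow> real"
    using stopped_sum_tendsto[OF assms(1-6) that, of 0] by (simp cong: if_cong)
  have ac': "continuous_on {0..t} a" and pc: "continuous_on {0..t} p"
    using continuous_on_subset[OF ac, of "{0..t}"] continuous_on_subset[OF p, of "{0..t}"] by auto
  have dc: "continuous_on {0..t} d" and ec: "continuous_on {0..t} e"
    unfolding d_def e_def by (intro continuous_intros ac')+
  \<comment> \<open>The sum of \<open>da - dd\<close> over the kept steps is precisely the overshoot
    of \<open>a\<close> beyond \<open>t\<close>. It vanishes in the limit because the capped and the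
    uncapped clock agree at \<open>T\<close>.\<close>
  have l0: "(\<lambda>n. (\<Sum>i<n. if a (grid t n i) < t then da n i else 0) - (\<Sum>i<n. if a (grid t n i) < t then dd n i else 0))
      \<longlonglongrightarrow> (a T - a 0) - (d T - d 0)"
    unfolding da_def dd_def by (intro tendsto_diff tele dc ac')
  have "(a T - a 0) - (d T - d 0) = 0" using assms(1-5) by (simp add: d_def)
  with l0 have l1: "(\<lambda>n. \<Sum>i<n. if a (grid t n i) < t then da n i - dd n i else 0) \<longlonglongrightarrow> 0"
    by (simp add: sum_subtractf[symmetric] if_distrib if_distribR cong: if_cong)
  have l2: "(\<lambda>n. \<Sum>i<n. da n i * \<bar>e (grid t n (Suc i)) - e (grid t n i)\<bar>) \<longlonglongrightarrow> 0"
    unfolding da_def by (intro increment_product_sum_tendsto_0[OF \<open>0 < t\<close> am] ec)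
  have l3: "(\<lambda>n. \<Sum>i<n. da n i * \<bar>p (grid t n (Suc i)) - p (grid t n i)\<bar>) \<longlonglongrightarrow> 0"
    unfolding da_def by (intro increment_product_sum_tendsto_0[OF \<open>0 < t\<close> am] pc)
  \<comment> \<open>Three sources of error, in this order: linearising the exponential, the
    overshoot of the clock, and moving \<open>p\<close> from the right end of a step to the left
    end.\<close>
  let ?b = "\<lambda>n. K * (c * (\<Sum>i<n. da n i * \<bar>e (grid t n (Suc i)) - e (grid t n i)\<bar>)
      + c * exp (c * t) * (\<Sum>i<n. if a (grid t n i) < t then da n i - dd n i else 0))
      + c * exp (c * t) * (\<Sum>i<n. da n i * \<bar>p (grid t n (Suc i)) - p (grid t n i)\<bar>)"
  have "?b \<longlonglongrightarrow> K * (c * 0 + c * exp (c * t) * 0) + c * exp (c * t) * 0"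
    by (intro tendsto_intros l1 l2 l3)
  then have lb: "?b \<longlonglongrightarrow> 0" by simp
  have bnd: "\<bar>U n\<bar> \<le> ?b n" for n
    unfolding U sum_distrib_left sum.distrib[symmetric]
  proof (rule order_trans[OF sum_abs sum_mono], goal_cases)
    case (1 i)
    show ?case
    proof (cases "a (grid t n i) < t")
      case False
      then show ?thesis using da0[of n i] dd_bounds[of n i] c K0 by (auto intro!: add_nonneg_nonneg mult_nonneg_nonneg)
    next
      case True
      have x1: "\<bar>e (grid t n (Suc i)) - e (grid t n i) - c * e (grid t n i) * da n i\<bar>
        \<le> c * (da n i * \<bar>e (grid t n (Suc i)) - e (grid t n i)\<bar>) + c * exp (c * t) * (da n i - dd n i)"
      proof -
        have "c * e (grid t n (Suc i)) * dd n i - c * e (grid t n i) * dd n i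
           = c * ((e (grid t n (Suc i)) - e (grid t n i)) * dd n i)" by (simp add: algebra_simps)
        also have "\<dots> \<le> c * ((e (grid t n (Suc i)) - e (grid t n i)) * da n i)"
          using dd_bounds[of n i] em[of n i] c by (intro mult_left_mono) auto
        finally have y1: "\<bar>e (grid t n (Suc i)) - e (grid t n i) - c * e (grid t n i) * dd n i\<bar>
          \<le> c * (da n i * \<bar>e (grid t n (Suc i)) - e (grid t n i)\<bar>)"
          using e_bounds(1,2)[of n i] em[of n i] by (simp add: mult.commute)
        have "c * e (grid t n i) * (da n i - dd n i) \<le> c * exp (c * t) * (da n i - dd n i)"
          using dd_bounds[of n i] cet by (intro mult_right_mono) auto
        moreover have "0 \<le> c * e (grid t n i) * (da n i - dd n i)"
          using dd_bounds[of n i] c e0[of "grid t n i"] by (intro mult_nonneg_nonneg) auto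
        moreover have "e (grid t n (Suc i)) - e (grid t n i) - c * e (grid t n i) * da n i
           = (e (grid t n (Suc i)) - e (grid t n i) - c * e (grid t n i) * dd n i) - c * e (grid t n i) * (da n i - dd n i)"
          by (simp add: algebra_simps)
        ultimately show ?thesis using y1 by linarith
      qed
      have x2: "\<bar>c * e (grid t n i) * da n i\<bar> \<le> c * exp (c * t) * da n i"
      proof -
        have "c * e (grid t n i) * da n i \<le> c * exp (c * t) * da n i"
          using da0[of n i] cet by (intro mult_right_mono) auto
        then show ?thesis using c e0[of "grid t n i"] da0[of n i] by (simp add: abs_mult)
      qed
      have "\<bar>(e (grid t n (Suc i)) - e (grid t n i) - c * e (grid t n i) * da n i) * p (grid t n (Suc i))\<bar>
        \<le> (c * (da n i * \<bar>e (grid t n (Suc i)) - e (grid t n i)\<bar>) + c * exp (c * t) * (da n i - dd n i)) * K"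
        unfolding abs_mult using x1 K r0 
        by (intro mult_mono) (auto intro: order_trans[OF abs_ge_zero])
      moreover have "\<bar>c * e (grid t n i) * da n i * (p (grid t n (Suc i)) - p (grid t n i))\<bar>
        \<le> c * exp (c * t) * da n i * \<bar>p (grid t n (Suc i)) - p (grid t n i)\<bar>"
        unfolding abs_mult[of _ "p _ - p _"] using x2 by (rule mult_right_mono) auto
      moreover have "(e (grid t n (Suc i)) - e (grid t n i)) * p (grid t n (Suc i)) - c * e (grid t n i) * da n i * p (grid t n i)
        = (e (grid t n (Suc i)) - e (grid t n i) - c * e (grid t n i) * da n i) * p (grid t n (Suc i))
          + c * e (grid t n i) * da n i * (p (grid t n (Suc i)) - p (grid t n i))" by (simp add: algebra_simps)
      ultimately show ?thesis using True by (simp add: algebra_simps)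
    qed
  qed
  show "U \<longlonglongrightarrow> 0"
    by (rule Lim_null_comparison[OF _ lb]) (use bnd in auto)
qed

section \<open>A transform that determines measures on the half-line\<close>

text \<open>Vector-valued, so that it serves both the complex integrand of
  \<open>char_exponential\<close> and the real one of \<open>sticky_density_robin_integral\<close>.
  Integrability of \<open>f\<close> supplies the dominating function for the truncations to
  \<open>[0, n]\<close>.\<close>

lemma integral_FTC_atLeast:
  fixes f F :: "real \<Rightarrow> 'a :: euclidean_space"
  assumes F: "\<And>x. 0 \<le> x \<Longrightarrow> (F has_vector_derivative f x) (at x)"
    and f: "continuous_on {0..} f"
    and int: "integrable lborel (\<lambda>x. indicator {0..} x *\<^sub>R f x)"
    and lim: "(F \<longlongrightarrow> T) at_top"
  shows "(\<integral>x. indicator {0..} x *\<^sub>R f x \<partial>lborel) = T - F 0"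
proof (rule LIMSEQ_unique)
  show "(\<lambda>n. \<integral>x. indicator {0..real n} x *\<^sub>R f x \<partial>lborel) \<longlonglongrightarrow> (\<integral>x. indicator {0..} x *\<^sub>R f x \<partial>lborel)"
  proof (rule integral_dominated_convergence)
    show "integrable lborel (\<lambda>x. norm (indicator {0..} x *\<^sub>R f x))" by (rule integrable_norm[OF int])
    show "(\<lambda>x. indicator {0..} x *\<^sub>R f x) \<in> borel_measurable lborel"
      using int by (rule borel_measurable_integrable)
    show "(\<lambda>x. indicator {0..real n} x *\<^sub>R f x) \<in> borel_measurable lborel" for n
    proof -
      have "(\<lambda>x. indicator {0..real n} x *\<^sub>R (indicator {0..} x *\<^sub>R f x)) \<in> borel_measurable lborel"
        by (intro borel_measurable_scaleR borel_measurable_indicator borel_measurable_integrable int) simp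
      then show ?thesis by (rule measurable_cong[THEN iffD1, rotated]) (auto simp: indicator_def)
    qed
    show "AE x in lborel. (\<lambda>n. indicator {0..real n} x *\<^sub>R f x) \<longlonglongrightarrow> indicator {0..} x *\<^sub>R f x"
    proof (intro AE_I2 tendsto_eventually)
      fix x :: real
      obtain n0 :: nat where "x \<le> n0" using real_arch_simple by blast
      then show "\<forall>\<^sub>F n in sequentially. indicator {0..real n} x *\<^sub>R f x = indicator {0..} x *\<^sub>R f x"
        by (intro eventually_sequentiallyI[of n0]) (auto simp: indicator_def)
    qed
  qed (auto simp: indicator_def)
  have "(\<integral>x. indicator {0..real n} x *\<^sub>R f x \<partial>lborel) = F n - F 0" for n
    by (rule integral_FTC_atLeastAtMost)
      (auto intro!: has_vector_derivative_at_within F continuous_on_subset[OF f])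
  moreover have "(\<lambda>n. F (real n) - F 0) \<longlonglongrightarrow> T - F 0"
    by (intro tendsto_intros filterlim_compose[OF lim] filterlim_real_sequentially)
  ultimately show "(\<lambda>n. \<integral>x. indicator {0..real n} x *\<^sub>R f x \<partial>lborel) \<longlonglongrightarrow> T - F 0" by simp
qed

lemma char_distr_sum_pair:
  assumes "real_distribution M" "real_distribution N"
  shows "char (distr (M \<Otimes>\<^sub>M N) borel (\<lambda>(x, y). x + y)) k = char M k * char N k"
proof -
  interpret M: real_distribution M by fact
  interpret N: real_distribution N by fact
  interpret pair_prob_space M N ..
  have int: "integrable (M \<Otimes>\<^sub>M N) (\<lambda>(x, y). iexp (k * x) * iexp (k * y))"
    by (rule integrable_const_bound[of _ 1]) (auto simp: norm_mult split_beta)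
  have "char (distr (M \<Otimes>\<^sub>M N) borel (\<lambda>(x, y). x + y)) k
      = (CLINT z|M \<Otimes>\<^sub>M N. (\<lambda>(x, y). iexp (k * x) * iexp (k * y)) z)"
    unfolding char_def by (subst integral_distr)
      (auto simp: exp_add[symmetric] algebra_simps intro!: Bochner_Integration.integral_cong)
  also have "\<dots> = (CLINT x|M. CLINT y|N. iexp (k * x) * iexp (k * y))"
    using integral_fst'[OF int] by simp
  finally show ?thesis by (simp add: char_def)
qed

text \<open>An independent fair sign kills the imaginary part of the characteristic function, so
  Levy's theorem identifies the symmetrised laws. Taking \<open>abs\<close> then undoes the sign,
  because the original mass sits on the half-line.\<close>

lemma Re_char_uniqueness:
  assumes "real_distribution M" "real_distribution N"
    and "AE x in M. 0 \<le> x" "AE x in N. 0 \<le> x"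
    and eq: "\<And>k. Re (char M k) = Re (char N k)"
  shows "M = N"
proof -
  define S where "S = measure_pmf (pmf_of_set {-1, 1 :: real})"
  define sym where "sym = (\<lambda>M. distr (M \<Otimes>\<^sub>M S) borel (\<lambda>(x, s). s * x))"
  have sets_S [measurable_cong]: "sets S = sets (count_space UNIV)" by (simp add: S_def)
  have S_m: "(\<lambda>s. s) \<in> borel_measurable S" by (simp add: S_def)
  have sgnm: "case_prod (\<lambda>x s. s * x) \<in> borel_measurable (M \<Otimes>\<^sub>M S)" if "real_distribution M" for M
  proof -
    interpret real_distribution M by fact
    note S_m[measurable]
    show ?thesis by measurable
  qed
  have AES: "AE s in S. s = -1 \<or> s = 1" unfolding S_def by (auto simp: AE_measure_pmf_iff)
  have S_int: "(\<integral>s. f s \<partial>S) = (f (-1) + f 1) / 2" for f :: "real \<Rightarrow> complex"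
    unfolding S_def by (subst integral_measure_pmf[of "{-1, 1}"]) (auto simp: scaleR_conv_of_real)
  have char_sym: "char (sym M) k = of_real (Re (char M k))" and sym_rd: "real_distribution (sym M)"
    if M: "real_distribution M" for M k
  proof -
    interpret M: real_distribution M by fact
    interpret S: prob_space S by (simp add: S_def measure_pmf.prob_space_axioms)
    interpret pair_prob_space M S ..
    note sgnm[OF M, measurable] S_m[measurable]
    show "real_distribution (sym M)" unfolding sym_def by (rule real_distribution_distr) simp
    have int: "integrable (M \<Otimes>\<^sub>M S) (\<lambda>(x, s). iexp (k * (s * x)))"
      by (rule integrable_const_bound[of _ 1]) (auto simp: split_beta)
    have "char (sym M) k = (CLINT z|M \<Otimes>\<^sub>M S. (\<lambda>(x, s). iexp (k * (s * x))) z)"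
      unfolding char_def sym_def by (subst integral_distr)
        (auto intro!: Bochner_Integration.integral_cong)
    also have "\<dots> = (CLINT x|M. CLINT s|S. iexp (k * (s * x)))"
      using integral_fst'[OF int] by simp
    also have "\<dots> = (CLINT x|M. of_real (cos (k * x)))"
      unfolding S_int by (rule Bochner_Integration.integral_cong)
        (auto simp: complex_eq_iff Re_exp Im_exp)
    also have "\<dots> = of_real (\<integral>x. cos (k * x) \<partial>M)" by (rule integral_complex_of_real)
    also have "(\<integral>x. cos (k * x) \<partial>M) = Re (char M k)"
      unfolding char_def by (subst integral_Re[symmetric]) (auto simp: Re_exp intro!: M.integrable_iexp)
    finally show "char (sym M) k = of_real (Re (char M k))" .
  qed
  have sym_eq: "sym M = sym N"
    by (rule Levy_uniqueness) (use assms in \<open>auto simp: fun_eq_iff char_sym sym_rd\<close>)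
  have recover: "distr (sym M) borel abs = M" if M: "real_distribution M" and pos: "AE x in M. 0 \<le> x" for M
  proof -
    interpret M: real_distribution M by fact
    interpret S: prob_space S by (simp add: S_def measure_pmf.prob_space_axioms)
    interpret pair_prob_space M S ..
    note sgnm[OF M, measurable] S_m[measurable]
    have "distr (sym M) borel abs = distr (M \<Otimes>\<^sub>M S) borel (abs \<circ> (\<lambda>(x, s). s * x))"
      unfolding sym_def by (rule distr_distr) auto
    also have "\<dots> = distr (M \<Otimes>\<^sub>M S) borel fst"
    proof (rule distr_cong_AE)
      have [measurable]: "snd \<in> borel_measurable (M \<Otimes>\<^sub>M S)"
        by (rule measurable_compose[OF measurable_snd S_m])
      show "AE z in M \<Otimes>\<^sub>M S. (abs \<circ> (\<lambda>(x, s). s * x)) z = fst z"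
      proof (rule AE_pair_measure)
        show "{z \<in> space (M \<Otimes>\<^sub>M S). (abs \<circ> (\<lambda>(x, s). s * x)) z = fst z} \<in> sets (M \<Otimes>\<^sub>M S)"
          unfolding comp_def split_beta by measurable
        show "AE x in M. AE s in S. (abs \<circ> (\<lambda>(x, s). s * x)) (x, s) = fst (x, s)"
          using pos by eventually_elim (use AES in \<open>auto elim!: eventually_mono\<close>)
      qed
    qed auto
    also have "\<dots> = distr (M \<Otimes>\<^sub>M S) M fst" by (rule distr_cong) auto
    also have "\<dots> = M" by (rule S.distr_pair_fst)
    finally show ?thesis .
  qed
  show ?thesis using recover[of M] recover[of N] sym_eq assms by metis
qed

lemma char_exponential:
  fixes m :: real
  assumes "0 < m"
  shows "char (density lborel (exponential_density (1 / m))) k = 1 / (1 - \<i> * (m * k))"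
proof -
  \<comment> \<open>Complex rate: \<open>exp (- ?l * x)\<close> equals
    \<open>exp (- x / m) * iexp (k * x)\<close>, so the integrand is a single exponential with an
    explicit antiderivative.\<close>
  let ?l = "Complex (1 / m) (- k)"
  let ?f = "\<lambda>x. of_real (1 / m) * exp (- ?l * of_real x)"
  let ?F = "\<lambda>x. - (of_real (1 / m) / ?l) * exp (- ?l * of_real x)"
  have l0: "?l \<noteq> 0" using assms by (simp add: complex_eq_iff)
  have nf: "norm (?f x) = exponential_density (1 / m) x" if "0 \<le> x" for x
    using that assms by (simp add: exponential_density_def norm_mult norm_divide norm_exp_eq_Re mult.commute)
  have int: "integrable lborel (\<lambda>x. indicator {0..} x *\<^sub>R ?f x)"
  proof (rule Bochner_Integration.integrable_bound)
    interpret E: prob_space "density lborel (exponential_density (1 / m))"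
      using assms by (intro prob_space_exponential_density) simp
    have "integrable (density lborel (exponential_density (1 / m))) (\<lambda>x. 1 :: real)" by simp
    then show "integrable lborel (exponential_density (1 / m))"
      using assms by (subst (asm) integrable_density) (auto simp: exponential_density_nonneg)
    show "AE x in lborel. norm (indicator {0..} x *\<^sub>R ?f x) \<le> norm (exponential_density (1 / m) x)"
      using nf assms by (auto simp: indicator_def exponential_density_nonneg)
  qed measurable
  have F: "(?F has_vector_derivative ?f x) (at x)" for x
    by (rule has_vector_derivative_real_field, (rule derivative_eq_intros refl)+) (use l0 assms in simp)
  have "(?F \<longlongrightarrow> 0) at_top"
  proof (rule Lim_null_comparison)
    show "\<forall>\<^sub>F x in at_top. norm (?F x) \<le> norm (of_real (1 / m) / ?l) * exp (- x / m)"
      by (auto simp: norm_mult norm_divide)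
    show "((\<lambda>x. norm (of_real (1 / m) / ?l) * exp (- x / m)) \<longlongrightarrow> 0) at_top"
      using assms by real_asymp
  qed
  then have FTC: "(\<integral>x. indicator {0..} x *\<^sub>R ?f x \<partial>lborel) = 0 - ?F 0"
    using F int assms by (intro integral_FTC_atLeast) (auto intro!: continuous_intros)
  have "char (density lborel (exponential_density (1 / m))) k
      = (\<integral>x. exponential_density (1 / m) x *\<^sub>R iexp (k * x) \<partial>lborel)"
    unfolding char_def using assms by (intro integral_density) (auto simp: exponential_density_nonneg)
  also have "\<dots> = (\<integral>x. indicator {0..} x *\<^sub>R ?f x \<partial>lborel)"
    by (rule Bochner_Integration.integral_cong)
      (auto simp: exponential_density_def indicator_def complex_eq_iff Re_exp Im_exp scaleR_conv_of_real mult.commute)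
  also have "\<dots> = of_real (1 / m) / ?l" unfolding FTC by simp
  also have "\<dots> = 1 / (1 - \<i> * (m * k))"
  proof -
    have "?l = of_real (1 / m) * (1 - \<i> * (m * k))" using assms by (simp add: complex_eq_iff)
    then show ?thesis using l0 by simp
  qed
  finally show ?thesis .
qed

text \<open>With \<open>Y\<close> exponential of mean \<open>m\<close> and independent of \<open>X\<close>, the transform determines
  \<open>Re E (iexp (k * (X + Y)))\<close>, because \<open>cos (k x) - m k sin (k x)\<close> is the real part of
  \<open>(1 + i m k) iexp (k x)\<close>.\<close>

lemma robin_transform_uniqueness:
  fixes m :: real
  assumes m: "0 < m" and "real_distribution M" "real_distribution N"
    and pos: "AE x in M. 0 \<le> x" "AE x in N. 0 \<le> x"
    and eq: "\<And>k. (\<integral>x. cos (k * x) - m * k * sin (k * x) \<partial>M) = (\<integral>x. cos (k * x) - m * k * sin (k * x) \<partial>N)"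
  shows "M = N"
proof -
  define E where "E = density lborel (exponential_density (1 / m))"
  define conv where "conv = (\<lambda>M. distr (M \<Otimes>\<^sub>M E) borel (\<lambda>(x, y). x + y))"
  interpret E: prob_space E
    unfolding E_def using m by (intro prob_space_exponential_density) simp
  interpret E: real_distribution E
    by standard (auto simp: E_def)
  have E_pos: "AE y in E. 0 \<le> y"
    unfolding E_def using m by (auto simp: AE_density exponential_density_def)
  have char_conv: "char (conv M) k = char M k / (1 - \<i> * (m * k))"
    \<comment> \<open>Dividing by \<open>1 - \<i> * (m * k)\<close> amounts to multiplying by its
      conjugate over \<open>1 + (m * k)^2\<close>; the real part of the product is the given
      transform.\<close>
    and Re_conv: "Re (char (conv M) k) = (\<integral>x. cos (k * x) - m * k * sin (k * x) \<partial>M) / (1 + (m * k)\<^sup>2)"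
    and rd: "real_distribution (conv M)"
    and cpos: "AE x in conv M. 0 \<le> x"
    if M: "real_distribution M" and p: "AE x in M. 0 \<le> x" for M k
  proof -
    interpret M: real_distribution M by fact
    interpret pair_prob_space M E ..
    show rd: "real_distribution (conv M)" unfolding conv_def by (rule real_distribution_distr) auto
    show c: "char (conv M) k = char M k / (1 - \<i> * (m * k))"
      unfolding conv_def using char_distr_sum_pair[OF M E.real_distribution_axioms]
      by (simp add: E_def char_exponential[OF m])
    have "AE z in M \<Otimes>\<^sub>M E. 0 \<le> fst z + snd z"
    proof (rule AE_pair_measure)
      show "{z \<in> space (M \<Otimes>\<^sub>M E). 0 \<le> fst z + snd z} \<in> sets (M \<Otimes>\<^sub>M E)" by measurable
      show "AE x in M. AE y in E. 0 \<le> fst (x, y) + snd (x, y)"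
        using p by eventually_elim (use E_pos in \<open>auto elim!: eventually_mono\<close>)
    qed
    then show "AE x in conv M. 0 \<le> x"
      unfolding conv_def by (subst AE_distr_iff) (auto simp: split_beta)
    have int: "integrable M (\<lambda>x. iexp (k * x))" by (rule M.integrable_iexp) auto
    have re: "Re (char M k) = (\<integral>x. cos (k * x) \<partial>M)" and im: "Im (char M k) = (\<integral>x. sin (k * x) \<partial>M)"
      unfolding char_def integral_Re[OF int, symmetric] integral_Im[OF int, symmetric]
      by (simp_all add: Re_exp Im_exp)
    have i1: "integrable M (\<lambda>x. cos (k * x))" "integrable M (\<lambda>x. m * k * sin (k * x))"
      using integrable_Re[OF int] integrable_Im[OF int] by (simp_all add: Re_exp Im_exp)
    have "Re (char (conv M) k) = (Re (char M k) - m * k * Im (char M k)) / (1 + (m * k)\<^sup>2)"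
      unfolding c by (simp add: Re_divide power2_eq_square)
    then show "Re (char (conv M) k) = (\<integral>x. cos (k * x) - m * k * sin (k * x) \<partial>M) / (1 + (m * k)\<^sup>2)"
      using i1 by (simp add: re im)
  qed
  have "conv M = conv N"
    by (rule Re_char_uniqueness) (use assms in \<open>simp_all add: rd cpos Re_conv\<close>)
  \<comment> \<open>Deconvolution: the characteristic function of the exponential law has no zeros,
    so that factor can be cancelled.\<close>
  then have "char M k / (1 - \<i> * (m * k)) = char N k / (1 - \<i> * (m * k))" for k
    using char_conv assms by metis
  moreover have "1 - \<i> * (m * k) \<noteq> 0" for k by (simp add: complex_eq_iff)
  ultimately have "char M = char N" by (simp add: fun_eq_iff)
  then show ?thesis using Levy_uniqueness assms by blast
qed

section \<open>The explicit kernel\<close>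

lemma integrable_gauss_tail: "integrable lborel (\<lambda>u::real. indicator {z..} u *\<^sub>R exp (- u\<^sup>2))"
proof (rule Bochner_Integration.integrable_bound)
  have "integrable lborel (\<lambda>u::real. exp (- u\<^sup>2) * u ^ (2 * 0))"
    using has_bochner_integral_even_function[OF gaussian_moment_even_pos[where k=0]]
    by (intro integrable.intros) auto
  then show "integrable lborel (\<lambda>u::real. exp (- u\<^sup>2))" by simp
qed (auto simp: indicator_def)

lemma erfc_nonneg: "0 \<le> erfc z"
  unfolding erfc_def set_lebesgue_integral_def by (intro mult_nonneg_nonneg integral_nonneg) auto

text \<open>Substitute \<open>u = z + v\<close> and use \<open>(z + v)^2 \<ge> z^2 + v^2\<close> for
  nonnegative \<open>z\<close> and \<open>v\<close>; the remaining half Gaussian integral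
  \<open>sqrt pi / 2\<close> cancels the normalisation of \<open>erfc\<close>.\<close>

lemma erfc_le_exp:
  assumes "0 \<le> z"
  shows "erfc z \<le> exp (- z\<^sup>2)"
proof -
  have "(\<integral>u. indicator {z..} u *\<^sub>R exp (- u\<^sup>2) \<partial>lborel)
      = (\<integral>v. indicator {0..} v *\<^sub>R exp (- (z + v)\<^sup>2) \<partial>lborel)"
    by (subst lborel_integral_real_affine[of 1 _ z])
      (auto intro!: Bochner_Integration.integral_cong simp: indicator_def)
  also have "\<dots> \<le> (\<integral>v. exp (- z\<^sup>2) * (indicator {0..} v *\<^sub>R exp (- v\<^sup>2)) \<partial>lborel)"
  proof (rule integral_mono)
    have "integrable lborel (\<lambda>v. indicator {z..} (z + 1 * v) *\<^sub>R exp (- (z + 1 * v)\<^sup>2))"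
      by (rule lborel_integrable_real_affine[OF integrable_gauss_tail]) simp
    then show "integrable lborel (\<lambda>v. indicator {0..} v *\<^sub>R exp (- (z + v)\<^sup>2))"
      by (simp add: indicator_def)
    show "integrable lborel (\<lambda>v. exp (- z\<^sup>2) * (indicator {0..} v *\<^sub>R exp (- v\<^sup>2)))"
      by (intro integrable_mult_right integrable_gauss_tail)
    show "indicator {0..} v *\<^sub>R exp (- (z + v)\<^sup>2) \<le> exp (- z\<^sup>2) * (indicator {0..} v *\<^sub>R exp (- v\<^sup>2))" for v
      using assms by (auto simp: indicator_def exp_add[symmetric] power2_eq_square algebra_simps)
  qed
  also have "\<dots> = exp (- z\<^sup>2) * (sqrt pi / 2)"
    using has_bochner_integral_integral_eq[OF gaussian_moment_0] by simp
  finally show ?thesis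
    by (simp add: erfc_def set_lebesgue_integral_def field_simps)
qed

lemma erfc_has_real_derivative [derivative_intros]:
  assumes "(f has_real_derivative f') (at x within S)"
  shows "((\<lambda>x. erfc (f x)) has_real_derivative - (2 / sqrt pi) * exp (- (f x)\<^sup>2) * f') (at x within S)"
proof -
  have "(erfc has_real_derivative - (2 / sqrt pi) * exp (- z\<^sup>2)) (at z)" for z
  proof -
    let ?f = "\<lambda>u::real. exp (- u\<^sup>2)"
    \<comment> \<open>The base point \<open>z - 1\<close> lies strictly to the left of
      \<open>z\<close>, so the formula holds for all \<open>w\<close> near \<open>z\<close> and the
      fundamental theorem on a compact interval gives a two-sided derivative.\<close>
    have split: "erfc w = erfc (z - 1) - 2 / sqrt pi * integral {z - 1..w} ?f" if "z - 1 < w" for w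
    proof -
      have ii: "integrable lborel (\<lambda>u. indicator {z - 1..w} u *\<^sub>R ?f u)"
        unfolding set_integrable_def[symmetric]
        by (intro borel_integrable_atLeastAtMost' continuous_intros)
      have "(\<integral>u. indicator {z - 1..} u *\<^sub>R ?f u \<partial>lborel)
          = (\<integral>u. indicator {z - 1..w} u *\<^sub>R ?f u + indicator {w..} u *\<^sub>R ?f u \<partial>lborel)"
        by (rule integral_cong_AE)
          (use that AE_lborel_singleton[of w] in \<open>auto elim!: eventually_mono simp: indicator_def\<close>)
      also have "\<dots> = (\<integral>u. indicator {z - 1..w} u *\<^sub>R ?f u \<partial>lborel) + (\<integral>u. indicator {w..} u *\<^sub>R ?f u \<partial>lborel)"
        by (intro Bochner_Integration.integral_add ii integrable_gauss_tail)
      also have "(\<integral>u. indicator {z - 1..w} u *\<^sub>R ?f u \<partial>lborel) = integral {z - 1..w} ?f"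
        using set_borel_integral_eq_integral(2)[of "{z - 1..w}" ?f] ii
        by (simp add: set_lebesgue_integral_def set_integrable_def)
      finally show ?thesis by (simp add: erfc_def set_lebesgue_integral_def algebra_simps)
    qed
    have "((\<lambda>w. integral {z - 1..w} ?f) has_real_derivative ?f z) (at z within {z - 1..z + 1})"
      by (rule integral_has_real_derivative) (auto intro!: continuous_intros)
    then have "((\<lambda>w. integral {z - 1..w} ?f) has_real_derivative ?f z) (at z)"
      by (simp add: at_within_Icc_at)
    then have "((\<lambda>w. erfc (z - 1) - 2 / sqrt pi * integral {z - 1..w} ?f) has_real_derivative
        - (2 / sqrt pi) * exp (- z\<^sup>2)) (at z)"
      by (rule DERIV_cong[OF DERIV_diff[OF DERIV_const DERIV_cmult]]) simp
    then show ?thesis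
    proof (rule DERIV_cong_ev[OF refl _ refl, THEN iffD1, rotated])
      have "\<forall>\<^sub>F w in nhds z. z - 1 < w" by (rule order_tendstoD[OF filterlim_ident]) simp
      then show "\<forall>\<^sub>F w in nhds z. erfc (z - 1) - 2 / sqrt pi * integral {z - 1..w} ?f = erfc w"
        by (auto elim!: eventually_mono simp: split)
    qed
  qed
  from DERIV_chain2[OF this assms] show ?thesis .
qed

section \<open>The function \<open>g0\<close>: Gaussian bounds and its first-order equation\<close>

lemma g0_nonneg: "0 < \<gamma> \<Longrightarrow> 0 \<le> g0 \<gamma> t x"
  by (auto simp: g0_def erfc_nonneg intro!: mult_nonneg_nonneg)

text \<open>The square is completed so that the cross term and the constant are exactly the exponent
  in \<open>g0\<close>. Multiplying the prefactor of \<open>g0\<close> by \<open>exp\<close> of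
  minus this square therefore leaves only the Gaussian \<open>exp (- x^2 / (2 * t))\<close>.\<close>

lemma gauss_exponent:
  fixes \<gamma> t x :: real
  assumes "0 < \<gamma>" "0 < t"
  shows "(x / sqrt (2 * t) + sqrt (2 * t) / \<gamma>)\<^sup>2 = x\<^sup>2 / (2 * t) + (2 * x / \<gamma> + 2 * t / \<gamma>\<^sup>2)"
  using assms by (simp add: power2_sum power_divide)

lemma g0_le:
  assumes "0 < \<gamma>" "0 < t" "0 \<le> x"
  shows "g0 \<gamma> t x \<le> 1 / \<gamma> * exp (- x\<^sup>2 / (2 * t))"
proof -
  have "g0 \<gamma> t x \<le> 1 / \<gamma> * exp (2 * x / \<gamma> + 2 * t / \<gamma>\<^sup>2) * exp (- (x / sqrt (2 * t) + sqrt (2 * t) / \<gamma>)\<^sup>2)"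
    unfolding g0_def using assms by (intro mult_left_mono erfc_le_exp) auto
  also have "\<dots> = 1 / \<gamma> * exp (- x\<^sup>2 / (2 * t))"
    using assms by (simp add: gauss_exponent exp_add[symmetric])
  finally show ?thesis .
qed

text \<open>Differentiating the exponential prefactor reproduces \<open>2 / \<gamma> * g0\<close>;
  in the derivative of the \<open>erfc\<close> factor the exponentials collapse by
  \<open>gauss_exponent\<close> to the centred Gaussian density.\<close>

lemma g0_has_real_derivative:
  assumes "0 < \<gamma>" "0 < t"
  shows "(g0 \<gamma> t has_real_derivative 2 / \<gamma> * (g0 \<gamma> t x - normal_density 0 (sqrt t) x)) (at x)"
proof -
  let ?w = "x / sqrt (2 * t) + sqrt (2 * t) / \<gamma>"
  let ?E = "exp (2 * x / \<gamma> + 2 * t / \<gamma>\<^sup>2)"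
  have e: "((\<lambda>x. 2 * x / \<gamma> + 2 * t / \<gamma>\<^sup>2) has_real_derivative 2 / \<gamma>) (at x)"
    and w: "((\<lambda>x. x / sqrt (2 * t) + sqrt (2 * t) / \<gamma>) has_real_derivative 1 / sqrt (2 * t)) (at x)"
    using DERIV_add[OF DERIV_cmult_right[OF DERIV_ident, of "2 / \<gamma>"] DERIV_const]
      DERIV_add[OF DERIV_cmult_right[OF DERIV_ident, of "1 / sqrt (2 * t)"] DERIV_const]
    by (simp_all add: mult.commute)
  have d: "(g0 \<gamma> t has_real_derivative
      1 / \<gamma> * (?E * (2 / \<gamma>)) * erfc ?w + 1 / \<gamma> * ?E * (- (2 / sqrt pi) * exp (- ?w\<^sup>2) * (1 / sqrt (2 * t)))) (at x)"
    unfolding g0_def[abs_def]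
    by (rule DERIV_cong[OF DERIV_mult[OF DERIV_cmult[OF DERIV_fun_exp[OF e]] erfc_has_real_derivative[OF w]]])
      (simp add: algebra_simps)
  have "?E * exp (- ?w\<^sup>2) = exp (- x\<^sup>2 / (2 * t))"
    unfolding gauss_exponent[OF assms] by (simp add: exp_add[symmetric])
  then have "1 / \<gamma> * ?E * (- (2 / sqrt pi) * exp (- ?w\<^sup>2) * (1 / sqrt (2 * t)))
      = - (2 / \<gamma>) * (1 / sqrt pi * (1 / sqrt (2 * t)) * exp (- x\<^sup>2 / (2 * t)))"
    by (simp add: field_simps)
  also have "1 / sqrt pi * (1 / sqrt (2 * t)) * exp (- x\<^sup>2 / (2 * t)) = normal_density 0 (sqrt t) x"
    using assms by (simp add: normal_density_def real_sqrt_mult)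
  finally have "1 / \<gamma> * (?E * (2 / \<gamma>)) * erfc ?w + 1 / \<gamma> * ?E * (- (2 / sqrt pi) * exp (- ?w\<^sup>2) * (1 / sqrt (2 * t)))
      = 2 / \<gamma> * (g0 \<gamma> t x - normal_density 0 (sqrt t) x)"
    by (simp add: g0_def algebra_simps)
  then show ?thesis by (rule DERIV_cong[OF d])
qed

lemma g0_continuous: "0 < \<gamma> \<Longrightarrow> 0 < t \<Longrightarrow> continuous_on UNIV (g0 \<gamma> t)"
  by (intro DERIV_continuous_on[OF has_field_derivative_at_within[OF g0_has_real_derivative]])

lemma g0_measurable [measurable]: "0 < \<gamma> \<Longrightarrow> 0 < t \<Longrightarrow> g0 \<gamma> t \<in> borel_measurable borel"
  by (rule borel_measurable_continuous_onI[OF g0_continuous])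

lemma g0_shift_integrable:
  assumes "0 < \<gamma>" "0 < t" "0 \<le> x"
  shows "integrable lborel (\<lambda>y. indicator {0..} y * g0 \<gamma> t (x + y))"
proof (rule Bochner_Integration.integrable_bound)
  note g0_measurable[OF assms(1,2), measurable]
  have "integrable lborel (\<lambda>y. normal_density 0 (sqrt t) (x + 1 * y))"
    using assms by (intro lborel_integrable_real_affine integrable_normal_density) auto
  then show "integrable lborel (\<lambda>y. sqrt (2 * pi * t) / \<gamma> * normal_density 0 (sqrt t) (x + 1 * y))"
    by (rule integrable_mult_right)
  show "(\<lambda>y. indicator {0..} y * g0 \<gamma> t (x + y)) \<in> borel_measurable lborel" by measurable
  show "AE y in lborel. norm (indicator {0..} y * g0 \<gamma> t (x + y))
      \<le> norm (sqrt (2 * pi * t) / \<gamma> * normal_density 0 (sqrt t) (x + 1 * y))"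
  proof (intro AE_I2)
    fix y :: real
    have "sqrt (2 * pi * t) / \<gamma> * normal_density 0 (sqrt t) (x + 1 * y)
        = 1 / \<gamma> * exp (- (x + y)\<^sup>2 / (2 * t))"
      using assms by (simp add: normal_density_def)
    then show "norm (indicator {0..} y * g0 \<gamma> t (x + y))
      \<le> norm (sqrt (2 * pi * t) / \<gamma> * normal_density 0 (sqrt t) (x + 1 * y))"
      using g0_le[OF assms(1,2), of "x + y"] g0_nonneg[OF assms(1), of t "x + y"] assms
      by (auto simp: indicator_def)
  qed
qed

lemma g0_shift_tendsto_0:
  assumes "0 < \<gamma>" "0 < t" "0 \<le> x"
  shows "((\<lambda>y. g0 \<gamma> t (x + y)) \<longlongrightarrow> 0) at_top"
proof (rule Lim_null_comparison)
  show "\<forall>\<^sub>F y in at_top. norm (g0 \<gamma> t (x + y)) \<le> 1 / \<gamma> * exp (- (x + y)\<^sup>2 / (2 * t))"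
    using eventually_ge_at_top[of 0]
  proof eventually_elim
    case (elim y)
    then show ?case
      using g0_le[OF assms(1,2), of "x + y"] g0_nonneg[OF assms(1), of t "x + y"] assms by simp
  qed
  show "((\<lambda>y. 1 / \<gamma> * exp (- (x + y)\<^sup>2 / (2 * t))) \<longlongrightarrow> 0) at_top"
    using assms by real_asymp
qed

section \<open>The transform of the claimed law\<close>

lemma dirichlet_kernel_eq:
  assumes "0 < t"
  shows "dirichlet_kernel t x y = normal_density 0 (sqrt t) (x - y) - normal_density 0 (sqrt t) (x + y)"
  using assms by (simp add: dirichlet_kernel_def normal_density_def algebra_simps)

lemma dirichlet_kernel_nonneg:
  assumes "0 < t" "0 \<le> x" "0 \<le> y"
  shows "0 \<le> dirichlet_kernel t x y"
proof -
  have "(x - y)\<^sup>2 \<le> (x + y)\<^sup>2" using assms by (simp add: power2_eq_square algebra_simps)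
  then show ?thesis using assms by (simp add: dirichlet_kernel_def divide_right_mono)
qed

text \<open>Here \<psi> is extended to negative arguments by its formula, not evenly. It is then a
  combination of waves of frequency \<open>k\<close>, hence an eigenfunction of the heat semigroup
  on the whole line: the addition theorems apply, and the sine moment of the standard normal law is
  0.\<close>

lemma gauss_robin_integral:
  fixes k x t m :: real
  assumes "0 < t"
  defines "\<psi> \<equiv> \<lambda>y. cos (k * y) - m * k * sin (k * y)"
  shows "(\<integral>y. normal_density 0 (sqrt t) (x - y) * \<psi> y \<partial>lborel) = exp (- (k\<^sup>2 * t / 2)) * \<psi> x"
proof -
  let ?s = "k * sqrt t"
  interpret std: real_distribution std_normal_distribution by (rule real_dist_normal_dist)
  have int: "integrable std_normal_distribution (\<lambda>z. iexp (?s * z))" by (rule std.integrable_iexp) auto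
  have c: "(\<integral>z. cos (?s * z) \<partial>std_normal_distribution) = exp (- (k\<^sup>2 * t / 2))"
    and s: "(\<integral>z. sin (?s * z) \<partial>std_normal_distribution) = 0"
    and ic: "integrable std_normal_distribution (\<lambda>z. cos (?s * z))"
    and isin: "integrable std_normal_distribution (\<lambda>z. sin (?s * z))"
    using fun_cong[OF char_std_normal_distribution, of ?s] assms
      integrable_Re[OF int] integrable_Im[OF int] integral_Re[OF int] integral_Im[OF int]
    by (simp_all add: char_def Re_exp Im_exp power_mult_distrib)
  have "(\<integral>y. normal_density 0 (sqrt t) (x - y) * \<psi> y \<partial>lborel)
     = sqrt t * (\<integral>z. normal_density 0 (sqrt t) (x - (x + sqrt t * z)) * \<psi> (x + sqrt t * z) \<partial>lborel)"
    using assms by (subst lborel_integral_real_affine[of "sqrt t" _ x]) auto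
  also have "\<dots> = (\<integral>z. std_normal_density z * \<psi> (x + sqrt t * z) \<partial>lborel)"
    unfolding integral_mult_right_zero[symmetric] using assms
    by (intro Bochner_Integration.integral_cong)
      (auto simp: normal_density_def real_sqrt_mult power_mult_distrib)
  also have "\<dots> = (\<integral>z. \<psi> (x + sqrt t * z) \<partial>std_normal_distribution)"
    by (subst integral_density) (auto simp: \<psi>_def)
  also have "\<dots> = (\<integral>z. \<psi> x * cos (?s * z) - (sin (k * x) + m * k * cos (k * x)) * sin (?s * z) \<partial>std_normal_distribution)"
    by (rule Bochner_Integration.integral_cong)
      (auto simp: \<psi>_def distrib_left cos_add sin_add algebra_simps)
  also have "\<dots> = exp (- (k\<^sup>2 * t / 2)) * \<psi> x"
    using ic isin by (simp add: c s)
  finally show ?thesis .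
qed

lemma integrable_mult_robin:
  fixes f :: "real \<Rightarrow> real"
  assumes "integrable lborel f"
  shows "integrable lborel (\<lambda>y. f y * (cos (k * y) - m * k * sin (k * y)))"
proof (rule Bochner_Integration.integrable_bound)
  show "integrable lborel (\<lambda>y. (1 + \<bar>m * k\<bar>) * f y)" using assms by (rule integrable_mult_right)
  show "(\<lambda>y. f y * (cos (k * y) - m * k * sin (k * y))) \<in> borel_measurable lborel"
    using borel_measurable_integrable[OF assms] by measurable
  show "AE y in lborel. norm (f y * (cos (k * y) - m * k * sin (k * y))) \<le> norm ((1 + \<bar>m * k\<bar>) * f y)"
  proof (intro AE_I2)
    fix y
    have "\<bar>m * k * sin (k * y)\<bar> \<le> \<bar>m * k\<bar> * 1"
      unfolding abs_mult[of "m * k"] by (intro mult_left_mono) auto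
    then have "\<bar>cos (k * y) - m * k * sin (k * y)\<bar> \<le> 1 + \<bar>m * k\<bar>"
      using abs_cos_le_one[of "k * y"] by linarith
    then show "norm (f y * (cos (k * y) - m * k * sin (k * y))) \<le> norm ((1 + \<bar>m * k\<bar>) * f y)"
      by (simp add: abs_mult mult.commute mult_left_mono)
  qed
qed

text \<open>The atom at \<open>0\<close> is represented by uniform mass on \<open>(-1, 0)\<close>, which \<open>max 0\<close> then
  collapses to \<open>0\<close>.\<close>

definition sticky_density :: "real \<Rightarrow> real \<Rightarrow> real \<Rightarrow> real \<Rightarrow> real" where
  "sticky_density \<gamma> t x y = indicator {0..} y * (dirichlet_kernel t x y + 2 * g0 \<gamma> t (x + y))
     + indicator {-1<..<0} y * (\<gamma> * g0 \<gamma> t x)"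

definition sticky_law :: "real \<Rightarrow> real \<Rightarrow> real \<Rightarrow> real measure" where
  "sticky_law \<gamma> t x = distr (density lborel (\<lambda>y. ennreal (sticky_density \<gamma> t x y))) borel (max 0)"

lemma sticky_density_nonneg:
  assumes "0 < \<gamma>" "0 < t" "0 \<le> x"
  shows "0 \<le> sticky_density \<gamma> t x y"
  unfolding sticky_density_def using assms g0_nonneg[OF assms(1)] dirichlet_kernel_nonneg[OF assms(2,3)]
  by (auto simp: indicator_def)

lemma sticky_density_measurable [measurable]:
  assumes "0 < \<gamma>" "0 < t"
  shows "sticky_density \<gamma> t x \<in> borel_measurable borel"
proof -
  note g0_measurable[OF assms, measurable]
  show ?thesis unfolding sticky_density_def[abs_def] dirichlet_kernel_def by measurable
qed

text \<open>Reflecting the negative half of the Gaussian integral yields the required value minus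
  the integral of \<open>?n (x + y) * \<psi> (- y)\<close> over the half-line, and the Dirichlet
  kernel subtracts \<open>?n (x + y) * \<psi> y\<close> as well. Since
  \<open>\<psi> y + \<psi> (- y) = 2 * cos (k * y)\<close>, what has to be made up is a cosine
  integral of the Gaussian; the \<open>g0\<close> density and the atom supply it.\<close>

lemma sticky_density_robin_integral:
  fixes k x t \<gamma> :: real
  assumes pos: "0 < \<gamma>" "0 < t" "0 \<le> x"
  defines "\<psi> \<equiv> \<lambda>y. cos (k * y) - \<gamma> / 2 * k * sin (k * y)"
  shows "has_bochner_integral lborel (\<lambda>y. sticky_density \<gamma> t x y * \<psi> (max 0 y)) (exp (- (k\<^sup>2 * t / 2)) * \<psi> x)"
proof -
  let ?n = "normal_density 0 (sqrt t)"
  let ?I = "indicator {0..} :: real \<Rightarrow> real"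
  have \<psi>_meas [measurable]: "\<psi> \<in> borel_measurable borel" unfolding \<psi>_def by measurable
  note g0_measurable[OF pos(1,2), measurable]
  have in1: "integrable lborel (\<lambda>y. ?n (x - y))" and in2: "integrable lborel (\<lambda>y. ?n (x + y))"
    using lborel_integrable_real_affine[OF integrable_normal_density, of "sqrt t" "-1" 0 x]
      lborel_integrable_real_affine[OF integrable_normal_density, of "sqrt t" "1" 0 x] pos by simp_all
  have i1: "integrable lborel (\<lambda>y. ?n (x - y) * \<psi> y)" and i2: "integrable lborel (\<lambda>y. ?n (x + y) * \<psi> y)"
    unfolding \<psi>_def by (intro integrable_mult_robin in1 in2)+
  have i2': "integrable lborel (\<lambda>y. ?n (x + y) * \<psi> (- y))"
    using lborel_integrable_real_affine[OF i1, of "-1" 0] by simp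
  have ind: "integrable lborel (\<lambda>y. indicator A y * f y)"
    if "integrable lborel f" "A \<in> sets borel" for f :: "real \<Rightarrow> real" and A
    using integrable_mult_indicator[of A lborel f] that by simp
  have "(\<integral>y. ?n (x - y) * \<psi> y \<partial>lborel)
      = (\<integral>y. ?I y * (?n (x - y) * \<psi> y) + indicator {..<0} y * (?n (x - y) * \<psi> y) \<partial>lborel)"
    by (intro Bochner_Integration.integral_cong) (auto simp: indicator_def)
  also have "\<dots> = (\<integral>y. ?I y * (?n (x - y) * \<psi> y) \<partial>lborel) + (\<integral>y. indicator {..<0} y * (?n (x - y) * \<psi> y) \<partial>lborel)"
    by (intro Bochner_Integration.integral_add ind i1) auto
  also have "(\<integral>y. indicator {..<0} y * (?n (x - y) * \<psi> y) \<partial>lborel)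
      = (\<integral>y. indicator {..<0} (- y) * (?n (x + y) * \<psi> (- y)) \<partial>lborel)"
    by (subst lborel_integral_real_affine[of "-1" _ 0]) auto
  also have "\<dots> = (\<integral>y. ?I y * (?n (x + y) * \<psi> (- y)) \<partial>lborel)"
    by (rule integral_cong_AE)
      (use AE_lborel_singleton[of "0::real"] in \<open>auto elim!: eventually_mono simp: indicator_def\<close>)
  finally have e1: "(\<integral>y. ?I y * (?n (x - y) * \<psi> y) \<partial>lborel)
      = exp (- (k\<^sup>2 * t / 2)) * \<psi> x - (\<integral>y. ?I y * (?n (x + y) * \<psi> (- y)) \<partial>lborel)"
    using gauss_robin_integral[OF pos(2), of x k "\<gamma> / 2"] by (simp add: \<psi>_def)
  \<comment> \<open>By the equation for \<open>g0\<close>, the derivative of \<open>?F\<close> is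
    the \<open>g0\<close> density times \<psi> minus the missing cosine term. Its integral over the
    half-line is the boundary value \<open>- \<gamma> * g0 \<gamma> t x\<close>, which the atom
    cancels because \<open>\<psi> 0 = 1\<close>.\<close>
  let ?F = "\<lambda>y. \<gamma> * (cos (k * y) * g0 \<gamma> t (x + y))"
  let ?f = "\<lambda>y. 2 * (g0 \<gamma> t (x + y) * \<psi> y) - ?n (x + y) * \<psi> y - ?n (x + y) * \<psi> (- y)"
  have ig: "integrable lborel (\<lambda>y. ?I y * (g0 \<gamma> t (x + y) * \<psi> y))"
    using integrable_mult_robin[OF g0_shift_integrable[OF pos], of k "\<gamma> / 2"] by (simp add: \<psi>_def mult.assoc)
  have F: "(?F has_vector_derivative ?f y) (at y)" for y
  proof -
    have g: "((\<lambda>y. g0 \<gamma> t (x + y)) has_real_derivative 2 / \<gamma> * (g0 \<gamma> t (x + y) - ?n (x + y))) (at y)"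
      using DERIV_chain2[OF g0_has_real_derivative[OF pos(1,2)] DERIV_add[OF DERIV_const DERIV_ident]]
      by simp
    have c: "((\<lambda>y. cos (k * y)) has_real_derivative - k * sin (k * y)) (at y)"
      by (auto intro!: derivative_eq_intros)
    show ?thesis
      unfolding has_real_derivative_iff_has_vector_derivative[symmetric]
      by (rule DERIV_cong[OF DERIV_cmult[OF DERIV_mult[OF c g]]])
        (use pos in \<open>simp add: \<psi>_def field_simps\<close>)
  qed
  have "(\<integral>y. ?I y *\<^sub>R ?f y \<partial>lborel) = 0 - ?F 0"
  proof (rule integral_FTC_atLeast)
    show "continuous_on {0..} ?f"
      unfolding \<psi>_def normal_density_def using pos
      by (auto intro!: continuous_intros continuous_on_compose2[OF g0_continuous[OF pos(1,2)]])
    show "integrable lborel (\<lambda>y. ?I y *\<^sub>R ?f y)"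
      using ig ind[OF i2] ind[OF i2'] by (simp add: right_diff_distrib mult.left_commute[of _ 2])
    show "(?F \<longlongrightarrow> 0) at_top"
    proof (rule Lim_null_comparison)
      show "\<forall>\<^sub>F y in at_top. norm (?F y) \<le> \<gamma> * g0 \<gamma> t (x + y)"
        using g0_nonneg[OF pos(1)] pos
        by (auto simp: abs_mult intro!: always_eventually mult_left_le_one_le)
      show "((\<lambda>y. \<gamma> * g0 \<gamma> t (x + y)) \<longlongrightarrow> 0) at_top"
        using tendsto_mult_left[OF g0_shift_tendsto_0[OF pos], of \<gamma>] by simp
    qed
  qed (rule F)
  then have e2: "2 * (\<integral>y. ?I y * (g0 \<gamma> t (x + y) * \<psi> y) \<partial>lborel)
      = (\<integral>y. ?I y * (?n (x + y) * \<psi> y) \<partial>lborel) + (\<integral>y. ?I y * (?n (x + y) * \<psi> (- y)) \<partial>lborel) - \<gamma> * g0 \<gamma> t x"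
    using ig ind[OF i2] ind[OF i2'] by (simp add: right_diff_distrib mult.left_commute[of _ 2])
  have split: "sticky_density \<gamma> t x y * \<psi> (max 0 y) = ?I y * (?n (x - y) * \<psi> y) - ?I y * (?n (x + y) * \<psi> y)
      + 2 * (?I y * (g0 \<gamma> t (x + y) * \<psi> y)) + indicator {-1<..<0} y * (\<gamma> * g0 \<gamma> t x)" for y
    by (auto simp: sticky_density_def dirichlet_kernel_eq[OF pos(2)] indicator_def \<psi>_def algebra_simps max_def)
  have ia: "integrable lborel (\<lambda>y. indicator {-1<..<0::real} y * (\<gamma> * g0 \<gamma> t x))"
    by (intro integrable_mult_left) (simp add: integrable_real_indicator)
  show ?thesis
    unfolding split has_bochner_integral_iff
    using ig ind[OF i1] ind[OF i2] ia e1 e2 by simp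
qed

lemma sticky_law_real_distribution:
  assumes pos: "0 < \<gamma>" "0 < t" "0 \<le> x"
  shows "real_distribution (sticky_law \<gamma> t x)"
proof -
  note sticky_density_measurable[OF pos(1,2), measurable]
  \<comment> \<open>For \<open>k = 0\<close> the test function is 1, so the transform formula itself
    shows that the total mass is 1.\<close>
  have "has_bochner_integral lborel (sticky_density \<gamma> t x) 1"
    using sticky_density_robin_integral[OF pos, of 0] by simp
  then have "prob_space (density lborel (\<lambda>y. ennreal (sticky_density \<gamma> t x y)))"
    using sticky_density_nonneg[OF pos]
    by (intro prob_spaceI)
      (auto simp: emeasure_density has_bochner_integral_iff nn_integral_eq_integral)
  then show ?thesis
    unfolding sticky_law_def by (intro prob_space.real_distribution_distr) auto
qed

lemma sticky_law_robin_integral: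
  assumes pos: "0 < \<gamma>" "0 < t" "0 \<le> x"
  shows "(\<integral>y. cos (k * y) - \<gamma> / 2 * k * sin (k * y) \<partial>sticky_law \<gamma> t x)
    = exp (- (k\<^sup>2 * t / 2)) * (cos (k * x) - \<gamma> / 2 * k * sin (k * x))"
proof -
  note sticky_density_measurable[OF pos(1,2), measurable]
  show ?thesis
    unfolding sticky_law_def
    using has_bochner_integral_integral_eq[OF sticky_density_robin_integral[OF pos, of k]]
    by (simp add: integral_distr integral_density sticky_density_nonneg[OF pos])
qed

text \<open>The interval \<open>(-1, 0)\<close> has length 1, so its image under
  \<open>max 0\<close> has the full weight of the atom. As \<open>C\<close> lies in the half-line,
  the two density terms never see negative arguments, where the Dirichlet kernel would change
  sign.\<close>

lemma emeasure_sticky_law: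
  assumes pos: "0 < \<gamma>" "0 < t" "0 \<le> x" and C: "C \<in> sets borel" "C \<subseteq> {0..}"
  shows "emeasure (sticky_law \<gamma> t x) C =
      emeasure (density lborel (\<lambda>y. ennreal (dirichlet_kernel t x y))) C
    + emeasure (density lborel (\<lambda>y. ennreal (2 * g0 \<gamma> t (x + y)))) C
    + ennreal (\<gamma> * g0 \<gamma> t x) * emeasure (return borel 0) C"
proof -
  note sticky_density_measurable[OF pos(1,2), measurable] g0_measurable[OF pos(1,2), measurable]
  note C(1)[measurable]
  have [measurable]: "(\<lambda>y. dirichlet_kernel t x y) \<in> borel_measurable borel"
    unfolding dirichlet_kernel_def by measurable
  have "emeasure (sticky_law \<gamma> t x) C = (\<integral>\<^sup>+y. ennreal (sticky_density \<gamma> t x y) * indicator C (max 0 y) \<partial>lborel)"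
    using measurable_sets[OF _ C(1), of "max 0" borel]
    unfolding sticky_law_def by (subst emeasure_distr)
      (auto simp: emeasure_density intro!: nn_integral_cong split: split_indicator)
  also have "\<dots> = (\<integral>\<^sup>+y. ennreal (dirichlet_kernel t x y) * indicator C y
      + ennreal (2 * g0 \<gamma> t (x + y)) * indicator C y
      + ennreal (\<gamma> * g0 \<gamma> t x) * indicator C (0::real) * indicator {-1<..<0} y \<partial>lborel)"
  proof (rule nn_integral_cong)
    fix y :: real
    consider "0 \<le> y" | "y < 0" by linarith
    then show "ennreal (sticky_density \<gamma> t x y) * indicator C (max 0 y) = ennreal (dirichlet_kernel t x y) * indicator C y
      + ennreal (2 * g0 \<gamma> t (x + y)) * indicator C y
      + ennreal (\<gamma> * g0 \<gamma> t x) * indicator C (0::real) * indicator {-1<..<0} y"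
    proof cases
      case 1
      then show ?thesis
        using dirichlet_kernel_nonneg[OF pos(2,3) 1] g0_nonneg[OF pos(1), of t "x + y"]
        by (auto simp: sticky_density_def max_def distrib_right)
    next
      case 2
      then have "y \<notin> C" using C by auto
      with 2 show ?thesis by (auto simp: sticky_density_def max_def mult.commute indicator_def)
    qed
  qed
  also have "\<dots> = (\<integral>\<^sup>+y. ennreal (dirichlet_kernel t x y) * indicator C y \<partial>lborel)
      + (\<integral>\<^sup>+y. ennreal (2 * g0 \<gamma> t (x + y)) * indicator C y \<partial>lborel)
      + ennreal (\<gamma> * g0 \<gamma> t x) * indicator C (0::real) * emeasure lborel {-1<..<0::real}"
    by (simp add: nn_integral_add nn_integral_cmult_indicator)
  finally show ?thesis by (simp add: emeasure_density)
qed

section \<open>Smooth parts and Taylor bounds\<close>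

text \<open>The mean value inequality applied twice, first to \<open>f'\<close> and then to
  \<open>f\<close>, which costs only the factor 1/6 of the sharp constant. A Lipschitz bound on
  \<open>f''\<close> is the right hypothesis because the second derivative in the application has a
  kink at 0.\<close>

lemma second_order_taylor_bound:
  fixes f f' f'' :: "real \<Rightarrow> real"
  assumes f: "\<And>x. (f has_real_derivative f' x) (at x)"
    and f': "\<And>x. (f' has_real_derivative f'' x) (at x)"
    and lip: "\<And>x y. \<bar>f'' x - f'' y\<bar> \<le> M * \<bar>x - y\<bar>" and M: "0 \<le> M"
  shows "\<bar>f (b + d) - f b - f' b * d - f'' b * d\<^sup>2 / 2\<bar> \<le> M * \<bar>d\<bar> ^ 3"
proof -
  let ?S = "closed_segment b (b + d)"
  have S: "\<bar>z - b\<bar> \<le> \<bar>d\<bar>" if "z \<in> ?S" for z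
    using that by (auto simp: closed_segment_eq_real_ivl split: if_splits)
  have 1: "\<bar>(f' z - f'' b * z) - (f' b - f'' b * b)\<bar> \<le> M * \<bar>d\<bar> * \<bar>d\<bar>" if z: "z \<in> ?S" for z
  proof -
    have "norm ((f' z - f'' b * z) - (f' b - f'' b * b)) \<le> M * \<bar>d\<bar> * norm (z - b)"
    proof (rule field_differentiable_bound[of ?S])
      fix w assume w: "w \<in> ?S"
      show "((\<lambda>z. f' z - f'' b * z) has_real_derivative f'' w - f'' b) (at w within ?S)"
        by (rule has_field_derivative_at_within) (auto intro!: derivative_eq_intros f')
      have "M * \<bar>w - b\<bar> \<le> M * \<bar>d\<bar>" using S[OF w] M by (rule mult_left_mono)
      then show "norm (f'' w - f'' b) \<le> M * \<bar>d\<bar>" using lip[of w b] by simp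
    qed (use z in auto)
    also have "\<dots> \<le> M * \<bar>d\<bar> * \<bar>d\<bar>" using S[OF z] M by (intro mult_left_mono) auto
    finally show ?thesis by simp
  qed
  let ?R = "\<lambda>z. f z - f' b * (z - b) - f'' b * (z - b)\<^sup>2 / 2"
  have "norm (?R (b + d) - ?R b) \<le> M * \<bar>d\<bar> * \<bar>d\<bar> * norm (b + d - b)"
  proof (rule field_differentiable_bound[of ?S])
    fix w assume w: "w \<in> ?S"
    show "(?R has_real_derivative f' w - f' b - f'' b * (w - b)) (at w within ?S)"
      by (rule has_field_derivative_at_within) (auto intro!: derivative_eq_intros f)
    show "norm (f' w - f' b - f'' b * (w - b)) \<le> M * \<bar>d\<bar> * \<bar>d\<bar>"
      using 1[OF w] by (simp add: algebra_simps)
  qed auto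
  then show ?thesis by (simp add: power3_eq_cube algebra_simps)
qed

text \<open>Away from 0 the sign is locally constant. At 0 the difference quotient is bounded in
  absolute value by that of \<open>f\<close>, which tends to \<open>f' 0 = 0\<close>.\<close>

lemma sgn_mult_has_real_derivative:
  fixes f f' :: "real \<Rightarrow> real"
  assumes f: "(f has_real_derivative f' x) (at x)" and "f 0 = 0" "f' 0 = 0"
  shows "((\<lambda>x. sgn x * f x) has_real_derivative sgn x * f' x) (at x)"
proof -
  consider "x = 0" | "0 < x" | "x < 0" by linarith
  then show ?thesis
  proof cases
    case 1
    then have "((\<lambda>y. f y / y) \<longlongrightarrow> 0) (at 0)" using assms by (simp add: has_field_derivative_iff)
    then have "((\<lambda>y. sgn y * f y / y) \<longlongrightarrow> 0) (at 0)"
      by (rule Lim_null_comparison[OF _ tendsto_rabs_zero, rotated]) (auto simp: abs_mult abs_sgn_eq)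
    then show ?thesis using 1 by (simp add: has_field_derivative_iff)
  next
    case 2
    have "\<forall>\<^sub>F y in nhds x. 0 < y" by (rule order_tendstoD[OF filterlim_ident 2])
    then have "\<forall>\<^sub>F y in nhds x. sgn y * f y = f y" by eventually_elim simp
    then show ?thesis using f 2 by (subst DERIV_cong_ev[OF refl _ refl]) auto
  next
    case 3
    have "\<forall>\<^sub>F y in nhds x. y < 0" by (rule order_tendstoD[OF filterlim_ident 3])
    then have "\<forall>\<^sub>F y in nhds x. sgn y * f y = - f y" by eventually_elim simp
    then show ?thesis using DERIV_minus[OF f] 3 by (subst DERIV_cong_ev[OF refl _ refl]) auto
  qed
qed

section \<open>Robin functions and their Taylor expansion\<close>

lemma abs_sin_diff_le: "\<bar>sin x - sin y\<bar> \<le> \<bar>x - y\<bar>" for x y :: real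
  using field_differentiable_bound[of UNIV sin cos 1 x y] by (auto intro: DERIV_sin)

lemma abs_cos_diff_le: "\<bar>cos x - cos y\<bar> \<le> \<bar>x - y\<bar>" for x y :: real
  using field_differentiable_bound[of UNIV cos "\<lambda>x. - sin x" 1 x y] by (auto intro: DERIV_cos)

text \<open>This is \<psi> evaluated at \<open>\<bar>b\<bar>\<close>, with
  \<open>\<beta> = \<gamma> / 2 * k\<close> in the application; the cosine is even and takes no
  absolute value. At the origin the value is 1 and the right derivative is
  \<open>- \<beta> * k\<close>, a boundary condition of Robin type.\<close>

definition robin :: "real \<Rightarrow> real \<Rightarrow> real \<Rightarrow> real" where
  "robin \<beta> k b = cos (k * b) - \<beta> * sin (k * \<bar>b\<bar>)"

lemma robin_measurable [measurable]: "robin \<beta> k \<in> borel_measurable borel"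
  unfolding robin_def[abs_def] by measurable

lemma robin_continuous: "continuous_on S (robin \<beta> k)"
  unfolding robin_def[abs_def] by (intro continuous_intros)

lemma abs_robin_le: "\<bar>robin \<beta> k b\<bar> \<le> 1 + \<bar>\<beta>\<bar>"
proof -
  have "\<bar>\<beta> * sin (k * \<bar>b\<bar>)\<bar> \<le> \<bar>\<beta>\<bar> * 1" unfolding abs_mult by (intro mult_left_mono) auto
  then show ?thesis using abs_cos_le_one[of "k * b"] unfolding robin_def by linarith
qed

lemma robin_lipschitz: "\<bar>robin \<beta> k b - robin \<beta> k b'\<bar> \<le> (1 + \<bar>\<beta>\<bar>) * \<bar>k\<bar> * \<bar>b - b'\<bar>"
proof -
  have "\<bar>cos (k * b) - cos (k * b')\<bar> \<le> \<bar>k\<bar> * \<bar>b - b'\<bar>"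
    using abs_cos_diff_le[of "k * b" "k * b'"] by (simp add: abs_mult[symmetric] algebra_simps)
  moreover have "\<bar>\<beta> * (sin (k * \<bar>b\<bar>) - sin (k * \<bar>b'\<bar>))\<bar> \<le> \<bar>\<beta>\<bar> * (\<bar>k\<bar> * \<bar>b - b'\<bar>)"
    unfolding abs_mult[of \<beta>]
  proof (intro mult_left_mono)
    have "\<bar>sin (k * \<bar>b\<bar>) - sin (k * \<bar>b'\<bar>)\<bar> \<le> \<bar>k * (\<bar>b\<bar> - \<bar>b'\<bar>)\<bar>"
      using abs_sin_diff_le[of "k * \<bar>b\<bar>" "k * \<bar>b'\<bar>"] by (simp add: algebra_simps)
    also have "\<dots> \<le> \<bar>k\<bar> * \<bar>b - b'\<bar>" unfolding abs_mult by (intro mult_left_mono) auto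
    finally show "\<bar>sin (k * \<bar>b\<bar>) - sin (k * \<bar>b'\<bar>)\<bar> \<le> \<bar>k\<bar> * \<bar>b - b'\<bar>" .
  qed auto
  ultimately show ?thesis by (simp add: robin_def algebra_simps) (smt (verit))
qed

text \<open>Adding \<open>\<beta> k \<bar>b\<bar>\<close> to \<open>robin \<beta> k b\<close> removes the kink at \<open>0\<close>.\<close>

definition robin_smooth :: "real \<Rightarrow> real \<Rightarrow> real \<Rightarrow> real" where
  "robin_smooth \<beta> k b = robin \<beta> k b + \<beta> * k * \<bar>b\<bar>"

definition robin_smooth_deriv :: "real \<Rightarrow> real \<Rightarrow> real \<Rightarrow> real" where
  "robin_smooth_deriv \<beta> k b = - k * sin (k * b) - \<beta> * (sgn b * (k * cos (k * b) - k))"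

lemma robin_smooth_measurable [measurable]:
  "robin_smooth \<beta> k \<in> borel_measurable borel" "robin_smooth_deriv \<beta> k \<in> borel_measurable borel"
  unfolding robin_smooth_def[abs_def] robin_smooth_deriv_def[abs_def] by measurable

lemma abs_robin_smooth_deriv_le: "\<bar>robin_smooth_deriv \<beta> k b\<bar> \<le> \<bar>k\<bar> + 2 * \<bar>\<beta>\<bar> * \<bar>k\<bar>"
proof -
  have "\<bar>k * sin (k * b)\<bar> \<le> \<bar>k\<bar> * 1" unfolding abs_mult by (intro mult_left_mono) auto
  moreover have "\<bar>\<beta> * (sgn b * (k * (cos (k * b) - 1)))\<bar> \<le> \<bar>\<beta>\<bar> * (1 * (\<bar>k\<bar> * 2))"
    unfolding abs_mult
  proof (intro mult_left_mono mult_mono)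
    show "\<bar>cos (k * b) - 1\<bar> \<le> 2" using abs_cos_le_one[of "k * b"] by linarith
  qed (auto simp: abs_sgn_eq)
  ultimately show ?thesis by (simp add: robin_smooth_deriv_def algebra_simps)
qed

text \<open>After removal of the kink, the sine part is \<open>sgn b\<close> times
  \<open>sin (k * b) - k * b\<close>, which vanishes at 0 together with its first two derivatives,
  so the sign may be differentiated through twice. The second derivative is
  \<open>- (k^2) * robin \<beta> k\<close>, Lipschitz across 0, and the remainder is cubic uniformly
  in \<open>b\<close>.\<close>

lemma robin_smooth_taylor:
  "\<bar>robin_smooth \<beta> k (b + d) - robin_smooth \<beta> k b - robin_smooth_deriv \<beta> k b * d
     + k\<^sup>2 / 2 * robin \<beta> k b * d\<^sup>2\<bar> \<le> k\<^sup>2 * ((1 + \<bar>\<beta>\<bar>) * \<bar>k\<bar>) * \<bar>d\<bar> ^ 3"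
proof -
  have eq: "robin_smooth \<beta> k = (\<lambda>b. cos (k * b) - \<beta> * (sgn b * (sin (k * b) - k * b)))"
    by (auto simp: fun_eq_iff robin_smooth_def robin_def sgn_real_def abs_real_def algebra_simps)
  have 1: "(robin_smooth \<beta> k has_real_derivative robin_smooth_deriv \<beta> k x) (at x)" for x
    unfolding eq robin_smooth_deriv_def
    by (intro DERIV_diff DERIV_cmult sgn_mult_has_real_derivative[where f' = "\<lambda>b. k * cos (k * b) - k"])
      (auto intro!: derivative_eq_intros)
  have 2: "(robin_smooth_deriv \<beta> k has_real_derivative - (k\<^sup>2) * robin \<beta> k x) (at x)" for x
  proof -
    have "(robin_smooth_deriv \<beta> k has_real_derivative - k * (k * cos (k * x)) - \<beta> * (sgn x * (- (k\<^sup>2) * sin (k * x)))) (at x)"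
      unfolding robin_smooth_deriv_def[abs_def]
      by (intro DERIV_diff DERIV_cmult sgn_mult_has_real_derivative[where f' = "\<lambda>b. - (k\<^sup>2) * sin (k * b)"])
        (auto intro!: derivative_eq_intros simp: power2_eq_square)
    then show ?thesis
      by (rule DERIV_cong) (auto simp: robin_def power2_eq_square sgn_real_def abs_real_def algebra_simps)
  qed
  have "\<bar>- (k\<^sup>2) * robin \<beta> k x - - (k\<^sup>2) * robin \<beta> k y\<bar> \<le> k\<^sup>2 * ((1 + \<bar>\<beta>\<bar>) * \<bar>k\<bar>) * \<bar>x - y\<bar>" for x y
  proof -
    have "\<bar>- (k\<^sup>2) * robin \<beta> k x - - (k\<^sup>2) * robin \<beta> k y\<bar> = k\<^sup>2 * \<bar>robin \<beta> k x - robin \<beta> k y\<bar>"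
      by (simp add: abs_mult abs_minus_commute flip: right_diff_distrib minus_mult_right)
    also have "\<dots> \<le> k\<^sup>2 * ((1 + \<bar>\<beta>\<bar>) * \<bar>k\<bar> * \<bar>x - y\<bar>)"
      by (intro mult_left_mono robin_lipschitz) auto
    finally show ?thesis by (simp add: mult.assoc)
  qed
  from second_order_taylor_bound[OF 1 2 this, of b d] show ?thesis by (simp add: algebra_simps)
qed

text \<open>The \<open>X n\<close> are only assumed integrable; it is the differences
  \<open>X n - Y\<close> that eventually have a finite second moment. The bounded weight
  \<open>Z\<close> is what lets orthogonality relations pass to the limit.\<close>

lemma (in prob_space) square_mean_convergence:
  fixes X :: "nat \<Rightarrow> 'a \<Rightarrow> real"
  assumes X: "\<And>n. integrable M (X n)" and Y [measurable]: "Y \<in> borel_measurable M"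
    and conv: "(\<lambda>n. \<integral>\<^sup>+\<omega>. ennreal ((X n \<omega> - Y \<omega>)\<^sup>2) \<partial>M) \<longlonglongrightarrow> 0"
  shows "integrable M Y"
    and "\<And>Z (K :: real). Z \<in> borel_measurable M \<Longrightarrow> (\<And>\<omega>. \<omega> \<in> space M \<Longrightarrow> \<bar>Z \<omega>\<bar> \<le> K)
      \<Longrightarrow> (\<lambda>n. expectation (\<lambda>\<omega>. Z \<omega> * X n \<omega>)) \<longlonglongrightarrow> expectation (\<lambda>\<omega>. Z \<omega> * Y \<omega>)"
proof -
  have Xm [measurable]: "X n \<in> borel_measurable M" for n using X by (rule borel_measurable_integrable)
  have ev: "\<forall>\<^sub>F n in sequentially. (\<integral>\<^sup>+\<omega>. ennreal ((X n \<omega> - Y \<omega>)\<^sup>2) \<partial>M) < 1"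
    by (rule order_tendstoD[OF conv]) simp
  have sq: "integrable M (\<lambda>\<omega>. (X n \<omega> - Y \<omega>)\<^sup>2)" if "(\<integral>\<^sup>+\<omega>. ennreal ((X n \<omega> - Y \<omega>)\<^sup>2) \<partial>M) < 1" for n
    using that by (intro integrableI_nonneg) (auto intro: less_trans)
  have d: "integrable M (\<lambda>\<omega>. X n \<omega> - Y \<omega>)" if "(\<integral>\<^sup>+\<omega>. ennreal ((X n \<omega> - Y \<omega>)\<^sup>2) \<partial>M) < 1" for n
    by (rule square_integrable_imp_integrable[OF _ sq[OF that]]) simp
  obtain n0 where "(\<integral>\<^sup>+\<omega>. ennreal ((X n0 \<omega> - Y \<omega>)\<^sup>2) \<partial>M) < 1"
    using eventually_happens[OF ev] by auto
  from Bochner_Integration.integrable_diff[OF X[of n0] d[OF this]] show Yi: "integrable M Y" by simp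
  fix Z and K :: real assume Z [measurable]: "Z \<in> borel_measurable M" and K: "\<And>\<omega>. \<omega> \<in> space M \<Longrightarrow> \<bar>Z \<omega>\<bar> \<le> K"
  obtain \<omega>0 where "\<omega>0 \<in> space M" using not_empty by blast
  then have K0: "0 \<le> K" using K[of \<omega>0] by simp
  have Zi: "integrable M (\<lambda>\<omega>. Z \<omega> * f \<omega>)" if "integrable M f" for f :: "'a \<Rightarrow> real"
  proof (rule Bochner_Integration.integrable_bound[OF integrable_mult_right[OF that, of K]])
    show "AE \<omega> in M. norm (Z \<omega> * f \<omega>) \<le> norm (K * f \<omega>)"
      using K K0 by (auto simp: abs_mult intro!: mult_right_mono)
  qed (use that in measurable)
  let ?q = "\<lambda>n. enn2real (\<integral>\<^sup>+\<omega>. ennreal ((X n \<omega> - Y \<omega>)\<^sup>2) \<partial>M)"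
  have "?q \<longlonglongrightarrow> 0" by (rule tendsto_enn2real[of _ 0, unfolded ennreal_0, OF conv order_refl])
  then have "(\<lambda>n. K * sqrt (?q n)) \<longlonglongrightarrow> K * sqrt 0"
    by (rule tendsto_mult_left[OF tendsto_real_sqrt])
  then have lim: "(\<lambda>n. K * sqrt (?q n)) \<longlonglongrightarrow> 0" by simp
  have "\<forall>\<^sub>F n in sequentially. norm (expectation (\<lambda>\<omega>. Z \<omega> * X n \<omega>) - expectation (\<lambda>\<omega>. Z \<omega> * Y \<omega>)) \<le> K * sqrt (?q n)"
    using ev
  proof eventually_elim
    case (elim n)
    let ?D = "\<lambda>\<omega>. X n \<omega> - Y \<omega>"
    have "expectation (\<lambda>\<omega>. Z \<omega> * X n \<omega>) - expectation (\<lambda>\<omega>. Z \<omega> * Y \<omega>) = expectation (\<lambda>\<omega>. Z \<omega> * ?D \<omega>)"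
      using Zi[OF X] Zi[OF Yi] by (simp add: right_diff_distrib)
    also have "norm \<dots> \<le> expectation (\<lambda>\<omega>. norm (Z \<omega> * ?D \<omega>))" by (rule integral_norm_bound)
    also have "\<dots> \<le> expectation (\<lambda>\<omega>. K * \<bar>?D \<omega>\<bar>)"
      by (rule integral_mono[OF integrable_norm[OF Zi[OF d[OF elim]]] integrable_mult_right[OF integrable_abs[OF d[OF elim]]]])
        (use K in \<open>auto simp: abs_mult intro!: mult_right_mono\<close>)
    also have "\<dots> = K * expectation (\<lambda>\<omega>. \<bar>?D \<omega>\<bar>)" by simp
    also have "\<dots> \<le> K * sqrt (?q n)"
    proof (rule mult_left_mono[OF _ K0], rule real_le_rsqrt)
      \<comment> \<open>Cauchy-Schwarz against the constant 1, in the form of nonnegativity of a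
        variance.\<close>
      have "variance (\<lambda>\<omega>. \<bar>?D \<omega>\<bar>) = expectation (\<lambda>\<omega>. \<bar>?D \<omega>\<bar>\<^sup>2) - (expectation (\<lambda>\<omega>. \<bar>?D \<omega>\<bar>))\<^sup>2"
        by (rule variance_eq) (use d[OF elim] sq[OF elim] in auto)
      moreover have "0 \<le> variance (\<lambda>\<omega>. \<bar>?D \<omega>\<bar>)" by (rule variance_positive)
      moreover have "expectation (\<lambda>\<omega>. \<bar>?D \<omega>\<bar>\<^sup>2) = ?q n"
        by (subst integral_eq_nn_integral) auto
      ultimately show "(expectation (\<lambda>\<omega>. \<bar>?D \<omega>\<bar>))\<^sup>2 \<le> ?q n" by simp
    qed
    finally show ?case .
  qed
  from Lim_null_comparison[OF this lim]
  show "(\<lambda>n. expectation (\<lambda>\<omega>. Z \<omega> * X n \<omega>)) \<longlonglongrightarrow> expectation (\<lambda>\<omega>. Z \<omega> * Y \<omega>)"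
    by (rule LIM_zero_cancel)
qed

section \<open>Brownian increments and local time\<close>

context brownian_family
begin

lemma space_P [simp]: "space (P x) = space A"
  by (rule sets_eq_imp_space_eq[OF sets_P])

lemma space_F: "0 \<le> s \<Longrightarrow> space (F s) = space A"
  using subalgebra_F by (simp add: subalgebra_def)

lemma F_imp_P_measurable:
  assumes "0 \<le> s" "f \<in> measurable (F s) N"
  shows "f \<in> measurable (P x) N"
  using measurable_from_subalg[OF subalgebra_F[OF assms(1)] assms(2)]
  by (simp add: measurable_cong_sets[OF sets_P refl])

lemma F_measurable_mono:
  assumes "0 \<le> s" "s \<le> u" "f \<in> measurable (F s) N"
  shows "f \<in> measurable (F u) N"
proof (rule measurable_from_subalg[OF _ assms(3)])
  show "subalgebra (F u) (F s)"
    using assms(1,2) F_mono by (simp add: subalgebra_def space_F)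
qed

lemma B_P_measurable: "0 \<le> s \<Longrightarrow> B s \<in> borel_measurable (P x)"
  using F_imp_P_measurable[OF _ B_adapted] .

lemma integrable_F_bounded:
  assumes "0 \<le> s" "Z \<in> borel_measurable (F s)" "\<And>\<omega>. \<omega> \<in> space A \<Longrightarrow> \<bar>Z \<omega>\<bar> \<le> (K :: real)"
  shows "integrable (P x) Z"
proof -
  interpret prob_space "P x" by (rule prob_space_P)
  show ?thesis
    by (rule integrable_const_bound[of _ K]) (use assms F_imp_P_measurable in \<open>auto intro!: AE_I2\<close>)
qed

text \<open>\<open>Z\<close> generates a sub-sigma-algebra of \<open>F s\<close>, and
  \<open>g\<close> of the increment generates one of that of the increment. Independence therefore
  passes to the two variables and the expectation factorises.\<close>

lemma increment_product:
  fixes Z :: "'a \<Rightarrow> real" and g :: "real \<Rightarrow> real"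
  assumes su: "0 \<le> s" "s < u" and Z: "Z \<in> borel_measurable (F s)"
    and bd: "\<And>\<omega>. \<omega> \<in> space A \<Longrightarrow> \<bar>Z \<omega>\<bar> \<le> K" and g [measurable]: "g \<in> borel_measurable borel"
    and int: "integrable lborel (\<lambda>y. normal_density 0 (sqrt (u - s)) y * g y)"
  shows "integrable (P x) (\<lambda>\<omega>. g (B u \<omega> - B s \<omega>))"
    and "integrable (P x) (\<lambda>\<omega>. Z \<omega> * g (B u \<omega> - B s \<omega>))"
    and "(\<integral>\<omega>. Z \<omega> * g (B u \<omega> - B s \<omega>) \<partial>P x)
       = (\<integral>\<omega>. Z \<omega> \<partial>P x) * (\<integral>y. normal_density 0 (sqrt (u - s)) y * g y \<partial>lborel)"
proof -
  interpret prob_space "P x" by (rule prob_space_P)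
  let ?D = "\<lambda>\<omega>. B u \<omega> - B s \<omega>"
  have D: "distributed (P x) lborel ?D (normal_density 0 (sqrt (u - s)))"
    by (rule B_increment_normal[OF su])
  have Dm [measurable]: "?D \<in> borel_measurable (P x)"
    using B_P_measurable su by (intro borel_measurable_diff) auto
  have Zm: "Z \<in> borel_measurable (P x)" by (rule F_imp_P_measurable[OF su(1) Z])
  show gi: "integrable (P x) (\<lambda>\<omega>. g (?D \<omega>))"
    using int distributed_integrable[OF D, of g] by simp
  have ind: "indep_set (sets (F s)) (sets (vimage_algebra (space A) ?D borel))"
    by (rule B_increment_indep[OF su])
  have "indep_var borel Z borel (\<lambda>\<omega>. g (?D \<omega>))"
    unfolding indep_var_eq
  proof (intro conjI)
    show "indep_set (sigma_sets (space (P x)) {Z -` A \<inter> space (P x) |A. A \<in> sets borel})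
      (sigma_sets (space (P x)) {(\<lambda>\<omega>. g (?D \<omega>)) -` A \<inter> space (P x) |A. A \<in> sets borel})"
      unfolding indep_set_def
    proof (rule indep_sets_mono_sets[OF ind[unfolded indep_set_def]])
      have 1: "sigma_sets (space A) {Z -` C \<inter> space A |C. C \<in> sets borel} \<subseteq> sets (F s)"
        using measurable_sets[OF Z] sets.sigma_sets_subset[of "{Z -` C \<inter> space A |C. C \<in> sets borel}" "F s"]
        by (auto simp: space_F[OF su(1)])
      have 2: "sigma_sets (space A) {(\<lambda>\<omega>. g (?D \<omega>)) -` C \<inter> space A |C. C \<in> sets borel}
          \<subseteq> sets (vimage_algebra (space A) ?D borel)"
      proof -
        have "(\<lambda>\<omega>. g (?D \<omega>)) -` C \<inter> space A \<in> sets (vimage_algebra (space A) ?D borel)"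
          if C: "C \<in> sets borel" for C
        proof -
          have "g -` C \<in> sets borel" using measurable_sets[OF g C] by simp
          from in_vimage_algebra[OF this, of ?D "space A"] show ?thesis
            by (simp add: vimage_def)
        qed
        then show ?thesis
          using sets.sigma_sets_subset[of "{(\<lambda>\<omega>. g (?D \<omega>)) -` C \<inter> space A |C. C \<in> sets borel}"
            "vimage_algebra (space A) ?D borel"] by auto
      qed
      show "(case b of True \<Rightarrow> sigma_sets (space (P x)) {Z -` A \<inter> space (P x) |A. A \<in> sets borel}
          | False \<Rightarrow> sigma_sets (space (P x)) {(\<lambda>\<omega>. g (?D \<omega>)) -` A \<inter> space (P x) |A. A \<in> sets borel})
        \<subseteq> (case b of True \<Rightarrow> sets (F s) | False \<Rightarrow> sets (vimage_algebra (space A) ?D borel))" for b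
        using 1 2 by (cases b) auto
    qed
  qed (use Zm in auto)
  from indep_var_lebesgue_integral[OF this integrable_F_bounded[OF su(1) Z bd] gi]
    indep_var_integrable[OF this integrable_F_bounded[OF su(1) Z bd] gi]
  show "integrable (P x) (\<lambda>\<omega>. Z \<omega> * g (?D \<omega>))"
    and "(\<integral>\<omega>. Z \<omega> * g (?D \<omega>) \<partial>P x)
       = (\<integral>\<omega>. Z \<omega> \<partial>P x) * (\<integral>y. normal_density 0 (sqrt (u - s)) y * g y \<partial>lborel)"
    using distributed_integral[OF D, of g] by simp_all
qed

text \<open>The weighted first and second moments evaluate the Taylor expansion, the absolute third
  moment bounds its remainder, and the fourth controls large increments in the local time
  estimate.\<close>

lemma increment_moments:
  fixes Z :: "'a \<Rightarrow> real"
  assumes su: "0 \<le> s" "s < u" and Z: "Z \<in> borel_measurable (F s)"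
    and bd: "\<And>\<omega>. \<omega> \<in> space A \<Longrightarrow> \<bar>Z \<omega>\<bar> \<le> K"
  shows "integrable (P x) (\<lambda>\<omega>. Z \<omega> * (B u \<omega> - B s \<omega>))"
    and "(\<integral>\<omega>. Z \<omega> * (B u \<omega> - B s \<omega>) \<partial>P x) = 0"
    and "integrable (P x) (\<lambda>\<omega>. Z \<omega> * (B u \<omega> - B s \<omega>)\<^sup>2)"
    and "(\<integral>\<omega>. Z \<omega> * (B u \<omega> - B s \<omega>)\<^sup>2 \<partial>P x) = (\<integral>\<omega>. Z \<omega> \<partial>P x) * (u - s)"
    and "integrable (P x) (\<lambda>\<omega>. \<bar>B u \<omega> - B s \<omega>\<bar> ^ 3)"
    and "(\<integral>\<omega>. \<bar>B u \<omega> - B s \<omega>\<bar> ^ 3 \<partial>P x) \<le> 2 * ((u - s) * sqrt (u - s))"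
    and "integrable (P x) (\<lambda>\<omega>. (B u \<omega> - B s \<omega>) ^ 4)"
    and "(\<integral>\<omega>. (B u \<omega> - B s \<omega>) ^ 4 \<partial>P x) = 3 * (u - s)\<^sup>2"
proof -
  let ?\<sigma> = "sqrt (u - s)"
  have \<sigma>: "0 < ?\<sigma>" using su by simp
  interpret prob_space "P x" by (rule prob_space_P)
  have prob_space_A: "prob (space A) = 1" using prob_space by simp
  have i1: "has_bochner_integral lborel (\<lambda>y. normal_density 0 ?\<sigma> y * y) 0"
    using normal_moment_odd[OF \<sigma>, of 0 0] by simp
  have i2: "has_bochner_integral lborel (\<lambda>y. normal_density 0 ?\<sigma> y * y\<^sup>2) (u - s)"
    using normal_moment_even[OF \<sigma>, of 0 1] su by (simp add: diff_divide_distrib)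
  have i3: "has_bochner_integral lborel (\<lambda>y. normal_density 0 ?\<sigma> y * \<bar>y\<bar> ^ 3) (2 * ((u - s) * ?\<sigma>) * sqrt (2 / pi))"
    using normal_moment_abs_odd[OF \<sigma>, of 0 1] su by (simp add: power3_eq_cube)
  have i4: "has_bochner_integral lborel (\<lambda>y. normal_density 0 ?\<sigma> y * y ^ 4) (3 * (u - s)\<^sup>2)"
    using normal_moment_even[OF \<sigma>, of 0 2] su by (simp add: fact_numeral field_simps power_divide)
  note ip = increment_product[OF su Z bd]
  note i1' = i1[unfolded has_bochner_integral_iff] and i2' = i2[unfolded has_bochner_integral_iff]
    and i3' = i3[unfolded has_bochner_integral_iff] and i4' = i4[unfolded has_bochner_integral_iff]
  show "integrable (P x) (\<lambda>\<omega>. Z \<omega> * (B u \<omega> - B s \<omega>))"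
    "(\<integral>\<omega>. Z \<omega> * (B u \<omega> - B s \<omega>) \<partial>P x) = 0"
    using ip(2,3)[of "\<lambda>y. y"] i1' by auto
  show "integrable (P x) (\<lambda>\<omega>. Z \<omega> * (B u \<omega> - B s \<omega>)\<^sup>2)"
    "(\<integral>\<omega>. Z \<omega> * (B u \<omega> - B s \<omega>)\<^sup>2 \<partial>P x) = (\<integral>\<omega>. Z \<omega> \<partial>P x) * (u - s)"
    using ip(2,3)[of "\<lambda>y. y\<^sup>2"] i2' by auto
  note i1p = increment_product[OF su, of "\<lambda>_. 1" 1]
  show "integrable (P x) (\<lambda>\<omega>. \<bar>B u \<omega> - B s \<omega>\<bar> ^ 3)"
    using i1p(1)[of "\<lambda>y. \<bar>y\<bar> ^ 3"] i3' by simp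
  \<comment> \<open>The exact third moment has the further factor \<open>sqrt (2 / pi)\<close>,
    which is below 1 and is dropped.\<close>
  have "2 * ((u - s) * ?\<sigma>) * sqrt (2 / pi) \<le> 2 * ((u - s) * ?\<sigma>) * 1"
    using su pi_gt3 by (intro mult_left_mono) auto
  then show "(\<integral>\<omega>. \<bar>B u \<omega> - B s \<omega>\<bar> ^ 3 \<partial>P x) \<le> 2 * ((u - s) * ?\<sigma>)"
    using i1p(3)[of "\<lambda>y. \<bar>y\<bar> ^ 3"] i3' by (simp add: prob_space_A)
  show "integrable (P x) (\<lambda>\<omega>. (B u \<omega> - B s \<omega>) ^ 4)"
    "(\<integral>\<omega>. (B u \<omega> - B s \<omega>) ^ 4 \<partial>P x) = 3 * (u - s)\<^sup>2"
    using i1p(1,3)[of "\<lambda>y. y ^ 4"] i4' by (simp_all add: prob_space_A)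
qed

lemma integrable_mult_F_bounded:
  fixes Z :: "'a \<Rightarrow> real"
  assumes "0 \<le> s" "Z \<in> borel_measurable (F s)" "\<And>\<omega>. \<omega> \<in> space A \<Longrightarrow> \<bar>Z \<omega>\<bar> \<le> K"
    and f: "integrable (P x) f"
  shows "integrable (P x) (\<lambda>\<omega>. Z \<omega> * f \<omega>)"
proof (rule Bochner_Integration.integrable_bound[OF integrable_mult_right[OF f, of K]])
  show "(\<lambda>\<omega>. Z \<omega> * f \<omega>) \<in> borel_measurable (P x)"
    using F_imp_P_measurable[OF assms(1,2)] f by measurable
  have "\<bar>Z \<omega>\<bar> * \<bar>f \<omega>\<bar> \<le> \<bar>K\<bar> * \<bar>f \<omega>\<bar>" if "\<omega> \<in> space A" for \<omega>
    using assms(3)[OF that] by (intro mult_right_mono) auto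
  then show "AE \<omega> in P x. norm (Z \<omega> * f \<omega>) \<le> norm (K * f \<omega>)"
    by (auto simp: abs_mult)
qed

lemma B_integrable:
  assumes "0 \<le> u"
  shows "integrable (P x) (B u)"
proof -
  interpret prob_space "P x" by (rule prob_space_P)
  have B0: "integrable (P x) (B 0)"
    using integrable_cong_AE[of "B 0" "P x" "\<lambda>_. x"] B_start[of x] B_P_measurable[of 0] by simp
  show ?thesis
  proof (cases "u = 0")
    case False
    then have "integrable (P x) (\<lambda>\<omega>. 1 * (B u \<omega> - B 0 \<omega>))"
      using assms by (intro increment_moments(1)[of 0 u _ 1]) auto
    from Bochner_Integration.integrable_add[OF this B0] show ?thesis by simp
  qed (use B0 in simp)
qed

text \<open>The difference is a single increment of \<open>B\<close>, over the intersection of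
  \<open>(s, t]\<close> with \<open>(a, b]\<close>. At its left end both \<open>Z\<close> and \<xi>
  are already known, so the increment has mean 0 against their product.\<close>

lemma martingale_transform:
  fixes Z \<xi> :: "'a \<Rightarrow> real"
  assumes "0 \<le> s" "s \<le> t" "0 \<le> a" "a \<le> b"
    and Z: "Z \<in> borel_measurable (F s)" "\<And>\<omega>. \<omega> \<in> space A \<Longrightarrow> \<bar>Z \<omega>\<bar> \<le> K"
    and \<xi>: "\<xi> \<in> borel_measurable (F a)" "\<And>\<omega>. \<omega> \<in> space A \<Longrightarrow> \<bar>\<xi> \<omega>\<bar> \<le> K'"
  defines "X \<equiv> \<lambda>\<omega>. Z \<omega> * (\<xi> \<omega> * (B (min t b) \<omega> - B (min t a) \<omega>) - \<xi> \<omega> * (B (min s b) \<omega> - B (min s a) \<omega>))"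
  shows "integrable (P x) X" "(\<integral>\<omega>. X \<omega> \<partial>P x) = 0"
proof -
  let ?u = "min t (max s a)" and ?v = "min t (max s b)"
  have X: "X = (\<lambda>\<omega>. (Z \<omega> * \<xi> \<omega>) * (B ?v \<omega> - B ?u \<omega>))"
  proof
    fix \<omega>
    have "B (min t p) \<omega> - B (min s p) \<omega> = B (min t (max s p)) \<omega> - B s \<omega>" for p
      using assms(2) by (auto simp: min_def max_def)
    note h = this[of a] this[of b]
    have "X \<omega> = (Z \<omega> * \<xi> \<omega>) * ((B (min t b) \<omega> - B (min s b) \<omega>) - (B (min t a) \<omega> - B (min s a) \<omega>))"
      by (simp add: X_def algebra_simps)
    then show "X \<omega> = (Z \<omega> * \<xi> \<omega>) * (B ?v \<omega> - B ?u \<omega>)"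
      unfolding h by simp
  qed
  have "integrable (P x) X \<and> (\<integral>\<omega>. X \<omega> \<partial>P x) = 0"
  proof (cases "?u < ?v")
    case True
    \<comment> \<open>Strictness excludes \<open>?u = t\<close>, so \<open>?u\<close> is
      \<open>max s a\<close> and lies after both \<open>s\<close> and \<open>a\<close>.\<close>
    then have u: "0 \<le> ?u" "s \<le> ?u" "a \<le> ?u" using assms(1-4) by (auto simp: min_def max_def split: if_splits)
    have 1: "(\<lambda>\<omega>. Z \<omega> * \<xi> \<omega>) \<in> borel_measurable (F ?u)"
      using F_measurable_mono[OF assms(1) u(2) Z(1)] F_measurable_mono[OF assms(3) u(3) \<xi>(1)] by measurable
    have 2: "\<bar>Z \<omega> * \<xi> \<omega>\<bar> \<le> K * K'" if "\<omega> \<in> space A" for \<omega>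
      unfolding abs_mult using Z(2)[OF that] \<xi>(2)[OF that] by (intro mult_mono) auto
    show ?thesis
      unfolding X using increment_moments(1,2)[OF u(1) True 1 2] by blast
  next
    case False
    then have "?u = ?v" using assms(1-4) by (auto simp: min_def max_def split: if_splits)
    then show ?thesis unfolding X by simp
  qed
  then show "integrable (P x) X" "(\<integral>\<omega>. X \<omega> \<partial>P x) = 0" by auto
qed

lemma simple_integral_martingale:
  assumes "simple_integrand F n T \<xi>" "0 \<le> s" "s \<le> t"
    and Z: "Z \<in> borel_measurable (F s)" "\<And>\<omega>. \<omega> \<in> space A \<Longrightarrow> \<bar>Z \<omega>\<bar> \<le> (K :: real)"
  shows "integrable (P x) (\<lambda>\<omega>. Z \<omega> * (simple_integral B n T \<xi> t \<omega> - simple_integral B n T \<xi> s \<omega>))"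
    and "(\<integral>\<omega>. Z \<omega> * (simple_integral B n T \<xi> t \<omega> - simple_integral B n T \<xi> s \<omega>) \<partial>P x) = 0"
proof -
  have T: "0 \<le> T i" if "i \<le> n" for i
    using that assms(1) by (induction i) (auto simp: simple_integrand_def intro: order_trans)
  have b: "\<exists>K'. \<forall>\<omega>\<in>space A. \<bar>\<xi> i \<omega>\<bar> \<le> K'" if "i < n" for i
  proof -
    have "bounded (\<xi> i ` space A)"
      using assms(1) that space_F[OF T[of i]] by (auto simp: simple_integrand_def)
    then show ?thesis by (auto simp: bounded_iff)
  qed
  let ?X = "\<lambda>i \<omega>. Z \<omega> * (\<xi> i \<omega> * (B (min t (T (Suc i))) \<omega> - B (min t (T i)) \<omega>) - \<xi> i \<omega> * (B (min s (T (Suc i))) \<omega> - B (min s (T i)) \<omega>))"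
  have eq: "Z \<omega> * (simple_integral B n T \<xi> t \<omega> - simple_integral B n T \<xi> s \<omega>) = (\<Sum>i<n. ?X i \<omega>)" for \<omega>
    by (simp add: simple_integral_def sum_subtractf[symmetric] sum_distrib_left)
  have X: "integrable (P x) (?X i) \<and> (\<integral>\<omega>. ?X i \<omega> \<partial>P x) = 0" if i: "i < n" for i
  proof -
    obtain K' where K': "\<And>\<omega>. \<omega> \<in> space A \<Longrightarrow> \<bar>\<xi> i \<omega>\<bar> \<le> K'" using b[OF i] by blast
    have le: "T i \<le> T (Suc i)" and m: "\<xi> i \<in> borel_measurable (F (T i))"
      using assms(1) i by (auto simp: simple_integrand_def)
    show ?thesis
      using martingale_transform[OF assms(2,3) T[OF less_imp_le[OF i]] le Z m K', where x = x] by simp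
  qed
  show "integrable (P x) (\<lambda>\<omega>. Z \<omega> * (simple_integral B n T \<xi> t \<omega> - simple_integral B n T \<xi> s \<omega>))"
    unfolding eq using X by (intro Bochner_Integration.integrable_sum) auto
  show "(\<integral>\<omega>. Z \<omega> * (simple_integral B n T \<xi> t \<omega> - simple_integral B n T \<xi> s \<omega>) \<partial>P x) = 0"
    unfolding eq using X by (subst Bochner_Integration.integral_sum) auto
qed

lemma simple_integral_0:
  assumes "simple_integrand F n T \<xi>"
  shows "simple_integral B n T \<xi> 0 \<omega> = 0"
proof -
  have T: "0 \<le> T i" if "i \<le> n" for i
    using that assms by (induction i) (auto simp: simple_integrand_def intro: order_trans)
  then show ?thesis by (auto simp: simple_integral_def min_def intro!: sum.neutral)
qed

text \<open>Each approximating simple integral has increments orthogonal to bounded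
  \<open>F s\<close>-measurable \<open>Z\<close>, and this relation survives the L2 limits at the
  two fixed times \<open>s\<close> and \<open>t\<close>.\<close>

lemma ito_martingale:
  assumes ito: "is_ito_integral (P x) F B H I" and "0 \<le> s" "s \<le> t"
    and Z: "Z \<in> borel_measurable (F s)" "\<And>\<omega>. \<omega> \<in> space A \<Longrightarrow> \<bar>Z \<omega>\<bar> \<le> (K :: real)"
  shows "integrable (P x) (I t)" and "(\<integral>\<omega>. Z \<omega> * (I t \<omega> - I s \<omega>) \<partial>P x) = 0"
proof -
  interpret prob_space "P x" by (rule prob_space_P)
  have I: "\<And>t. 0 \<le> t \<Longrightarrow> I t \<in> borel_measurable (F t)"
    using ito unfolding is_ito_integral_def by blast
  from ito have "\<exists>n T \<xi>. (\<forall>k. simple_integrand F (n k) (T k) (\<xi> k)) \<and>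
      (\<forall>t\<ge>0. (\<lambda>k. \<integral>\<^sup>+\<omega>.
             ennreal ((simple_integral B (n k) (T k) (\<xi> k) t \<omega> - I t \<omega>)\<^sup>2) \<partial>P x) \<longlonglongrightarrow> 0)"
    unfolding is_ito_integral_def by (elim conjE exE) (intro exI conjI)
  then obtain n T \<xi> where simple: "\<And>k. simple_integrand F (n k) (T k) (\<xi> k)"
    and conv: "\<And>t. 0 \<le> t \<Longrightarrow> (\<lambda>k. \<integral>\<^sup>+\<omega>.
             ennreal ((simple_integral B (n k) (T k) (\<xi> k) t \<omega> - I t \<omega>)\<^sup>2) \<partial>P x) \<longlonglongrightarrow> 0"
    by blast
  have Jint: "integrable (P x) (simple_integral B (n k) (T k) (\<xi> k) u)" if "0 \<le> u" for k u
    using simple_integral_martingale(1)[OF simple[of k], of 0 u "\<lambda>_. 1" 1 x] that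
    by (simp add: simple_integral_0[OF simple])
  have Im: "I u \<in> borel_measurable (P x)" if "0 \<le> u" for u
    using F_imp_P_measurable[OF that I[OF that]] .
  have t: "0 \<le> t" using assms by simp
  note sq = square_mean_convergence[OF Jint Im conv]
  show It: "integrable (P x) (I t)" by (rule sq(1)[OF t t t])
  have Is: "integrable (P x) (I s)" by (rule sq(1)) (rule assms)+
  have Zm: "Z \<in> borel_measurable (P x)" by (rule F_imp_P_measurable[OF assms(2) Z(1)])
  have mi: "integrable (P x) (\<lambda>\<omega>. Z \<omega> * f \<omega>)" if "integrable (P x) f" for f
    by (rule integrable_mult_F_bounded[OF assms(2) Z that])
  have "(\<lambda>k. expectation (\<lambda>\<omega>. Z \<omega> * simple_integral B (n k) (T k) (\<xi> k) t \<omega>)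
        - expectation (\<lambda>\<omega>. Z \<omega> * simple_integral B (n k) (T k) (\<xi> k) s \<omega>))
      \<longlonglongrightarrow> expectation (\<lambda>\<omega>. Z \<omega> * I t \<omega>) - expectation (\<lambda>\<omega>. Z \<omega> * I s \<omega>)"
    by (intro tendsto_diff sq(2)[where K = K]) (use t assms(2) Zm Z(2) in auto)
  moreover have "expectation (\<lambda>\<omega>. Z \<omega> * simple_integral B (n k) (T k) (\<xi> k) t \<omega>)
        - expectation (\<lambda>\<omega>. Z \<omega> * simple_integral B (n k) (T k) (\<xi> k) s \<omega>) = 0" for k
    using simple_integral_martingale(2)[OF simple[of k] assms(2,3) Z, where x = x] mi[OF Jint[OF t]] mi[OF Jint[OF assms(2)]]
    by (simp add: right_diff_distrib)
  ultimately have "expectation (\<lambda>\<omega>. Z \<omega> * I t \<omega>) - expectation (\<lambda>\<omega>. Z \<omega> * I s \<omega>) = 0"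
    by (simp add: LIMSEQ_const_iff)
  then show "(\<integral>\<omega>. Z \<omega> * (I t \<omega> - I s \<omega>) \<partial>P x) = 0"
    using mi[OF It] mi[OF Is] by (simp add: right_diff_distrib)
qed

text \<open>A one-step Ito formula: the linear term has mean 0, the squared increment averages to
  \<open>u - s\<close> independently of the past, and the cubic remainder contributes an error of
  order \<open>(u - s) powr (3/2)\<close>, small enough to be summed over a grid.\<close>

lemma robin_smooth_increment:
  fixes Z :: "'a \<Rightarrow> real"
  assumes su: "0 \<le> s" "s < u" and Z: "Z \<in> borel_measurable (F s)"
    and bd: "\<And>\<omega>. \<omega> \<in> space A \<Longrightarrow> \<bar>Z \<omega>\<bar> \<le> K"
  shows "integrable (P x) (\<lambda>\<omega>. Z \<omega> * (robin_smooth \<beta> k (B u \<omega>) - robin_smooth \<beta> k (B s \<omega>)))"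
    and "\<bar>(\<integral>\<omega>. Z \<omega> * (robin_smooth \<beta> k (B u \<omega>) - robin_smooth \<beta> k (B s \<omega>)) \<partial>P x)
      + k\<^sup>2 / 2 * (u - s) * (\<integral>\<omega>. Z \<omega> * robin \<beta> k (B s \<omega>) \<partial>P x)\<bar>
     \<le> K * (k\<^sup>2 * ((1 + \<bar>\<beta>\<bar>) * \<bar>k\<bar>)) * (2 * ((u - s) * sqrt (u - s)))"
proof -
  interpret prob_space "P x" by (rule prob_space_P)
  let ?C = "k\<^sup>2 * ((1 + \<bar>\<beta>\<bar>) * \<bar>k\<bar>)"
  let ?D = "\<lambda>\<omega>. B u \<omega> - B s \<omega>"
  let ?R = "\<lambda>\<omega>. robin_smooth \<beta> k (B u \<omega>) - robin_smooth \<beta> k (B s \<omega>)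
      - robin_smooth_deriv \<beta> k (B s \<omega>) * ?D \<omega> + k\<^sup>2 / 2 * robin \<beta> k (B s \<omega>) * (?D \<omega>)\<^sup>2"
  obtain \<omega>0 where "\<omega>0 \<in> space (P x)" using not_empty by blast
  then have K0: "0 \<le> K" using bd[of \<omega>0] by simp
  have C0: "0 \<le> ?C" by simp
  note Bs = B_adapted[OF su(1)]
  have [measurable]: "B s \<in> borel_measurable (P x)" "B u \<in> borel_measurable (P x)" "Z \<in> borel_measurable (P x)"
    using B_P_measurable su F_imp_P_measurable[OF su(1) Z] by auto
  have m1: "(\<lambda>\<omega>. Z \<omega> * robin_smooth_deriv \<beta> k (B s \<omega>)) \<in> borel_measurable (F s)"
    and m2: "(\<lambda>\<omega>. Z \<omega> * robin \<beta> k (B s \<omega>)) \<in> borel_measurable (F s)"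
    using Z Bs by measurable
  have b1: "\<bar>Z \<omega> * robin_smooth_deriv \<beta> k (B s \<omega>)\<bar> \<le> K * (\<bar>k\<bar> + 2 * \<bar>\<beta>\<bar> * \<bar>k\<bar>)"
    and b2: "\<bar>Z \<omega> * robin \<beta> k (B s \<omega>)\<bar> \<le> K * (1 + \<bar>\<beta>\<bar>)" if "\<omega> \<in> space A" for \<omega>
    unfolding abs_mult using bd[OF that] K0
    by (intro mult_mono abs_robin_smooth_deriv_le abs_robin_le; simp)+
  note M1 = increment_moments[OF su m1 b1, of x] and M2 = increment_moments[OF su m2 b2, of x]
  have R: "\<bar>Z \<omega> * ?R \<omega>\<bar> \<le> K * (?C * \<bar>?D \<omega>\<bar> ^ 3)" if "\<omega> \<in> space A" for \<omega>
    unfolding abs_mult using robin_smooth_taylor[of \<beta> k "B s \<omega>" "?D \<omega>"] bd[OF that] K0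
    by (intro mult_mono) auto
  have Ri: "integrable (P x) (\<lambda>\<omega>. Z \<omega> * ?R \<omega>)"
  proof (rule Bochner_Integration.integrable_bound)
    show "integrable (P x) (\<lambda>\<omega>. K * (?C * \<bar>?D \<omega>\<bar> ^ 3))" by (intro integrable_mult_right M1(5))
    show "AE \<omega> in P x. norm (Z \<omega> * ?R \<omega>) \<le> norm (K * (?C * \<bar>?D \<omega>\<bar> ^ 3))"
      using R K0 C0 by (intro AE_I2) (auto intro: order_trans)
  qed measurable
  have eq: "Z \<omega> * (robin_smooth \<beta> k (B u \<omega>) - robin_smooth \<beta> k (B s \<omega>))
      = Z \<omega> * ?R \<omega> + (Z \<omega> * robin_smooth_deriv \<beta> k (B s \<omega>)) * ?D \<omega>
        - k\<^sup>2 / 2 * ((Z \<omega> * robin \<beta> k (B s \<omega>)) * (?D \<omega>)\<^sup>2)" for \<omega>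
    by (simp add: algebra_simps)
  show "integrable (P x) (\<lambda>\<omega>. Z \<omega> * (robin_smooth \<beta> k (B u \<omega>) - robin_smooth \<beta> k (B s \<omega>)))"
    unfolding eq by (intro Bochner_Integration.integrable_add Bochner_Integration.integrable_diff integrable_mult_right Ri M1(1) M2(3))
  have "(\<integral>\<omega>. Z \<omega> * (robin_smooth \<beta> k (B u \<omega>) - robin_smooth \<beta> k (B s \<omega>)) \<partial>P x)
     = (\<integral>\<omega>. Z \<omega> * ?R \<omega> \<partial>P x) - k\<^sup>2 / 2 * ((\<integral>\<omega>. Z \<omega> * robin \<beta> k (B s \<omega>) \<partial>P x) * (u - s))"
    unfolding eq using Ri M1(1,2) M2(3,4)
    by (simp add: Bochner_Integration.integral_add Bochner_Integration.integral_diff)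
  moreover have "\<bar>\<integral>\<omega>. Z \<omega> * ?R \<omega> \<partial>P x\<bar> \<le> K * (?C * (2 * ((u - s) * sqrt (u - s))))"
  proof -
    have "\<bar>\<integral>\<omega>. Z \<omega> * ?R \<omega> \<partial>P x\<bar> \<le> (\<integral>\<omega>. \<bar>Z \<omega> * ?R \<omega>\<bar> \<partial>P x)" by (rule integral_abs_bound)
    also have "\<dots> \<le> (\<integral>\<omega>. K * (?C * \<bar>?D \<omega>\<bar> ^ 3) \<partial>P x)"
    proof (rule integral_mono)
      show "integrable (P x) (\<lambda>\<omega>. \<bar>Z \<omega> * ?R \<omega>\<bar>)" by (rule integrable_abs[OF Ri])
      show "integrable (P x) (\<lambda>\<omega>. K * (?C * \<bar>?D \<omega>\<bar> ^ 3))" by (intro integrable_mult_right M1(5))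
      show "\<bar>Z \<omega> * ?R \<omega>\<bar> \<le> K * (?C * \<bar>?D \<omega>\<bar> ^ 3)" if "\<omega> \<in> space (P x)" for \<omega>
        using that R[of \<omega>] unfolding space_P by blast
    qed
    also have "\<dots> = K * (?C * (\<integral>\<omega>. \<bar>?D \<omega>\<bar> ^ 3 \<partial>P x))" by simp
    also have "\<dots> \<le> K * (?C * (2 * ((u - s) * sqrt (u - s))))"
      by (intro mult_left_mono M1(6) K0 C0)
    finally show ?thesis .
  qed
  ultimately show "\<bar>(\<integral>\<omega>. Z \<omega> * (robin_smooth \<beta> k (B u \<omega>) - robin_smooth \<beta> k (B s \<omega>)) \<partial>P x)
      + k\<^sup>2 / 2 * (u - s) * (\<integral>\<omega>. Z \<omega> * robin \<beta> k (B s \<omega>) \<partial>P x)\<bar>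
     \<le> K * ?C * (2 * ((u - s) * sqrt (u - s)))"
    by (simp add: mult.assoc mult.commute[of "u - s"])
qed

end

section \<open>Local time increments away from the zeros of \<open>B\<close>\<close>

context brownian_family
begin

text \<open>The Gaussian density is at most \<open>1 / sqrt (2 * pi * s)\<close> and the interval
  has length \<open>2 * \<delta>\<close>; then \<open>2 \<le> sqrt (2 * pi)\<close>. The bound is
  uniform in the starting point.\<close>

lemma B_small_ball:
  assumes "0 < s" "0 \<le> \<delta>"
  shows "measure (P x) {\<omega> \<in> space A. \<bar>B s \<omega>\<bar> \<le> \<delta>} \<le> \<delta> / sqrt s"
proof -
  interpret prob_space "P x" by (rule prob_space_P)
  have D: "distributed (P x) lborel (\<lambda>\<omega>. B s \<omega> - B 0 \<omega>) (normal_density 0 (sqrt (s - 0)))"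
    by (rule B_increment_normal) (use assms in auto)
  let ?C = "{- \<delta> - x..\<delta> - x}"
  have [measurable]: "B s \<in> borel_measurable (P x)" "B 0 \<in> borel_measurable (P x)"
    using assms B_P_measurable by auto
  have "emeasure (P x) {\<omega> \<in> space A. \<bar>B s \<omega>\<bar> \<le> \<delta>} = emeasure (P x) ((\<lambda>\<omega>. B s \<omega> - B 0 \<omega>) -` ?C \<inter> space (P x))"
  proof (rule emeasure_eq_AE)
    show "AE \<omega> in P x. \<omega> \<in> {\<omega> \<in> space A. \<bar>B s \<omega>\<bar> \<le> \<delta>} \<longleftrightarrow> \<omega> \<in> (\<lambda>\<omega>. B s \<omega> - B 0 \<omega>) -` ?C \<inter> space (P x)"
      using B_start[of x] by eventually_elim auto
    show "{\<omega> \<in> space A. \<bar>B s \<omega>\<bar> \<le> \<delta>} \<in> sets (P x)"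
      unfolding space_P[of x, symmetric] by measurable
  qed measurable
  also have "\<dots> = (\<integral>\<^sup>+y. ennreal (normal_density 0 (sqrt s) y) * indicator ?C y \<partial>lborel)"
    using distributed_emeasure[OF D, of ?C] by simp
  also have "\<dots> \<le> (\<integral>\<^sup>+y. ennreal (1 / sqrt (2 * pi * s)) * indicator ?C y \<partial>lborel)"
    using assms by (intro nn_integral_mono mult_right_mono ennreal_leI)
      (auto simp: normal_density_def divide_right_mono)
  also have "\<dots> = ennreal (1 / sqrt (2 * pi * s)) * emeasure lborel ?C"
    by (rule nn_integral_cmult_indicator) simp
  also have "\<dots> = ennreal (2 * \<delta> / sqrt (2 * pi * s))"
    using assms by (simp add: ennreal_mult[symmetric])
  finally have "measure (P x) {\<omega> \<in> space A. \<bar>B s \<omega>\<bar> \<le> \<delta>} \<le> 2 * \<delta> / sqrt (2 * pi * s)"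
    using assms by (simp add: emeasure_eq_measure)
  also have "\<dots> \<le> \<delta> / sqrt s"
  proof -
    have "2 \<le> sqrt (2 * pi)" using pi_gt3 by (intro real_le_rsqrt) simp
    then have "\<delta> * 2 \<le> \<delta> * sqrt (2 * pi)" using assms by (intro mult_left_mono) auto
    then have "2 * \<delta> / sqrt (2 * pi) \<le> \<delta>" by (simp add: divide_le_eq mult.commute)
    then have "2 * \<delta> / sqrt (2 * pi) / sqrt s \<le> \<delta> / sqrt s" using assms by (intro divide_right_mono) auto
    then show ?thesis by (simp add: real_sqrt_mult mult.assoc)
  qed
  finally show ?thesis .
qed

end

text \<open>The absolute value departs from its linearisation only when the step reaches 0, that is
  when \<open>\<bar>b\<bar> \<le> \<bar>d\<bar>\<close>. The departure is then at most
  \<open>2 * \<bar>d\<bar>\<close>, and the weight \<open>min 1 \<bar>b\<bar>\<close> is itself at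
  most \<open>\<bar>d\<bar>\<close>, which makes the error quadratic.\<close>

lemma abs_increment_near_0:
  fixes b d \<delta> :: real
  assumes "0 < \<delta>"
  shows "min 1 \<bar>b\<bar> * (\<bar>b + d\<bar> - \<bar>b\<bar>) \<le> min 1 \<bar>b\<bar> * sgn b * d
    + 2 * (indicator {c. \<bar>c\<bar> \<le> \<delta>} b * d\<^sup>2) + 2 / \<delta>\<^sup>2 * d ^ 4"
proof -
  have e: "min 1 \<bar>b\<bar> * (\<bar>b + d\<bar> - \<bar>b\<bar> - sgn b * d) \<le> 2 * (if \<bar>b\<bar> \<le> \<bar>d\<bar> then d\<^sup>2 else 0)"
  proof (cases "\<bar>b\<bar> \<le> \<bar>d\<bar>")
    case True
    have "\<bar>b + d\<bar> - \<bar>b\<bar> - sgn b * d \<le> 2 * \<bar>d\<bar>" by (auto simp: sgn_real_def)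
    then have "min 1 \<bar>b\<bar> * (\<bar>b + d\<bar> - \<bar>b\<bar> - sgn b * d) \<le> min 1 \<bar>b\<bar> * (2 * \<bar>d\<bar>)"
      by (rule mult_left_mono) auto
    also have "\<dots> \<le> \<bar>d\<bar> * (2 * \<bar>d\<bar>)" using True by (intro mult_right_mono) auto
    also have "\<dots> = 2 * d\<^sup>2" by (simp add: power2_eq_square mult.left_commute)
    finally show ?thesis using True by simp
  next
    case False
    then have "\<bar>b + d\<bar> - \<bar>b\<bar> - sgn b * d = 0" by (auto simp: sgn_real_def)
    then show ?thesis using False by simp
  qed
  \<comment> \<open>Either \<open>b\<close> is within \<delta> of 0, which has small probability, or
    \<open>\<bar>d\<bar> > \<delta>\<close>, in which case
    \<open>d^2 \<le> d^4 / \<delta>^2\<close>.\<close>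
  have "(if \<bar>b\<bar> \<le> \<bar>d\<bar> then d\<^sup>2 else 0) \<le> indicator {c. \<bar>c\<bar> \<le> \<delta>} b * d\<^sup>2 + 1 / \<delta>\<^sup>2 * d ^ 4"
  proof (cases "\<bar>b\<bar> \<le> \<delta>")
    case False
    show ?thesis
    proof (cases "\<bar>b\<bar> \<le> \<bar>d\<bar>")
      case True
      then have "\<delta>\<^sup>2 \<le> d\<^sup>2" using False assms by (intro abs_le_square_iff[THEN iffD1]) auto
      then have "\<delta>\<^sup>2 * d\<^sup>2 \<le> d\<^sup>2 * d\<^sup>2" by (intro mult_right_mono) auto
      then show ?thesis using False True assms by (simp add: field_simps eval_nat_numeral)
    qed (use assms in simp)
  qed (use assms in simp)
  with e show ?thesis by (simp add: algebra_simps)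
qed

context brownian_local_time
begin

lemma L_P_measurable: "0 \<le> s \<Longrightarrow> L s \<in> borel_measurable (P x)"
  using F_imp_P_measurable[OF _ L_adapted] .

text \<open>In Tanaka's formula the stochastic integral has increments orthogonal to
  \<open>Z\<close>, so they drop out of the expectation. Integrability of \<open>L\<close> is read
  off from the same formula.\<close>

lemma local_time_compensator:
  assumes "0 \<le> s" "s \<le> u"
    and Z: "Z \<in> borel_measurable (F s)" "\<And>\<omega>. \<omega> \<in> space A \<Longrightarrow> \<bar>Z \<omega>\<bar> \<le> (K :: real)"
  shows "integrable (P x) (L u)"
    and "(\<integral>\<omega>. Z \<omega> * (L u \<omega> - L s \<omega>) \<partial>P x) = (\<integral>\<omega>. Z \<omega> * (\<bar>B u \<omega>\<bar> - \<bar>B s \<omega>\<bar>) \<partial>P x)"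
proof -
  interpret prob_space "P x" by (rule prob_space_P)
  obtain I where I: "is_ito_integral (P x) F B (\<lambda>s \<omega>. sgn (B s \<omega>)) I"
    and eq: "\<And>t. 0 \<le> t \<Longrightarrow> AE \<omega> in P x. \<bar>B t \<omega>\<bar> = \<bar>B 0 \<omega>\<bar> + I t \<omega> + L t \<omega>"
    using tanaka[of x] by blast
  have Ii: "integrable (P x) (I v)" if "0 \<le> v" for v
    using ito_martingale(1)[OF I, of v v "\<lambda>_. 1" 1] that by simp
  have Li: "integrable (P x) (L v)" if "0 \<le> v" for v
  proof (rule integrable_cong_AE_imp)
    show "integrable (P x) (\<lambda>\<omega>. \<bar>B v \<omega>\<bar> - \<bar>B 0 \<omega>\<bar> - I v \<omega>)"
      using B_integrable[of v x] B_integrable[of 0 x] Ii[OF that] that by auto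
    show "AE \<omega> in P x. \<bar>B v \<omega>\<bar> - \<bar>B 0 \<omega>\<bar> - I v \<omega> = L v \<omega>"
      using eq[OF that] by eventually_elim simp
  qed (rule L_P_measurable[OF that])
  have u: "0 \<le> u" using assms by simp
  show "integrable (P x) (L u)" by (rule Li[OF u])
  have mi: "integrable (P x) (\<lambda>\<omega>. Z \<omega> * f \<omega>)" if "integrable (P x) f" for f
    by (rule integrable_mult_F_bounded[OF assms(1) Z that])
  have "(\<integral>\<omega>. Z \<omega> * (L u \<omega> - L s \<omega>) \<partial>P x) = (\<integral>\<omega>. Z \<omega> * (\<bar>B u \<omega>\<bar> - \<bar>B s \<omega>\<bar>) - Z \<omega> * (I u \<omega> - I s \<omega>) \<partial>P x)"
  proof (rule integral_cong_AE)
    show "AE \<omega> in P x. Z \<omega> * (L u \<omega> - L s \<omega>) = Z \<omega> * (\<bar>B u \<omega>\<bar> - \<bar>B s \<omega>\<bar>) - Z \<omega> * (I u \<omega> - I s \<omega>)"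
      using eq[OF u] eq[OF assms(1)] by eventually_elim (simp add: algebra_simps)
  qed (use F_imp_P_measurable[OF assms(1) Z(1), of x] B_P_measurable[OF u] B_P_measurable[OF assms(1)]
      L_P_measurable[OF u] L_P_measurable[OF assms(1)] borel_measurable_integrable[OF Ii[OF u]]
      borel_measurable_integrable[OF Ii[OF assms(1)]] in measurable)
  also have "\<dots> = (\<integral>\<omega>. Z \<omega> * (\<bar>B u \<omega>\<bar> - \<bar>B s \<omega>\<bar>) \<partial>P x) - (\<integral>\<omega>. Z \<omega> * (I u \<omega> - I s \<omega>) \<partial>P x)"
  proof (rule Bochner_Integration.integral_diff)
    show "integrable (P x) (\<lambda>\<omega>. Z \<omega> * (\<bar>B u \<omega>\<bar> - \<bar>B s \<omega>\<bar>))"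
      using B_integrable[OF u, of x] B_integrable[OF assms(1), of x] by (intro mi) auto
    show "integrable (P x) (\<lambda>\<omega>. Z \<omega> * (I u \<omega> - I s \<omega>))"
      using Ii[OF u] Ii[OF assms(1)] by (intro mi) auto
  qed
  also have "(\<integral>\<omega>. Z \<omega> * (I u \<omega> - I s \<omega>) \<partial>P x) = 0"
    by (rule ito_martingale(2)[OF I assms(1,2) Z])
  finally show "(\<integral>\<omega>. Z \<omega> * (L u \<omega> - L s \<omega>) \<partial>P x) = (\<integral>\<omega>. Z \<omega> * (\<bar>B u \<omega>\<bar> - \<bar>B s \<omega>\<bar>) \<partial>P x)" by simp
qed

lemma L_integrable: "0 \<le> u \<Longrightarrow> integrable (P x) (L u)"
  using local_time_compensator(1)[of u u "\<lambda>_. 1" 1 x] by simp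

text \<open>\<open>dL\<close> is exchanged for the increment of \<open>\<bar>B\<bar>\<close>, to
  which \<open>abs_increment_near_0\<close> applies. The linear term has mean 0, the quadratic term
  is confined to the small ball, and the constant 6 is twice the Gaussian fourth moment constant
  3.\<close>

lemma local_time_off_zero_increment:
  assumes su: "0 \<le> s" "s < u" and \<delta>: "0 < \<delta>"
  shows "(\<integral>\<omega>. min 1 \<bar>B s \<omega>\<bar> * (L u \<omega> - L s \<omega>) \<partial>P x)
    \<le> 2 * (u - s) * measure (P x) {\<omega> \<in> space A. \<bar>B s \<omega>\<bar> \<le> \<delta>} + 6 * (u - s)\<^sup>2 / \<delta>\<^sup>2"
proof -
  interpret prob_space "P x" by (rule prob_space_P)
  let ?D = "\<lambda>\<omega>. B u \<omega> - B s \<omega>"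
  note Bs [measurable] = B_adapted[OF su(1)]
  have m0: "(\<lambda>\<omega>. min 1 \<bar>B s \<omega>\<bar>) \<in> borel_measurable (F s)"
    and m1: "(\<lambda>\<omega>. min 1 \<bar>B s \<omega>\<bar> * sgn (B s \<omega>)) \<in> borel_measurable (F s)"
    and m2: "(\<lambda>\<omega>. indicator {c. \<bar>c\<bar> \<le> \<delta>} (B s \<omega>) :: real) \<in> borel_measurable (F s)" by measurable
  have b0: "\<bar>min 1 \<bar>B s \<omega>\<bar>\<bar> \<le> 1" and b1: "\<bar>min 1 \<bar>B s \<omega>\<bar> * sgn (B s \<omega>)\<bar> \<le> 1"
    and b2: "\<bar>indicator {c. \<bar>c\<bar> \<le> \<delta>} (B s \<omega>) :: real\<bar> \<le> 1" for \<omega>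
    by (auto simp: abs_mult abs_sgn_eq indicator_def)
  note M1 = increment_moments[OF su m1 b1, of x] and M2 = increment_moments[OF su m2 b2, of x]
  have u: "0 \<le> u" using su by simp
  have "(\<integral>\<omega>. min 1 \<bar>B s \<omega>\<bar> * (L u \<omega> - L s \<omega>) \<partial>P x) = (\<integral>\<omega>. min 1 \<bar>B s \<omega>\<bar> * (\<bar>B u \<omega>\<bar> - \<bar>B s \<omega>\<bar>) \<partial>P x)"
    by (rule local_time_compensator(2)[OF su(1) less_imp_le[OF su(2)] m0 b0])
  also have "\<dots> \<le> (\<integral>\<omega>. (min 1 \<bar>B s \<omega>\<bar> * sgn (B s \<omega>)) * ?D \<omega>
      + 2 * (indicator {c. \<bar>c\<bar> \<le> \<delta>} (B s \<omega>) * (?D \<omega>)\<^sup>2) + 2 / \<delta>\<^sup>2 * (?D \<omega>) ^ 4 \<partial>P x)"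
  proof (rule integral_mono)
    show "integrable (P x) (\<lambda>\<omega>. min 1 \<bar>B s \<omega>\<bar> * (\<bar>B u \<omega>\<bar> - \<bar>B s \<omega>\<bar>))"
      using B_integrable[OF u, of x] B_integrable[OF su(1), of x]
      by (intro integrable_mult_F_bounded[OF su(1) m0 b0]) auto
    show "integrable (P x) (\<lambda>\<omega>. (min 1 \<bar>B s \<omega>\<bar> * sgn (B s \<omega>)) * ?D \<omega>
      + 2 * (indicator {c. \<bar>c\<bar> \<le> \<delta>} (B s \<omega>) * (?D \<omega>)\<^sup>2) + 2 / \<delta>\<^sup>2 * (?D \<omega>) ^ 4)"
      by (intro Bochner_Integration.integrable_add integrable_mult_right M1(1) M2(3) M1(7))
    show "min 1 \<bar>B s \<omega>\<bar> * (\<bar>B u \<omega>\<bar> - \<bar>B s \<omega>\<bar>) \<le> (min 1 \<bar>B s \<omega>\<bar> * sgn (B s \<omega>)) * ?D \<omega>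
      + 2 * (indicator {c. \<bar>c\<bar> \<le> \<delta>} (B s \<omega>) * (?D \<omega>)\<^sup>2) + 2 / \<delta>\<^sup>2 * (?D \<omega>) ^ 4" for \<omega>
      using abs_increment_near_0[OF \<delta>, of "B s \<omega>" "?D \<omega>"] by simp
  qed
  also have "\<dots> = 2 * ((\<integral>\<omega>. indicator {c. \<bar>c\<bar> \<le> \<delta>} (B s \<omega>) \<partial>P x) * (u - s)) + 2 / \<delta>\<^sup>2 * (3 * (u - s)\<^sup>2)"
    using M1(1,2,7,8) M2(3,4) by (simp add: Bochner_Integration.integral_add)
  also have "(\<integral>\<omega>. indicator {c. \<bar>c\<bar> \<le> \<delta>} (B s \<omega>) \<partial>P x) = measure (P x) {\<omega> \<in> space A. \<bar>B s \<omega>\<bar> \<le> \<delta>}"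
  proof -
    have "(\<integral>\<omega>. indicator {c. \<bar>c\<bar> \<le> \<delta>} (B s \<omega>) \<partial>P x) = (\<integral>\<omega>. indicator {\<omega> \<in> space A. \<bar>B s \<omega>\<bar> \<le> \<delta>} \<omega> \<partial>P x :: real)"
      by (rule Bochner_Integration.integral_cong) (auto simp: indicator_def)
    also have "\<dots> = measure (P x) {\<omega> \<in> space A. \<bar>B s \<omega>\<bar> \<le> \<delta>}"
      by (simp add: Int_absorb2 subset_iff Collect_conj_eq[symmetric])
    finally show ?thesis .
  qed
  finally show ?thesis by (simp add: algebra_simps)
qed

end

section \<open>Sticky Brownian motion\<close>

text \<open>The term at \<open>i = 0\<close> is 0 because \<open>1 / 0 = 0\<close>. The others
  telescope: consecutive roots \<open>?a\<close> and \<open>?b\<close> satisfy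
  \<open>?b^2 - ?a^2 = 1\<close>, so \<open>1 / ?b \<le> 2 * ?b - 2 * ?a\<close> follows from
  \<open>2 * ?a * ?b \<le> ?a^2 + ?b^2\<close>.\<close>

lemma sum_inverse_sqrt_le: "(\<Sum>i<n. 1 / sqrt (real i)) \<le> 2 * sqrt (real n)"
proof -
  have "(\<Sum>i<Suc n. 1 / sqrt (real i)) \<le> 2 * sqrt (real n)" for n
  proof (induction n)
    case (Suc n)
    let ?a = "sqrt (real n)" and ?b = "sqrt (real (Suc n))"
    have b: "0 < ?b" by simp
    have "?b * (2 * ?a) \<le> ?b\<^sup>2 + ?a\<^sup>2" using sum_squares_bound[of ?a ?b] by (simp add: mult.commute)
    also have "\<dots> = 2 * ?b\<^sup>2 - 1" by simp
    finally have "1 / ?b \<le> 2 * ?b - 2 * ?a" using b by (simp add: field_simps power2_eq_square)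
    then show ?case using Suc by simp
  qed simp
  from this[of "n - 1"] show ?thesis by (cases n) (auto intro: order_trans)
qed

text \<open>1 is the value at the origin. Near it the Lipschitz bound applies, far from it
  boundedness; the constant is chosen to dominate both. The factor
  \<open>min 1 \<bar>b\<bar>\<close> matches the weight in the local time estimate.\<close>

lemma robin_minus_1_le: "\<bar>robin \<beta> k b - 1\<bar> \<le> ((1 + \<bar>\<beta>\<bar>) * (1 + \<bar>k\<bar>) + 1) * min 1 \<bar>b\<bar>"
proof (cases "\<bar>b\<bar> \<le> 1")
  case True
  have "\<bar>robin \<beta> k b - 1\<bar> \<le> (1 + \<bar>\<beta>\<bar>) * \<bar>k\<bar> * \<bar>b\<bar>"
    using robin_lipschitz[of \<beta> k b 0] by (simp add: robin_def)
  also have "\<dots> \<le> ((1 + \<bar>\<beta>\<bar>) * (1 + \<bar>k\<bar>) + 1) * \<bar>b\<bar>"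
    by (intro mult_right_mono) (auto simp: algebra_simps)
  finally show ?thesis using True by simp
next
  case False
  have "\<bar>robin \<beta> k b - 1\<bar> \<le> (1 + \<bar>\<beta>\<bar>) * 1 + 1" using abs_robin_le[of \<beta> k b] abs_triangle_ineq4[of "robin \<beta> k b" 1] by simp
  also have "\<dots> \<le> (1 + \<bar>\<beta>\<bar>) * (1 + \<bar>k\<bar>) + 1" by (intro add_mono mult_left_mono) auto
  finally show ?thesis using False by simp
qed

section \<open>One-step drift of the Robin functions and the sticky transform\<close>

context brownian_local_time
begin

lemma L_increment_nonneg: "\<omega> \<in> space A \<Longrightarrow> 0 \<le> s \<Longrightarrow> s \<le> u \<Longrightarrow> 0 \<le> L u \<omega> - L s \<omega>"
  using mono_onD[OF L_mono, of \<omega> s u] by simp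

text \<open>A discrete form of the statement that the integral of \<open>min 1 \<bar>B\<bar>\<close>
  against \<open>L\<close> vanishes. The small-ball bounds behave like \<open>1 / sqrt i\<close>
  along the grid, and their sum grows only like \<open>sqrt n\<close>.\<close>

lemma local_time_off_zero_sum:
  assumes "0 < t"
  shows "(\<lambda>n. \<Sum>i<n. \<integral>\<omega>. min 1 \<bar>B (grid t n i) \<omega>\<bar> * (L (grid t n (Suc i)) \<omega> - L (grid t n i) \<omega>) \<partial>P x) \<longlonglongrightarrow> 0"
proof -
  interpret prob_space "P x" by (rule prob_space_P)
  let ?S = "\<lambda>n. \<Sum>i<n. \<integral>\<omega>. min 1 \<bar>B (grid t n i) \<omega>\<bar> * (L (grid t n (Suc i)) \<omega> - L (grid t n i) \<omega>) \<partial>P x"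
  have g: "0 \<le> grid t n i" "grid t n i \<le> grid t n (Suc i)" for n i
    using grid_nonneg grid_le_Suc assms by (auto intro: less_imp_le)
  have "0 \<le> min 1 \<bar>B (grid t n i) \<omega>\<bar> * (L (grid t n (Suc i)) \<omega> - L (grid t n i) \<omega>)"
    if "\<omega> \<in> space (P x)" for n i \<omega>
    using that by (intro mult_nonneg_nonneg L_increment_nonneg g) auto
  then have nonneg: "\<forall>\<^sub>F n in sequentially. 0 \<le> ?S n"
    by (intro always_eventually allI sum_nonneg Bochner_Integration.integral_nonneg)
  let ?b = "\<lambda>n. 2 * t / real n + 4 * sqrt t / sqrt (sqrt (real n)) + 6 * t\<^sup>2 / real n * sqrt (real n)"
  have le: "\<forall>\<^sub>F n in sequentially. ?S n \<le> ?b n"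
    using eventually_gt_at_top[of 0]
  proof eventually_elim
    case (elim n)
    \<comment> \<open>The two main contributions are of order \<delta> and
      \<open>1 / (n * \<delta>^2)\<close>, so any \<delta> tending to 0 with
      \<open>n * \<delta>^2\<close> tending to infinity works; \<open>n powr (-1/4)\<close> is one
      such choice.\<close>
    define \<delta> where "\<delta> = 1 / sqrt (sqrt (real n))"
    have \<delta>: "0 < \<delta>" using elim by (simp add: \<delta>_def)
    let ?h = "t / real n"
    have h: "0 < ?h" using elim assms by simp
    have step: "grid t n (Suc i) - grid t n i = ?h" for i by (rule grid_step)
    \<comment> \<open>At \<open>i = 0\<close> the process may start at 0, so the probability is
      bounded by 1 there; the other summand is then 0 since \<open>1 / sqrt 0 = 0\<close>.\<close>
    have term_le: "(\<integral>\<omega>. min 1 \<bar>B (grid t n i) \<omega>\<bar> * (L (grid t n (Suc i)) \<omega> - L (grid t n i) \<omega>) \<partial>P x)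
      \<le> 2 * ?h * ((if i = 0 then 1 else 0) + \<delta> * sqrt n / sqrt t * (1 / sqrt i)) + 6 * ?h\<^sup>2 / \<delta>\<^sup>2" for i
    proof -
      have "measure (P x) {\<omega> \<in> space A. \<bar>B (grid t n i) \<omega>\<bar> \<le> \<delta>} \<le> (if i = 0 then 1 else 0) + \<delta> * sqrt n / sqrt t * (1 / sqrt i)"
      proof (cases "i = 0")
        case False
        then have "0 < grid t n i" using assms elim by (simp add: grid_def)
        from B_small_ball[OF this, of \<delta> x] \<delta>
        have "measure (P x) {\<omega> \<in> space A. \<bar>B (grid t n i) \<omega>\<bar> \<le> \<delta>} \<le> \<delta> / sqrt (grid t n i)" by simp
        also have "\<dots> = \<delta> * sqrt n / sqrt t * (1 / sqrt i)"
          by (simp add: grid_def real_sqrt_divide real_sqrt_mult)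
        finally show ?thesis using False by simp
      qed simp
      then have "2 * ?h * measure (P x) {\<omega> \<in> space A. \<bar>B (grid t n i) \<omega>\<bar> \<le> \<delta>}
         \<le> 2 * ?h * ((if i = 0 then 1 else 0) + \<delta> * sqrt n / sqrt t * (1 / sqrt i))"
        using h by (intro mult_left_mono) auto
      moreover have "grid t n i < grid t n (Suc i)" using step[of i] h by linarith
      note local_time_off_zero_increment[OF g(1) this \<delta>, of x, unfolded step]
      ultimately show ?thesis by linarith
    qed
    have "?S n \<le> (\<Sum>i<n. 2 * ?h * ((if i = 0 then 1 else 0) + \<delta> * sqrt n / sqrt t * (1 / sqrt i)) + 6 * ?h\<^sup>2 / \<delta>\<^sup>2)"
      by (intro sum_mono term_le)
    also have "\<dots> = 2 * ?h * (1 + \<delta> * sqrt n / sqrt t * (\<Sum>i<n. 1 / sqrt i)) + n * (6 * ?h\<^sup>2 / \<delta>\<^sup>2)"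
      unfolding sum.distrib sum_distrib_left[symmetric] using elim by simp
    also have "\<dots> \<le> 2 * ?h * (1 + \<delta> * sqrt n / sqrt t * (2 * sqrt n)) + n * (6 * ?h\<^sup>2 / \<delta>\<^sup>2)"
      using h \<delta> assms by (intro add_mono mult_left_mono sum_inverse_sqrt_le order_refl) auto
    also have "\<dots> = ?b n"
    proof -
      have "2 * ?h * (\<delta> * sqrt n / sqrt t * (2 * sqrt n)) = 4 * \<delta> * (t / sqrt t) * ((sqrt n * sqrt n) / n)"
      proof -
        have "2 * (t / N) * (d * q / r * (2 * q)) = 4 * d * (t / r) * ((q * q) / N)" for N d q r :: real
          by (simp add: field_simps)
        then show ?thesis .
      qed
      also have "\<dots> = 4 * sqrt t / sqrt (sqrt n)"
        using elim assms by (simp add: \<delta>_def real_div_sqrt)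
      finally have 1: "2 * ?h * (\<delta> * sqrt n / sqrt t * (2 * sqrt n)) = 4 * sqrt t / sqrt (sqrt n)" .
      have "1 / \<delta>\<^sup>2 = sqrt n" by (simp add: \<delta>_def power_divide)
      then have "n * (6 * ?h\<^sup>2 / \<delta>\<^sup>2) = n * (6 * ?h\<^sup>2 * sqrt n)"
        by (metis mult.right_neutral times_divide_eq_right)
      also have "\<dots> = 6 * t\<^sup>2 / n * sqrt n"
        using elim by (simp add: power_divide power2_eq_square)
      finally show ?thesis using 1 by (simp add: distrib_left)
    qed
    finally show ?case .
  qed
  have "?b \<longlonglongrightarrow> 0" using assms by real_asymp
  from tendsto_sandwich[OF nonneg le tendsto_const this] show ?thesis .
qed

text \<open>The kink of \<open>robin\<close> contributes \<open>- \<beta> * k\<close> times the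
  increment of \<open>\<bar>B\<bar>\<close>, and \<open>\<beta> * k = k^2 / 2 * \<gamma>\<close>. In
  expectation this cancels the local time part of the clock with \<open>robin\<close> replaced by
  its value 1 at the origin. The discrepancy \<open>robin - 1\<close> against \<open>dL\<close> is
  bounded through \<open>robin_minus_1_le\<close>.\<close>

lemma robin_increment:
  fixes Z :: "'a \<Rightarrow> real" and \<gamma> k :: real
  assumes su: "0 \<le> s" "s < u" and Z: "Z \<in> borel_measurable (F s)"
    and bd: "\<And>\<omega>. \<omega> \<in> space A \<Longrightarrow> \<bar>Z \<omega>\<bar> \<le> K" and \<gamma>: "0 < \<gamma>"
  defines "\<beta> \<equiv> \<gamma> / 2 * k"
  defines "V \<equiv> \<lambda>\<omega>. Z \<omega> * (robin \<beta> k (B u \<omega>) - robin \<beta> k (B s \<omega>)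
      + k\<^sup>2 / 2 * ((u - s) + \<gamma> * (L u \<omega> - L s \<omega>)) * robin \<beta> k (B s \<omega>))"
  shows "integrable (P x) V"
    and "\<bar>\<integral>\<omega>. V \<omega> \<partial>P x\<bar> \<le> K * (k\<^sup>2 * ((1 + \<bar>\<beta>\<bar>) * \<bar>k\<bar>)) * (2 * ((u - s) * sqrt (u - s)))
      + k\<^sup>2 / 2 * \<gamma> * (K * ((1 + \<bar>\<beta>\<bar>) * (1 + \<bar>k\<bar>) + 1)) * (\<integral>\<omega>. min 1 \<bar>B s \<omega>\<bar> * (L u \<omega> - L s \<omega>) \<partial>P x)"
proof -
  interpret prob_space "P x" by (rule prob_space_P)
  obtain \<omega>0 where "\<omega>0 \<in> space (P x)" using not_empty by blast
  then have K0: "0 \<le> K" using bd[of \<omega>0] by simp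
  let ?c = "k\<^sup>2 / 2" and ?K' = "(1 + \<bar>\<beta>\<bar>) * (1 + \<bar>k\<bar>) + 1"
  let ?G = "\<lambda>\<omega>. robin_smooth \<beta> k (B u \<omega>) - robin_smooth \<beta> k (B s \<omega>)"
  let ?p = "\<lambda>\<omega>. robin \<beta> k (B s \<omega>)" and ?dL = "\<lambda>\<omega>. L u \<omega> - L s \<omega>" and ?dB = "\<lambda>\<omega>. \<bar>B u \<omega>\<bar> - \<bar>B s \<omega>\<bar>"
  note Bs [measurable] = B_adapted[OF su(1)]
  note Z [measurable]
  have u: "0 \<le> u" using su by simp
  have K'0: "0 \<le> ?K'" by simp
  have \<beta>k: "\<beta> * k = ?c * \<gamma>" by (simp add: \<beta>_def power2_eq_square)
  have mi: "integrable (P x) (\<lambda>\<omega>. Z \<omega> * f \<omega>)" if "integrable (P x) f" for f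
    by (rule integrable_mult_F_bounded[OF su(1) Z bd that])
  have dLi: "integrable (P x) ?dL" using L_integrable[OF u] L_integrable[OF su(1)] by simp
  have dBi: "integrable (P x) ?dB"
    using B_integrable[OF u, of x] B_integrable[OF su(1), of x] by auto
  have pi: "integrable (P x) ?p"
    by (rule integrable_F_bounded[OF su(1), of _ "1 + \<bar>\<beta>\<bar>"]) (auto intro: abs_robin_le)
  have i1: "integrable (P x) (\<lambda>\<omega>. Z \<omega> * ?G \<omega>)" by (rule robin_smooth_increment(1)[OF su Z bd])
  have m5: "(\<lambda>\<omega>. ?p \<omega> - 1) \<in> borel_measurable (F s)" by measurable
  have b5: "\<bar>?p \<omega> - 1\<bar> \<le> ?K'" for \<omega>
  proof -
    have m: "?K' * min 1 \<bar>B s \<omega>\<bar> \<le> ?K' * 1" by (rule mult_left_mono[OF _ K'0]) simp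
    show ?thesis using order_trans[OF robin_minus_1_le m] by simp
  qed
  have i5: "integrable (P x) (\<lambda>\<omega>. Z \<omega> * ((?p \<omega> - 1) * ?dL \<omega>))"
    by (intro mi integrable_mult_F_bounded[OF su(1) m5 b5 dLi])
  \<comment> \<open>The third and fourth terms cancel in expectation by
    \<open>local_time_compensator\<close>, the first two form the one-step Ito formula, and the
    fifth is the discrepancy.\<close>
  have V: "V \<omega> = Z \<omega> * ?G \<omega> + ?c * (u - s) * (Z \<omega> * ?p \<omega>) + ?c * \<gamma> * (Z \<omega> * ?dL \<omega>)
      - ?c * \<gamma> * (Z \<omega> * ?dB \<omega>) + ?c * \<gamma> * (Z \<omega> * ((?p \<omega> - 1) * ?dL \<omega>))" for \<omega>
    unfolding V_def robin_smooth_def \<beta>k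
    by (simp add: algebra_simps add_divide_distrib diff_divide_distrib)
  show "integrable (P x) V"
    unfolding V[abs_def]
    by (intro Bochner_Integration.integrable_add Bochner_Integration.integrable_diff integrable_mult_right i1 i5 mi pi dLi dBi)
  have "(\<integral>\<omega>. V \<omega> \<partial>P x) = (\<integral>\<omega>. Z \<omega> * ?G \<omega> \<partial>P x) + ?c * (u - s) * (\<integral>\<omega>. Z \<omega> * ?p \<omega> \<partial>P x)
      + ?c * \<gamma> * (\<integral>\<omega>. Z \<omega> * ?dL \<omega> \<partial>P x) - ?c * \<gamma> * (\<integral>\<omega>. Z \<omega> * ?dB \<omega> \<partial>P x)
      + ?c * \<gamma> * (\<integral>\<omega>. Z \<omega> * ((?p \<omega> - 1) * ?dL \<omega>) \<partial>P x)"
    unfolding V[abs_def] using i1 i5 mi[OF pi] mi[OF dLi] mi[OF dBi]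
    by (simp only: Bochner_Integration.integral_add Bochner_Integration.integral_diff integral_mult_right_zero
        Bochner_Integration.integrable_add Bochner_Integration.integrable_diff integrable_mult_right)
  also have "\<dots> = ((\<integral>\<omega>. Z \<omega> * ?G \<omega> \<partial>P x) + ?c * (u - s) * (\<integral>\<omega>. Z \<omega> * ?p \<omega> \<partial>P x))
      + ?c * \<gamma> * (\<integral>\<omega>. Z \<omega> * ((?p \<omega> - 1) * ?dL \<omega>) \<partial>P x)"
    using local_time_compensator(2)[OF su(1) less_imp_le[OF su(2)] Z bd, of x] by simp
  finally have eq: "(\<integral>\<omega>. V \<omega> \<partial>P x) = \<dots>" .
  have "\<bar>\<integral>\<omega>. Z \<omega> * ((?p \<omega> - 1) * ?dL \<omega>) \<partial>P x\<bar> \<le> (K * ?K') * (\<integral>\<omega>. min 1 \<bar>B s \<omega>\<bar> * ?dL \<omega> \<partial>P x)"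
  proof -
    have "\<bar>\<integral>\<omega>. Z \<omega> * ((?p \<omega> - 1) * ?dL \<omega>) \<partial>P x\<bar> \<le> (\<integral>\<omega>. \<bar>Z \<omega> * ((?p \<omega> - 1) * ?dL \<omega>)\<bar> \<partial>P x)"
      by (rule integral_abs_bound)
    also have "\<dots> \<le> (\<integral>\<omega>. (K * ?K') * (min 1 \<bar>B s \<omega>\<bar> * ?dL \<omega>) \<partial>P x)"
    proof (rule integral_mono)
      show "integrable (P x) (\<lambda>\<omega>. \<bar>Z \<omega> * ((?p \<omega> - 1) * ?dL \<omega>)\<bar>)" by (rule integrable_abs[OF i5])
      have "integrable (P x) (\<lambda>\<omega>. min 1 \<bar>B s \<omega>\<bar> * ?dL \<omega>)"
        by (rule integrable_mult_F_bounded[OF su(1) _ _ dLi, of _ 1]) auto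
      then show "integrable (P x) (\<lambda>\<omega>. (K * ?K') * (min 1 \<bar>B s \<omega>\<bar> * ?dL \<omega>))" by (rule integrable_mult_right)
      fix \<omega> assume "\<omega> \<in> space (P x)"
      then have w: "\<omega> \<in> space A" by simp
      have "\<bar>Z \<omega>\<bar> * (\<bar>?p \<omega> - 1\<bar> * \<bar>?dL \<omega>\<bar>) \<le> K * ((?K' * min 1 \<bar>B s \<omega>\<bar>) * ?dL \<omega>)"
        using bd[OF w] robin_minus_1_le L_increment_nonneg[OF w su(1) less_imp_le[OF su(2)]] K0
        by (intro mult_mono mult_nonneg_nonneg) auto
      then show "\<bar>Z \<omega> * ((?p \<omega> - 1) * ?dL \<omega>)\<bar> \<le> (K * ?K') * (min 1 \<bar>B s \<omega>\<bar> * ?dL \<omega>)"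
        by (simp only: abs_mult mult.assoc)
    qed
    finally show ?thesis by simp
  qed
  then have "\<bar>?c * \<gamma> * (\<integral>\<omega>. Z \<omega> * ((?p \<omega> - 1) * ?dL \<omega>) \<partial>P x)\<bar>
     \<le> ?c * \<gamma> * ((K * ?K') * (\<integral>\<omega>. min 1 \<bar>B s \<omega>\<bar> * ?dL \<omega> \<partial>P x))"
    using \<gamma> by (simp only: abs_mult) (intro mult_mono, auto)
  also have "\<dots> = ?c * \<gamma> * (K * ?K') * (\<integral>\<omega>. min 1 \<bar>B s \<omega>\<bar> * ?dL \<omega> \<partial>P x)"
    by (simp only: mult.assoc)
  finally have e2: "\<bar>?c * \<gamma> * (\<integral>\<omega>. Z \<omega> * ((?p \<omega> - 1) * ?dL \<omega>) \<partial>P x)\<bar> \<le> \<dots>" .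
  have e1: "\<bar>(\<integral>\<omega>. Z \<omega> * ?G \<omega> \<partial>P x) + ?c * (u - s) * (\<integral>\<omega>. Z \<omega> * ?p \<omega> \<partial>P x)\<bar>
      \<le> K * (k\<^sup>2 * ((1 + \<bar>\<beta>\<bar>) * \<bar>k\<bar>)) * (2 * ((u - s) * sqrt (u - s)))"
    by (rule robin_smooth_increment(2)[OF su Z bd])
  show "\<bar>\<integral>\<omega>. V \<omega> \<partial>P x\<bar> \<le> K * (k\<^sup>2 * ((1 + \<bar>\<beta>\<bar>) * \<bar>k\<bar>)) * (2 * ((u - s) * sqrt (u - s)))
      + ?c * \<gamma> * (K * ?K') * (\<integral>\<omega>. min 1 \<bar>B s \<omega>\<bar> * ?dL \<omega> \<partial>P x)"
    unfolding eq by (rule order_trans[OF abs_triangle_ineq add_mono[OF e1 e2]])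
qed

text \<open>Local time is nonnegative, so the clock runs at least as fast as time and level
  \<open>t\<close> is attained within \<open>[0, t]\<close>. This is why a grid on
  \<open>[0, t]\<close> suffices.\<close>

lemma sticky_clock_properties:
  assumes \<omega>: "\<omega> \<in> space A" and "0 < \<gamma>" "0 < t"
  defines "a \<equiv> \<lambda>s. s + \<gamma> * L s \<omega>" and "T \<equiv> sticky_clock L \<gamma> t \<omega>"
  shows "0 \<le> T" "T \<le> t" "a T = t" "a 0 = 0" "strict_mono_on {0..} a" "continuous_on {0..} a"
proof -
  show a0: "a 0 = 0" by (simp add: a_def L_zero[OF \<omega>])
  show sm: "strict_mono_on {0..} a"
  proof (rule strict_mono_onI)
    fix r s :: real assume "r \<in> {0..}" "s \<in> {0..}" "r < s"
    then have "\<gamma> * L r \<omega> \<le> \<gamma> * L s \<omega>"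
      using mono_onD[OF L_mono[OF \<omega>], of r s] assms by (intro mult_left_mono) auto
    then show "a r < a s" using \<open>r < s\<close> by (simp add: a_def)
  qed
  show cont: "continuous_on {0..} a"
    unfolding a_def by (intro continuous_intros L_continuous[OF \<omega>])
  have "0 \<le> L t \<omega>" using L_increment_nonneg[OF \<omega>, of 0 t] L_zero[OF \<omega>] assms by simp
  then have "t \<le> a t" using assms by (simp add: a_def)
  then obtain s where s: "0 \<le> s" "s \<le> t" "a s = t"
    using IVT'[of a 0 t t] a0 assms continuous_on_subset[OF cont, of "{0..t}"] by auto
  have inj: "inj_on a {0..}" by (rule strict_mono_on_imp_inj_on[OF sm])
  have "T = the_inv_into {0..} a (a s)" unfolding T_def sticky_clock_def a_def[symmetric] s(3) ..
  also have "\<dots> = s" using s by (intro the_inv_into_f_f[OF inj]) auto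
  finally show "0 \<le> T" "T \<le> t" "a T = t" using s by auto
qed

text \<open>The process is sampled at a random time. With \<open>c = 0\<close> all weights are 1,
  and the stopped grid sums of \<open>\<bar>B\<bar>\<close> exhibit the sampled value as a pointwise
  limit of functions of finitely many \<open>B\<close> and \<open>L\<close>.\<close>

lemma sticky_bm_measurable:
  assumes "0 < \<gamma>" "0 < t"
  shows "sticky_bm B L \<gamma> t \<in> borel_measurable (P x)"
proof -
  note [measurable] = B_P_measurable[OF grid_nonneg[OF less_imp_le[OF assms(2)]], where x = x]
    L_P_measurable[OF grid_nonneg[OF less_imp_le[OF assms(2)]], where x = x] B_P_measurable[OF order_refl, of x]
  let ?a = "\<lambda>\<omega> s. s + \<gamma> * L s \<omega>"
  let ?S = "\<lambda>n \<omega>. \<bar>B 0 \<omega>\<bar> + (\<Sum>i<n. if ?a \<omega> (grid t n i) < t then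
      exp (0 * min (?a \<omega> (grid t n (Suc i))) t) * \<bar>B (grid t n (Suc i)) \<omega>\<bar>
        - exp (0 * min (?a \<omega> (grid t n i)) t) * \<bar>B (grid t n i) \<omega>\<bar> else 0)"
  show ?thesis
  proof (rule borel_measurable_LIMSEQ_real)
    show "?S n \<in> borel_measurable (P x)" for n by measurable
    fix \<omega> assume "\<omega> \<in> space (P x)"
    then have w: "\<omega> \<in> space A" by simp
    note cp = sticky_clock_properties[OF w assms]
    have "(\<lambda>n. ?S n \<omega>) \<longlonglongrightarrow> \<bar>B 0 \<omega>\<bar> + (exp (0 * t) * \<bar>B (sticky_clock L \<gamma> t \<omega>) \<omega>\<bar> - \<bar>B 0 \<omega>\<bar>)"
      using continuous_on_subset[OF B_continuous[OF w], of "{0..t}"]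
      by (intro tendsto_add tendsto_const stopped_sum_tendsto[OF assms(2) cp(1-5), of "\<lambda>s. \<bar>B s \<omega>\<bar>" 0])
        (auto intro!: continuous_intros)
    then show "(\<lambda>n. ?S n \<omega>) \<longlonglongrightarrow> sticky_bm B L \<gamma> t \<omega>" by (simp add: sticky_bm_def)
  qed
qed

lemma sticky_bm_robin_integral:
  fixes \<gamma> k t x :: real
  assumes \<gamma>: "0 < \<gamma>" and t: "0 < t" and x: "0 \<le> x"
  shows "(\<integral>\<omega>. cos (k * sticky_bm B L \<gamma> t \<omega>) - \<gamma> / 2 * k * sin (k * sticky_bm B L \<gamma> t \<omega>) \<partial>P x)
    = exp (- (k\<^sup>2 * t / 2)) * (cos (k * x) - \<gamma> / 2 * k * sin (k * x))"
proof -
  interpret prob_space "P x" by (rule prob_space_P)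
  define \<beta> where "\<beta> = \<gamma> / 2 * k"
  define c where "c = k\<^sup>2 / 2"
  define K where "K = 1 + \<bar>\<beta>\<bar>"
  define a where "a = (\<lambda>\<omega> s. s + \<gamma> * L s \<omega>)"
  define p where "p = (\<lambda>\<omega> s. robin \<beta> k (B s \<omega>))"
  define T where "T = sticky_clock L \<gamma> t"
  have c0: "0 \<le> c" by (simp add: c_def)
  have K0: "0 \<le> K" by (simp add: K_def)
  have pK: "\<bar>p \<omega> s\<bar> \<le> K" for \<omega> s unfolding p_def K_def by (rule abs_robin_le)
  have g0: "0 \<le> grid t n i" for n i using grid_nonneg t by simp
  have am [measurable]: "(\<lambda>\<omega>. a \<omega> (grid t n i)) \<in> borel_measurable (P x)"
    and pm [measurable]: "(\<lambda>\<omega>. p \<omega> (grid t n i)) \<in> borel_measurable (P x)" for n i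
    unfolding a_def p_def using B_P_measurable[OF g0[of n i], where x = x] L_P_measurable[OF g0[of n i], where x = x] by measurable
  define S where "S = (\<lambda>n \<omega>. \<Sum>i<n. if a \<omega> (grid t n i) < t
        then exp (c * min (a \<omega> (grid t n (Suc i))) t) * p \<omega> (grid t n (Suc i))
           - exp (c * min (a \<omega> (grid t n i)) t) * p \<omega> (grid t n i) else 0)"
  define U where "U = (\<lambda>n \<omega>. \<Sum>i<n. if a \<omega> (grid t n i) < t
        then (exp (c * min (a \<omega> (grid t n (Suc i))) t) - exp (c * min (a \<omega> (grid t n i)) t))
               * p \<omega> (grid t n (Suc i))
           - c * exp (c * min (a \<omega> (grid t n i)) t)
               * (a \<omega> (grid t n (Suc i)) - a \<omega> (grid t n i)) * p \<omega> (grid t n i) else 0)"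
  \<comment> \<open>Both the decision to keep the step and its weight are determined at the left
    grid point, so \<open>Z n i\<close> is measurable at that time; the cap bounds it by
    \<open>exp (c * t)\<close>.\<close>
  define Z where "Z = (\<lambda>n i \<omega>. if a \<omega> (grid t n i) < t then exp (c * min (a \<omega> (grid t n i)) t) else 0)"
  define V where "V = (\<lambda>n i \<omega>. Z n i \<omega> * (p \<omega> (grid t n (Suc i)) - p \<omega> (grid t n i)
      + c * (a \<omega> (grid t n (Suc i)) - a \<omega> (grid t n i)) * p \<omega> (grid t n i)))"
  have Sm [measurable]: "S n \<in> borel_measurable (P x)" and Um [measurable]: "U n \<in> borel_measurable (P x)" for n
    unfolding S_def U_def by measurable
  \<comment> \<open>Discrete product rule
    \<open>e' * p' - e * p = (e' - e) * p' + e * (p' - p)\<close>, with \<open>c * e * p\<close>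
    times the clock increment subtracted in \<open>U\<close> and added back in \<open>V\<close>.
    \<open>U\<close> is small pathwise, \<open>V\<close> only in expectation.\<close>
  have SUV: "S n \<omega> = U n \<omega> + (\<Sum>i<n. V n i \<omega>)" for n \<omega>
    unfolding S_def U_def sum.distrib[symmetric]
    by (rule sum.cong) (auto simp: V_def Z_def algebra_simps)
  have path: "0 \<le> T \<omega>" "T \<omega> \<le> t" "a \<omega> (T \<omega>) = t" "a \<omega> 0 = 0" "strict_mono_on {0..} (a \<omega>)"
    "continuous_on {0..} (a \<omega>)" if "\<omega> \<in> space A" for \<omega>
    using sticky_clock_properties[OF that \<gamma> t] by (simp_all add: a_def T_def)
  have pc: "continuous_on {0..} (p \<omega>)" if "\<omega> \<in> space A" for \<omega>
    unfolding p_def by (rule continuous_on_compose2[OF robin_continuous[of UNIV] B_continuous[OF that]]) auto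
  have S_lim: "(\<lambda>n. S n \<omega>) \<longlonglongrightarrow> exp (c * t) * p \<omega> (T \<omega>) - p \<omega> 0" if w: "\<omega> \<in> space A" for \<omega>
    unfolding S_def by (rule stopped_sum_tendsto[OF t path(1-5)[OF w] continuous_on_subset[OF pc[OF w]]]) auto
  have S_bd: "\<bar>S n \<omega>\<bar> \<le> (exp (c * t) + 1) * K" if w: "\<omega> \<in> space A" for \<omega> n
    unfolding S_def by (rule stopped_sum_bound[OF t path(1-5)[OF w] pK])
  have U_lim: "(\<lambda>n. U n \<omega>) \<longlonglongrightarrow> 0" and U_bd: "\<bar>U n \<omega>\<bar> \<le> 2 * c * exp (c * t) * K * a \<omega> t"
    if w: "\<omega> \<in> space A" for \<omega> n
    unfolding U_def using stopped_chain_rule[OF t path(1-6)[OF w] pc[OF w] pK c0] by auto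
  \<comment> \<open>The bound on \<open>U\<close> is random, a multiple of the clock at
    \<open>t\<close>, and is integrable because \<open>L t\<close> is.\<close>
  have at: "integrable (P x) (\<lambda>\<omega>. 2 * c * exp (c * t) * K * a \<omega> t)"
    unfolding a_def using L_integrable[of t x] t by (intro integrable_mult_right Bochner_Integration.integrable_add) auto
  have EU: "(\<lambda>n. expectation (U n)) \<longlonglongrightarrow> expectation (\<lambda>_. 0)"
    by (rule integral_dominated_convergence[OF _ Um at]) (use U_lim U_bd in auto)
  have Ui: "integrable (P x) (U n)" for n
  proof (rule Bochner_Integration.integrable_bound[OF at Um])
    show "AE \<omega> in P x. norm (U n \<omega>) \<le> norm (2 * c * exp (c * t) * K * a \<omega> t)"
      using U_bd[of _ n] by (intro AE_I2) (fastforce intro: order_trans)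
  qed
  \<comment> \<open>Measurability at the random time again comes from the pointwise limit of the
    grid sums.\<close>
  have Tm: "(\<lambda>\<omega>. exp (c * t) * p \<omega> (T \<omega>) - p \<omega> 0) \<in> borel_measurable (P x)"
    by (rule borel_measurable_LIMSEQ_real[of _ S]) (use S_lim in auto)
  have ES: "(\<lambda>n. expectation (S n)) \<longlonglongrightarrow> expectation (\<lambda>\<omega>. exp (c * t) * p \<omega> (T \<omega>) - p \<omega> 0)"
    by (rule integral_dominated_convergence[OF Tm Sm, of "\<lambda>_. (exp (c * t) + 1) * K"]) (use S_lim S_bd in auto)
  define R where "R = (\<lambda>n i. \<integral>\<omega>. min 1 \<bar>B (grid t n i) \<omega>\<bar> * (L (grid t n (Suc i)) \<omega> - L (grid t n i) \<omega>) \<partial>P x)"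
  define C1 where "C1 = exp (c * t) * (k\<^sup>2 * ((1 + \<bar>\<beta>\<bar>) * \<bar>k\<bar>))"
  define C2 where "C2 = k\<^sup>2 / 2 * \<gamma> * (exp (c * t) * ((1 + \<bar>\<beta>\<bar>) * (1 + \<bar>k\<bar>) + 1))"
  have V_step: "integrable (P x) (V n i)" "\<bar>expectation (V n i)\<bar> \<le> C1 * (2 * (t / n * sqrt (t / n))) + C2 * R n i"
    if n: "i < n" for n i
  proof -
    have h: "grid t n (Suc i) - grid t n i = t / n" by (rule grid_step)
    have lt: "grid t n i < grid t n (Suc i)"
    proof -
      have "0 < t / n" using t n by simp
      with h show ?thesis by linarith
    qed
    have Zm: "Z n i \<in> borel_measurable (F (grid t n i))"
      unfolding Z_def a_def using L_adapted[OF g0, of n i] by measurable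
    have Zb: "\<bar>Z n i \<omega>\<bar> \<le> exp (c * t)" for \<omega>
      using c0 by (auto simp: Z_def intro: mult_left_mono)
    have V: "V n i = (\<lambda>\<omega>. Z n i \<omega> * (robin \<beta> k (B (grid t n (Suc i)) \<omega>) - robin \<beta> k (B (grid t n i) \<omega>)
      + k\<^sup>2 / 2 * ((grid t n (Suc i) - grid t n i) + \<gamma> * (L (grid t n (Suc i)) \<omega> - L (grid t n i) \<omega>)) * robin \<beta> k (B (grid t n i) \<omega>)))"
      by (auto simp: fun_eq_iff V_def p_def a_def c_def algebra_simps)
    note ri = robin_increment[OF g0 lt Zm Zb \<gamma>, of x k, folded \<beta>_def, folded V]
    show "integrable (P x) (V n i)" by (rule ri(1))
    show "\<bar>expectation (V n i)\<bar> \<le> C1 * (2 * (t / n * sqrt (t / n))) + C2 * R n i"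
      using ri(2) unfolding C1_def C2_def R_def h .
  qed
  have EV: "(\<lambda>n. expectation (\<lambda>\<omega>. \<Sum>i<n. V n i \<omega>)) \<longlonglongrightarrow> 0"
  proof (rule Lim_null_comparison)
    \<comment> \<open>Summing \<open>n\<close> Taylor errors of size
      \<open>t / n * sqrt (t / n)\<close> leaves \<open>t * sqrt (t / n)\<close>; the local time
      errors are summed by \<open>local_time_off_zero_sum\<close>.\<close>
    have "(\<lambda>n. C1 * (2 * (t * sqrt (t / real n))) + C2 * (\<Sum>i<n. R n i)) \<longlonglongrightarrow> C1 * (2 * (t * 0)) + C2 * 0"
    proof (intro tendsto_intros)
      show "(\<lambda>n. sqrt (t / real n)) \<longlonglongrightarrow> 0" using t by real_asymp
      show "(\<lambda>n. \<Sum>i<n. R n i) \<longlonglongrightarrow> 0" unfolding R_def by (rule local_time_off_zero_sum[OF t])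
    qed
    then show "(\<lambda>n. C1 * (2 * (t * sqrt (t / real n))) + C2 * (\<Sum>i<n. R n i)) \<longlonglongrightarrow> 0" by simp
    show "\<forall>\<^sub>F n in sequentially. norm (expectation (\<lambda>\<omega>. \<Sum>i<n. V n i \<omega>)) \<le> C1 * (2 * (t * sqrt (t / real n))) + C2 * (\<Sum>i<n. R n i)"
      using eventually_gt_at_top[of 0]
    proof eventually_elim
      case (elim n)
      have "norm (expectation (\<lambda>\<omega>. \<Sum>i<n. V n i \<omega>)) = \<bar>\<Sum>i<n. expectation (V n i)\<bar>"
        using V_step(1) by (subst Bochner_Integration.integral_sum) auto
      also have "\<dots> \<le> (\<Sum>i<n. C1 * (2 * (t / n * sqrt (t / n))) + C2 * R n i)"
        using V_step(2) by (intro order_trans[OF sum_abs sum_mono]) auto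
      also have "\<dots> = C1 * (2 * (t * sqrt (t / real n))) + C2 * (\<Sum>i<n. R n i)"
        using elim by (simp add: sum.distrib sum_distrib_left)
      finally show ?case .
    qed
  qed
  have "expectation (S n) = expectation (U n) + expectation (\<lambda>\<omega>. \<Sum>i<n. V n i \<omega>)" for n
    unfolding SUV[abs_def] using Ui[of n] V_step(1) by (intro Bochner_Integration.integral_add) auto
  with tendsto_add[OF EU EV] have "(\<lambda>n. expectation (S n)) \<longlonglongrightarrow> 0" by simp
  with ES have lim: "expectation (\<lambda>\<omega>. exp (c * t) * p \<omega> (T \<omega>) - p \<omega> 0) = 0"
    by (rule LIMSEQ_unique)
  have p0m: "(\<lambda>\<omega>. p \<omega> 0) \<in> borel_measurable (P x)" using pm[of 1 0] by simp
  have p0: "expectation (\<lambda>\<omega>. p \<omega> 0) = robin \<beta> k x"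
  proof -
    have "expectation (\<lambda>\<omega>. p \<omega> 0) = expectation (\<lambda>_. robin \<beta> k x)"
      by (rule integral_cong_AE) (use p0m B_start[of x] in \<open>auto simp: p_def elim!: eventually_mono\<close>)
    then show ?thesis by (simp add: prob_space[unfolded space_P])
  qed
  have p0i: "integrable (P x) (\<lambda>\<omega>. p \<omega> 0)"
    using pK p0m by (intro integrable_const_bound[of _ K]) auto
  have pTm: "(\<lambda>\<omega>. p \<omega> (T \<omega>)) \<in> borel_measurable (P x)"
  proof -
    have "(\<lambda>\<omega>. exp (- (c * t)) * ((exp (c * t) * p \<omega> (T \<omega>) - p \<omega> 0) + p \<omega> 0)) \<in> borel_measurable (P x)"
      using Tm p0m by measurable
    then show ?thesis by (simp add: mult.assoc[symmetric] exp_add[symmetric])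
  qed
  have pTi: "integrable (P x) (\<lambda>\<omega>. p \<omega> (T \<omega>))"
    using pK pTm by (intro integrable_const_bound[of _ K]) auto
  have "exp (c * t) * expectation (\<lambda>\<omega>. p \<omega> (T \<omega>)) = robin \<beta> k x"
    using lim pTi p0i p0 by simp
  then have "expectation (\<lambda>\<omega>. p \<omega> (T \<omega>)) = exp (- (c * t)) * robin \<beta> k x"
    by (simp add: exp_minus field_simps)
  moreover have "p \<omega> (T \<omega>) = cos (k * sticky_bm B L \<gamma> t \<omega>) - \<gamma> / 2 * k * sin (k * sticky_bm B L \<gamma> t \<omega>)" for \<omega>
    by (simp add: p_def T_def robin_def sticky_bm_def \<beta>_def abs_real_def)
  moreover have "robin \<beta> k x = cos (k * x) - \<gamma> / 2 * k * sin (k * x)"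
    using x by (simp add: robin_def \<beta>_def)
  ultimately show ?thesis by (simp add: c_def)
qed

end

theorem corollary3p11:
  fixes A :: "'a measure" and P F :: "real \<Rightarrow> 'a measure"
    and B L :: "real \<Rightarrow> 'a \<Rightarrow> real" and \<theta> :: "real \<Rightarrow> 'a \<Rightarrow> 'a"
    and \<gamma> t x :: real and C :: "real set"
  assumes "brownian_local_time A P F B \<theta> L"
    and "\<gamma> > 0" and "t > 0" and "x \<ge> 0"
    and "C \<in> sets (restrict_space borel {0..})"
  shows "emeasure (sticky_kernel P B L \<gamma> t x) C =
      emeasure (density lborel (\<lambda>y. ennreal (dirichlet_kernel t x y))) C
    + emeasure (density lborel (\<lambda>y. ennreal (2 * g0 \<gamma> t (x + y)))) C
    + ennreal (\<gamma> * g0 \<gamma> t x) * emeasure (return borel 0) C"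
proof -
  interpret brownian_local_time A P F B \<theta> L by fact
  interpret prob_space "P x" by (rule prob_space_P)
  let ?X = "sticky_bm B L \<gamma> t"
  note X [measurable] = sticky_bm_measurable[OF assms(2,3), of x]
  note Q = sticky_law_real_distribution[OF assms(2-4)]
  have C: "C \<in> sets borel" "C \<subseteq> {0..}"
    using assms(5) by (auto simp: sets_restrict_space)
  \<comment> \<open>The comparison takes place on the whole line with \<open>borel\<close>, where
    characteristic functions are available; both laws put their mass on the half-line. The parameter
    of the transform is \<open>m = \<gamma> / 2\<close>.\<close>
  have "distr (P x) borel ?X = sticky_law \<gamma> t x"
  proof (rule robin_transform_uniqueness)
    show "0 < \<gamma> / 2" using assms by simp
    show "real_distribution (distr (P x) borel ?X)" by (rule real_distribution_distr) simp
    show "real_distribution (sticky_law \<gamma> t x)" by (rule Q)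
    show "AE y in distr (P x) borel ?X. 0 \<le> y"
      by (subst AE_distr_iff) (auto simp: sticky_bm_def)
    show "AE y in sticky_law \<gamma> t x. 0 \<le> y"
      unfolding sticky_law_def by (subst AE_distr_iff) auto
    show "(\<integral>y. cos (k * y) - \<gamma> / 2 * k * sin (k * y) \<partial>distr (P x) borel ?X)
        = (\<integral>y. cos (k * y) - \<gamma> / 2 * k * sin (k * y) \<partial>sticky_law \<gamma> t x)" for k
      unfolding sticky_law_robin_integral[OF assms(2-4)]
      using sticky_bm_robin_integral[OF assms(2-4), of k] by (simp add: integral_distr)
  qed
  \<comment> \<open>The kernel is a measure on the trace sigma-algebra of the half-line; its members
    are the Borel sets contained in it, so both image measures give \<open>C\<close> the same
    mass.\<close>
  moreover have "emeasure (sticky_kernel P B L \<gamma> t x) C = emeasure (distr (P x) borel ?X) C"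
  proof -
    have "?X \<in> measurable (P x) (restrict_space borel {0..})"
      by (rule measurable_restrict_space2) (auto simp: sticky_bm_def)
    then show ?thesis
      unfolding sticky_kernel_def using assms(5) C(1) by (simp add: emeasure_distr)
  qed
  ultimately show ?thesis using emeasure_sticky_law[OF assms(2-4) C] by simp
qed

end
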